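(* Suppose $0<f<1$ and $\nu>0$, and let $\Lambda=\sqrt{f(1-f)}$. There exist constants $C_k>0$ ($k$ ranging over the positive integers) such that for any given time $T>0$ and any $\epsilon>0$, the linearized system $$\begin{cases}\partial_t\mathbf{u}+(u_2,0,0)^{\intercal}+y\,\partial_x\mathbf{u}+f\,(-u_2,u_1,0)^{\intercal}=\nu\Delta\mathbf{u}-\nabla q,\qquad q=-\Delta^{-1}\bigl(2\partial_xu_2+f(\partial_yu_1-\partial_xu_2)\bigr),\\ \operatorname{div}\mathbf{u}=0\end{cases}$$ on $\mathbb{R}^3$, supplemented with initial data and with the far-field condition $\lim_{|\mathbf{x}|\to+\infty}|\mathbf{u}(t,\mathbf{x})|=0$, has a nonzero real-valued solution $\mathbf{u}^{T,\epsilon}$ with associated pressure $q^{T,\epsilon}$ such that $\mathbf{u}^{T,\epsilon}\in C([0,T];[H^k(\mathbb{R}^3)]^3)$ and $\nabla q^{T,\epsilon}\in C([0,T];[H^k(\mathbb{R}^3)]^3)$ for all $k\ge0$, $\operatorname{div}\mathbf{u}^{T,\epsilon}=0$, and: (i) for any $t\in[0,T]$, $$(e^{t\Lambda}-\epsilon)\|\mathbf{u}^{T,\epsilon}(0)\|_{L^2}\le\|\mathbf{u}^{T,\epsilon}(t)\|_{L^2}\le(e^{t\Lambda}+\epsilon)\|\mathbf{u}^{T,\epsilon}(0)\|_{L^2};$$ (ii) for any positive integer $k$, $$\|\mathbf{u}^{T,\epsilon}(0)\|_{H^k}\le C_k\|\mathbf{u}^{T,\epsilon}(0)\|_{L^2},$$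 where $C_k$ is independent of $T$ and $\epsilon$.
   Context: Points of $\mathbb{R}^3$ are written $\mathbf{x}=(x,y,z)$ and $\mathbf{u}=(u_1,u_2,u_3)$. The system is the linearization of the Navier--Stokes equations with Coriolis force about the Couette flow $(y,0,0)$. Operators such as $\nabla\Delta^{-1}\partial_j$ are understood as Fourier multipliers. *)

theory Defs
  imports "HOL-Analysis.Analysis"
begin

section \<open>Classical partial derivatives on three-dimensional space\<close>

definition partial :: "3 \<Rightarrow> (real^3 \<Rightarrow> 'a::real_normed_vector) \<Rightarrow> real^3 \<Rightarrow> 'a" where
  "partial j g x = frechet_derivative g (at x) (axis j 1)"

abbreviation partials :: "3 list \<Rightarrow> (real^3 \<Rightarrow> 'a::real_normed_vector) \<Rightarrow> real^3 \<Rightarrow> 'a" where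
  "partials js g \<equiv> foldr partial js g"

text \<open>Functions of class \<open>C\<^sup>n\<close>. Differentiability is demanded explicitly, because
  \<^const>\<open>frechet_derivative\<close> is unspecified where the derivative does not exist.\<close>

definition C_class :: "nat \<Rightarrow> (real^3 \<Rightarrow> 'a::real_normed_vector) \<Rightarrow> bool" where
  "C_class n g \<longleftrightarrow>
     (\<forall>js. length js < n \<longrightarrow> (\<forall>x. partials js g differentiable (at x))) \<and>
     (\<forall>js. length js \<le> n \<longrightarrow> continuous_on UNIV (partials js g))"

definition gradient :: "(real^3 \<Rightarrow> real) \<Rightarrow> real^3 \<Rightarrow> real^3" where
  "gradient g x = (\<chi> j. partial j g x)"

definition divergence :: "(real^3 \<Rightarrow> real^3) \<Rightarrow> real^3 \<Rightarrow> real" where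
  "divergence v x = (\<Sum>j\<in>UNIV. partial j v x $ j)"

definition laplacian :: "(real^3 \<Rightarrow> 'a::real_normed_vector) \<Rightarrow> real^3 \<Rightarrow> 'a" where
  "laplacian g x = (\<Sum>j\<in>UNIV. partial j (partial j g) x)"


section \<open>Fourier transform and Fourier multipliers\<close>

definition schwartz :: "(real^3 \<Rightarrow> complex) \<Rightarrow> bool" where
  "schwartz \<phi> \<longleftrightarrow> (\<forall>n. C_class n \<phi>) \<and>
     (\<forall>js N. \<exists>B. \<forall>x. (1 + norm x) ^ N * norm (partials js \<phi> x) \<le> B)"

definition fourier_integral :: "(real^3 \<Rightarrow> complex) \<Rightarrow> real^3 \<Rightarrow> complex" where
  "fourier_integral \<phi> \<xi> = (LINT x|lborel. cis (- (x \<bullet> \<xi>)) * \<phi> x)"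

text \<open>The Fourier transform in the sense of tempered distributions, for the case that both the
  distribution and its transform are given by functions. This covers \<open>L\<^sup>1\<close>, \<open>L\<^sup>2\<close>, and also
  functions outside \<open>L\<^sup>2\<close> such as the pressure, whose transform has a factor
  \<open>1 / |\<xi>|\<close> at the origin. The transform \<open>G\<close> is determined by \<open>g\<close> up to a null set.\<close>

definition has_fourier :: "(real^3 \<Rightarrow> complex) \<Rightarrow> (real^3 \<Rightarrow> complex) \<Rightarrow> bool" where
  "has_fourier g G \<longleftrightarrow> (\<forall>\<phi>. schwartz \<phi> \<longrightarrow>
     integrable lborel (\<lambda>x. g x * fourier_integral \<phi> x) \<and>
     integrable lborel (\<lambda>\<xi>. G \<xi> * \<phi> \<xi>) \<and>
     (LINT x|lborel. g x * fourier_integral \<phi> x) = (LINT \<xi>|lborel. G \<xi> * \<phi> \<xi>))"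

definition fourier :: "(real^3 \<Rightarrow> complex) \<Rightarrow> real^3 \<Rightarrow> complex" where
  "fourier g = (SOME G. has_fourier g G)"

text \<open>\<open>fourier_multiplier m h p\<close> says that \<open>p\<close> is the image of \<open>h\<close> under the Fourier
  multiplier with symbol \<open>m\<close>.\<close>

definition fourier_multiplier ::
    "(real^3 \<Rightarrow> complex) \<Rightarrow> (real^3 \<Rightarrow> real) \<Rightarrow> (real^3 \<Rightarrow> real) \<Rightarrow> bool" where
  "fourier_multiplier m h p \<longleftrightarrow> (\<exists>H. has_fourier (\<lambda>x. complex_of_real (h x)) H \<and>
     has_fourier (\<lambda>x. complex_of_real (p x)) (\<lambda>\<xi>. m \<xi> * H \<xi>))"

text \<open>\<open>inverse_laplacian h p\<close> says \<open>p = \<Delta>\<^sup>-\<^sup>1 h\<close>. The value of the symbol at \<open>\<xi> = 0\<close>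
  is immaterial.\<close>

definition inverse_laplacian :: "(real^3 \<Rightarrow> real) \<Rightarrow> (real^3 \<Rightarrow> real) \<Rightarrow> bool" where
  "inverse_laplacian = fourier_multiplier (\<lambda>\<xi>. complex_of_real (- 1 / (norm \<xi>)\<^sup>2))"


section \<open>Lebesgue and Sobolev norms of vector fields\<close>

definition L2_norm :: "(real^3 \<Rightarrow> real^3) \<Rightarrow> real" where
  "L2_norm v = sqrt (LINT x|lborel. (norm (v x))\<^sup>2)"

definition sobolev_scalar :: "nat \<Rightarrow> (real^3 \<Rightarrow> complex) \<Rightarrow> bool" where
  "sobolev_scalar k g \<longleftrightarrow>
     g \<in> borel_measurable lborel \<and> integrable lborel (\<lambda>x. (norm (g x))\<^sup>2) \<and>
     (\<exists>G. has_fourier g G \<and>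
       integrable lborel (\<lambda>\<xi>. (1 + (norm \<xi>)\<^sup>2) ^ k * (norm (G \<xi>))\<^sup>2))"

text \<open>The factor \<open>(2\<pi>)\<^sup>3\<close> comes from Plancherel's identity for the convention of
  \<open>fourier_integral\<close>, so that the norm for \<open>k = 0\<close> is the \<open>L\<^sup>2\<close> norm.\<close>

definition sobolev_norm_scalar :: "nat \<Rightarrow> (real^3 \<Rightarrow> complex) \<Rightarrow> real" where
  "sobolev_norm_scalar k g =
     sqrt ((LINT \<xi>|lborel. (1 + (norm \<xi>)\<^sup>2) ^ k * (norm (fourier g \<xi>))\<^sup>2) / (2 * pi) ^ 3)"

abbreviation component :: "(real^3 \<Rightarrow> real^3) \<Rightarrow> 3 \<Rightarrow> real^3 \<Rightarrow> complex" where
  "component v j \<equiv> (\<lambda>x. complex_of_real (v x $ j))"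

definition sobolev :: "nat \<Rightarrow> (real^3 \<Rightarrow> real^3) \<Rightarrow> bool" where
  "sobolev k v \<longleftrightarrow> (\<forall>j. sobolev_scalar k (component v j))"

definition sobolev_norm :: "nat \<Rightarrow> (real^3 \<Rightarrow> real^3) \<Rightarrow> real" where
  "sobolev_norm k v = sqrt (\<Sum>j\<in>UNIV. (sobolev_norm_scalar k (component v j))\<^sup>2)"

text \<open>Membership in \<open>C([0,T]; [H\<^sup>k]\<^sup>3)\<close>.\<close>

definition C_sobolev :: "real \<Rightarrow> nat \<Rightarrow> (real \<Rightarrow> real^3 \<Rightarrow> real^3) \<Rightarrow> bool" where
  "C_sobolev T k u \<longleftrightarrow> (\<forall>t\<in>{0..T}. sobolev k (u t) \<and>
     ((\<lambda>s. sobolev_norm k (\<lambda>x. u s x - u t x)) \<longlongrightarrow> 0) (at t within {0..T}))"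


section \<open>The linearized Navier--Stokes--Coriolis system about the Couette flow\<close>

text \<open>The equations hold pointwise on \<open>[0,T] \<times> \<real>\<^sup>3\<close>, with one-sided time derivatives at the
  end points. For fields that are continuous in time with values in every \<open>H\<^sup>k\<close>, this is
  the same as the distributional formulation, up to the choice of the continuous representative.\<close>

definition linearized_solution ::
    "real \<Rightarrow> real \<Rightarrow> real \<Rightarrow> (real \<Rightarrow> real^3 \<Rightarrow> real^3) \<Rightarrow> (real \<Rightarrow> real^3 \<Rightarrow> real) \<Rightarrow> bool" where
  "linearized_solution f \<nu> T u q \<longleftrightarrow> (\<forall>t\<in>{0..T}.
     C_class 2 (u t) \<and> C_class 1 (q t) \<and>
     (\<forall>x. (\<lambda>s. u s x) differentiable (at t within {0..T}) \<and>
       vector_derivative (\<lambda>s. u s x) (at t within {0..T})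
         + vector [u t x $ 2, 0, 0]
         + (x $ 2) *\<^sub>R partial 1 (u t) x
         + f *\<^sub>R vector [- (u t x $ 2), u t x $ 1, 0]
       = \<nu> *\<^sub>R laplacian (u t) x - gradient (q t) x) \<and>
     inverse_laplacian
       (\<lambda>x. 2 * partial 1 (u t) x $ 2 + f * (partial 2 (u t) x $ 1 - partial 1 (u t) x $ 2))
       (\<lambda>x. - q t x) \<and>
     (\<forall>x. divergence (u t) x = 0) \<and>
     ((\<lambda>x. norm (u t x)) \<longlongrightarrow> 0) at_infinity)"

end

theory Submission
  imports Defs "HOL-Probability.Characteristic_Functions" "HOL-Probability.Sinc_Integral"
begin

text \<open>A plane wave carried by the shear \<open>y \<partial>\<^sub>x\<close> keeps its form while its wave vector moves:
the mode labelled by \<open>\<xi>\<close> has at time \<open>t\<close> the wave vector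
\<open>\<eta> = (\<xi>\<^sub>1, \<xi>\<^sub>2 - t \<xi>\<^sub>1, \<xi>\<^sub>3)\<close>, and its amplitude obeys a linear ordinary differential equation
whose coefficients are functions of \<open>\<eta> / |\<eta>|\<close>, apart from the damping \<open>\<nu> |\<eta>|\<^sup>2\<close>. As \<open>\<eta>\<close> tends to
zero along the third axis, damping and pressure disappear from the first two components and
what remains is \<open>v\<^sub>1' = - (1 - f) v\<^sub>2\<close>, \<open>v\<^sub>2' = - f v\<^sub>1\<close>. This limit system has the solution
\<open>e\<^sup>\<Lambda>\<^sup>t (\<surd>(1 - f), - \<surd>f)\<close> with \<open>\<Lambda> = \<surd>(f (1 - f))\<close>, and incompressibility makes the third
component small. Hence, given \<open>T\<close> and \<open>\<epsilon>\<close>, all modes whose label lies in a sufficiently small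
box close to the third axis and close to the origin grow like \<open>e\<^sup>\<Lambda>\<^sup>t\<close> up to an error \<open>\<epsilon>\<close> during
\<open>[0,T]\<close> (\<open>growing_mode_exists\<close>). The modes, continuous in \<open>\<xi>\<close>, come from a fixed point argument
(\<open>lipschitz_ode_with_parameter\<close>), and they are compared with the limit solution by an energy
inequality (\<open>perturbed_growth_bound\<close>).

The solution is the superposition of these modes, weighted by a bump function on the box and
symmetrised under \<open>\<xi> \<mapsto> - \<xi>\<close> so that it is real (locale \<open>wave_packet\<close>). By Plancherel the growth
of every single mode becomes the growth of the \<open>L\<^sup>2\<close> norm. The Sobolev bound comes for free:
all frequencies have length at most 1, so \<open>(1 + |\<eta>|\<^sup>2)\<^sup>k \<le> 2\<^sup>k\<close>, whatever \<open>T\<close> and \<open>\<epsilon>\<close> are.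

The amplitudes are continuous and compactly supported in frequency. The fields are therefore
smooth with bounded derivatives, but continuity of the amplitudes does not make the fields
integrable. Their decay at infinity is the Riemann-Lebesgue lemma
(\<open>synthesis_tendsto_0\<close>), and their Fourier transform in the sense of distributions is
identified through Parseval's identity (\<open>has_fourier_synthesis\<close>), in which both factors are
square integrable. Since the Sobolev norm refers to an arbitrarily chosen Fourier transform,
the transform must also be shown to be unique almost everywhere (\<open>has_fourier_unique\<close>).
Plancherel, Parseval and uniqueness all rest on one device: multiplication by a wide Gaussian
on one side is convolution with a narrow Gaussian on the other.\<close>

section \<open>Gaussians and their Fourier transform\<close>

text \<open>Lebesgue measure on a Euclidean space is the product of one-dimensional Lebesgue measures, so a
product of functions of the single coordinates is integrated coordinate by coordinate.\<close>

lemma lborel_product_integral: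
  fixes f :: "'a::euclidean_space \<Rightarrow> real \<Rightarrow> complex"
  assumes "\<And>b. b \<in> Basis \<Longrightarrow> integrable lborel (f b)"
  shows "integrable lborel (\<lambda>x::'a. \<Prod>b\<in>Basis. f b (x \<bullet> b))"
    and "(LINT x|lborel. (\<Prod>b\<in>Basis. f b (x \<bullet> b))) = (\<Prod>b\<in>Basis. LINT s|lborel. f b s)"
proof -
  interpret product_sigma_finite "\<lambda>_::'a. lborel :: real measure"
    by standard
  have [measurable]: "f b \<in> borel_measurable borel" if "b \<in> Basis" for b
    using borel_measurable_integrable[OF assms[OF that]] by simp
  have m: "(\<lambda>f. \<Sum>b\<in>Basis. f b *\<^sub>R b) \<in> (\<Pi>\<^sub>M b\<in>(Basis::'a set). (lborel :: real measure)) \<rightarrow>\<^sub>M borel"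
    by measurable
  have m2: "(\<lambda>x::'a. \<Prod>b\<in>Basis. f b (x \<bullet> b)) \<in> borel_measurable borel"
    by measurable
  have e: "(\<Prod>b\<in>Basis. f b ((\<Sum>b\<in>Basis. w b *\<^sub>R b) \<bullet> b)) = (\<Prod>b\<in>Basis. f b (w b))" for w :: "'a \<Rightarrow> real"
    by (intro prod.cong) auto
  show "integrable lborel (\<lambda>x::'a. \<Prod>b\<in>Basis. f b (x \<bullet> b))"
    by (subst lborel_eq, subst integrable_distr_eq[OF m m2], unfold e)
       (intro product_integrable_prod assms finite_Basis)
  show "(LINT x|lborel. (\<Prod>b\<in>Basis. f b (x \<bullet> b))) = (\<Prod>b\<in>Basis. LINT s|lborel. f b s)"
    by (subst lborel_eq, subst integral_distr[OF m m2], unfold e)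
       (intro product_integral_prod assms finite_Basis)
qed

lemma lborel_integral_affine:
  fixes f :: "'a::euclidean_space \<Rightarrow> 'b::{banach, second_countable_topology}"
  assumes "c \<noteq> 0" and f [measurable]: "f \<in> borel_measurable borel"
  shows "(LINT x|lborel. f x) = \<bar>c\<bar> ^ DIM('a) *\<^sub>R (LINT x|lborel. f (t + c *\<^sub>R x))"
  by (subst lborel_affine[OF assms(1), of t])
     (simp add: integral_density integral_distr)

lemma lborel_integrable_affine:
  fixes f :: "'a::euclidean_space \<Rightarrow> 'b::{banach, second_countable_topology}"
  assumes "c \<noteq> 0" and "integrable lborel f"
  shows "integrable lborel (\<lambda>x. f (t + c *\<^sub>R x))"
proof -
  have [measurable]: "f \<in> borel_measurable borel" using assms(2) by auto
  have "integrable (density (distr lborel borel (\<lambda>x. t + c *\<^sub>R x)) (\<lambda>_. ennreal (\<bar>c\<bar> ^ DIM('a)))) f"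
    using lborel_affine[OF assms(1), of t] assms(2) by (simp flip: ennreal_power)
  then have "integrable (distr lborel borel (\<lambda>x. t + c *\<^sub>R x)) (\<lambda>x. \<bar>c\<bar> ^ DIM('a) *\<^sub>R f x)"
    by (subst (asm) integrable_density) auto
  then have "integrable (distr lborel borel (\<lambda>x. t + c *\<^sub>R x)) f"
    using integrable_scaleR_right[of "inverse (\<bar>c\<bar> ^ DIM('a))"] assms(1) by fastforce
  then show ?thesis by (simp add: integrable_distr_eq)
qed

lemma measurable_cis [measurable]: "cis \<in> borel_measurable borel"
  by (intro borel_measurable_continuous_onI continuous_intros)

definition gauss :: "real^3 \<Rightarrow> real" where
  "gauss z = (\<Prod>b\<in>Basis. std_normal_density (z \<bullet> b))"

lemma sum_exponent: "(\<Sum>b\<in>Basis. - (z \<bullet> b)\<^sup>2 / 2) = - (z \<bullet> z) / 2" for z :: "'a::euclidean_space"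
proof -
  have "z \<bullet> z = (\<Sum>b\<in>Basis. (z \<bullet> b)\<^sup>2)"
    by (subst euclidean_inner) (simp add: power2_eq_square)
  then show ?thesis by (simp add: sum_negf sum_divide_distrib)
qed

lemma gauss_eq: "gauss z = exp (- (z \<bullet> z) / 2) / sqrt (2 * pi) ^ 3"
proof -
  have "gauss z = (\<Prod>b\<in>(Basis::(real^3) set). (1 / sqrt (2*pi)) * exp (- (z \<bullet> b)\<^sup>2 / 2))"
    by (simp add: gauss_def std_normal_density_def)
  also have "\<dots> = (1 / sqrt (2*pi)) ^ 3 * exp (\<Sum>b\<in>(Basis::(real^3) set). - (z \<bullet> b)\<^sup>2 / 2)"
    by (simp add: prod_dividef exp_sum power_divide)
  also have "(\<Sum>b\<in>(Basis::(real^3) set). - (z \<bullet> b)\<^sup>2 / 2) = - (z \<bullet> z) / 2"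
    by (rule sum_exponent)
  finally show ?thesis by (simp add: power_divide)
qed

lemma continuous_gauss [continuous_intros]: "continuous_on S g \<Longrightarrow> continuous_on S (\<lambda>x. gauss (g x))"
  unfolding gauss_eq by (intro continuous_intros) auto

lemma measurable_gauss [measurable]: "gauss \<in> borel_measurable borel"
  using continuous_gauss[of UNIV "\<lambda>x. x"] by (auto intro: borel_measurable_continuous_onI)

lemma gauss_pos: "gauss z > 0" by (simp add: gauss_eq)

lemma gauss_le_1: "gauss z \<le> 1"
proof -
  have "exp (- (z \<bullet> z) / 2) \<le> 1" by simp
  also have "1 \<le> sqrt (2 * pi) ^ 3" using pi_gt3 by (intro one_le_power) simp
  finally show ?thesis by (simp add: gauss_eq)
qed

text \<open>The integral factorises into values of the characteristic function of the standard normal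
distribution.\<close>

lemma gauss_fourier:
  "integrable lborel (\<lambda>z. gauss z * cis (z \<bullet> \<xi>))"
  "(LINT z|lborel. gauss z * cis (z \<bullet> \<xi>)) = exp (- (\<xi> \<bullet> \<xi>) / 2)"
proof -
  let ?f = "\<lambda>b s. complex_of_real (std_normal_density s) * cis (s * (\<xi> \<bullet> b))"
  have i: "integrable lborel (?f b)" for b
  proof (rule Bochner_Integration.integrable_bound)
    show "integrable lborel std_normal_density"
      by (rule integrable_normal_density) simp
  qed (auto simp: norm_mult)
  have e: "complex_of_real (gauss z) * cis (z \<bullet> \<xi>) = (\<Prod>b\<in>Basis. ?f b (z \<bullet> b))" for z
  proof -
    have "cis (z \<bullet> \<xi>) = (\<Prod>b\<in>Basis. cis ((z \<bullet> b) * (\<xi> \<bullet> b)))"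
      by (subst euclidean_inner) (simp add: cis_conv_exp sum_distrib_left exp_sum)
    then show ?thesis by (simp add: gauss_def prod.distrib)
  qed
  have c: "(LINT s|lborel. ?f b s) = exp (- (\<xi> \<bullet> b)\<^sup>2 / 2)" for b
  proof -
    have "(LINT s|lborel. ?f b s) = char std_normal_distribution (\<xi> \<bullet> b)"
      unfolding char_def
      by (subst integral_density) (auto simp: cis_conv_exp scaleR_conv_of_real mult_ac)
    then show ?thesis by (simp add: char_std_normal_distribution)
  qed
  show "integrable lborel (\<lambda>z. gauss z * cis (z \<bullet> \<xi>))"
    unfolding e by (intro lborel_product_integral i)
  have "(LINT z|lborel. gauss z * cis (z \<bullet> \<xi>)) = (\<Prod>b\<in>(Basis::(real^3) set). complex_of_real (exp (- (\<xi> \<bullet> b)\<^sup>2 / 2)))"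
    unfolding e by (subst lborel_product_integral(2)) (auto intro: i simp: c)
  also have "\<dots> = complex_of_real (exp (\<Sum>b\<in>(Basis::(real^3) set). - (\<xi> \<bullet> b)\<^sup>2 / 2))"
    by (simp only: exp_sum finite_Basis of_real_prod)
  also have "(\<Sum>b\<in>(Basis::(real^3) set). - (\<xi> \<bullet> b)\<^sup>2 / 2) = - (\<xi> \<bullet> \<xi>) / 2"
    by (rule sum_exponent)
  finally show "(LINT z|lborel. gauss z * cis (z \<bullet> \<xi>)) = exp (- (\<xi> \<bullet> \<xi>) / 2)" .
qed

lemma integrable_gauss: "integrable lborel gauss"
proof -
  have "integrable lborel (\<lambda>z. norm (complex_of_real (gauss z) * cis (z \<bullet> 0)))"
    by (intro integrable_norm gauss_fourier)
  then show ?thesis using gauss_pos by (simp add: norm_mult less_imp_le)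
qed

lemma integral_gauss: "(LINT z|lborel. gauss z) = 1"
proof -
  have "complex_of_real (LINT z|lborel. gauss z) = (LINT z|lborel. complex_of_real (gauss z))"
    by simp
  also have "\<dots> = 1" using gauss_fourier(2)[of 0] by simp
  finally show ?thesis by (metis of_real_eq_1_iff)
qed

text \<open>The product \<open>a x * b y\<close> is integrable on the product space and dominates the integrand, so Fubini's
theorem applies.\<close>

lemma kernel_swap:
  fixes a b :: "'a::euclidean_space \<Rightarrow> complex"
  assumes a: "integrable lborel a" and b: "integrable lborel b"
    and k: "(\<lambda>(x, y). k x y) \<in> borel_measurable (borel \<Otimes>\<^sub>M borel)" and bd: "\<And>x y. norm (k x y) \<le> 1"
  shows "(LINT x|lborel. a x * (LINT y|lborel. k x y * b y)) = (LINT y|lborel. b y * (LINT x|lborel. k x y * a x))"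
proof -
  have [measurable]: "a \<in> borel_measurable borel" "b \<in> borel_measurable borel"
    using a b by auto
  note k[measurable]
  have ab: "integrable (lborel \<Otimes>\<^sub>M lborel) (\<lambda>(x, y). a x * b y)"
    by (rule lborel_pair.Fubini_integrable) (use a b in \<open>auto simp: norm_mult\<close>)
  have "integrable (lborel \<Otimes>\<^sub>M lborel) (\<lambda>(x, y). k x y * (a x * b y))"
  proof (rule Bochner_Integration.integrable_bound[OF ab])
    show "(\<lambda>(x, y). k x y * (a x * b y)) \<in> borel_measurable (lborel \<Otimes>\<^sub>M lborel)"
      by measurable
  qed (auto simp: norm_mult split_beta intro!: mult_left_le_one_le bd AE_I2)
  from lborel_pair.Fubini_integral[OF this]
  have "(LINT y|lborel. LINT x|lborel. k x y * (a x * b y)) = (LINT x|lborel. LINT y|lborel. k x y * (a x * b y))" .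
  then show ?thesis
    by (simp add: mult_ac flip: integral_mult_right_zero integral_mult_left_zero)
qed

section \<open>The Plancherel and Parseval identities\<close>

text \<open>The inverse Fourier transform without its normalising factor.\<close>

definition synthesis :: "(real^3 \<Rightarrow> complex) \<Rightarrow> real^3 \<Rightarrow> complex" where
  "synthesis G x = (LINT \<eta>|lborel. cis (x \<bullet> \<eta>) * G \<eta>)"

lemma fourier_integral_eq_synthesis: "fourier_integral G x = synthesis G (- x)"
  by (simp add: fourier_integral_def synthesis_def inner_commute)

lemma integrable_cis_mult:
  assumes "integrable lborel G" "g \<in> borel_measurable borel"
  shows "integrable lborel (\<lambda>x. cis (g x) * (G x :: complex))"
proof (rule Bochner_Integration.integrable_bound[OF assms(1)])
  show "(\<lambda>x. cis (g x) * G x) \<in> borel_measurable lborel"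
    using assms by measurable
qed (auto simp: norm_mult)

lemma measurable_synthesis [measurable]:
  assumes [measurable]: "G \<in> borel_measurable borel"
  shows "synthesis G \<in> borel_measurable borel"
  unfolding synthesis_def[abs_def]
  by (rule lborel.borel_measurable_lebesgue_integral) measurable

lemma norm_synthesis_le: "norm (synthesis G x) \<le> (LINT \<eta>|lborel. norm (G \<eta>))"
  unfolding synthesis_def
  by (rule order_trans[OF integral_norm_bound]) (simp add: norm_mult)

text \<open>Convolution of \<open>F\<close> with the Gaussian density of width \<open>\<epsilon>\<close>, written with the substitution
\<open>y = \<xi> - \<epsilon> z\<close>. In this form the limit \<open>\<epsilon> \<longrightarrow> 0\<close> is immediate by dominated convergence.\<close>

definition mollify :: "real \<Rightarrow> (real^3 \<Rightarrow> complex) \<Rightarrow> real^3 \<Rightarrow> complex" where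
  "mollify \<epsilon> F \<xi> = (LINT z|lborel. complex_of_real (gauss z) * F (\<xi> - \<epsilon> *\<^sub>R z))"

lemma measurable_mollify [measurable]:
  assumes [measurable]: "F \<in> borel_measurable borel"
  shows "mollify \<epsilon> F \<in> borel_measurable borel"
  unfolding mollify_def[abs_def]
  by (rule lborel.borel_measurable_lebesgue_integral) measurable

lemma integrable_gauss_mult:
  assumes [measurable]: "F \<in> borel_measurable borel" and "\<And>x. norm (F x) \<le> B"
  shows "integrable lborel (\<lambda>z. complex_of_real (gauss z) * (F z :: complex))"
proof (rule Bochner_Integration.integrable_bound)
  show "integrable lborel (\<lambda>z. B * gauss z)" using integrable_gauss by simp
  have "0 \<le> B" using assms(2)[of 0] norm_ge_zero order_trans by blast
  then show "AE z in lborel. norm (complex_of_real (gauss z) * F z) \<le> norm (B * gauss z)"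
    using assms(2) gauss_pos by (auto simp: norm_mult abs_mult less_imp_le intro!: AE_I2)
qed simp

lemma norm_mollify_le:
  assumes [measurable]: "F \<in> borel_measurable borel" and B: "\<And>x. norm (F x) \<le> B"
  shows "norm (mollify \<epsilon> F \<xi>) \<le> B"
proof -
  have "norm (mollify \<epsilon> F \<xi>) \<le> (LINT z|lborel. norm (complex_of_real (gauss z) * F (\<xi> - \<epsilon> *\<^sub>R z)))"
    unfolding mollify_def by (rule integral_norm_bound)
  also have "\<dots> \<le> (LINT z|lborel. gauss z * B)"
    using gauss_pos integrable_gauss
    by (intro integral_mono integrable_norm integrable_gauss_mult[where B = B])
       (auto simp: norm_mult less_imp_le B intro!: mult_left_mono)
  finally show ?thesis by (simp add: integral_gauss)
qed

lemma mollify_tendsto: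
  assumes c: "continuous_on UNIV F" and B: "\<And>x. norm (F x) \<le> B" and \<epsilon>: "\<epsilon> \<longlonglongrightarrow> 0"
  shows "(\<lambda>n. mollify (\<epsilon> n) F \<xi>) \<longlonglongrightarrow> F \<xi>"
proof -
  have [measurable]: "F \<in> borel_measurable borel"
    using c by (rule borel_measurable_continuous_onI)
  have B0: "0 \<le> B" using B[of 0] norm_ge_zero order_trans by blast
  have "(\<lambda>n. LINT z|lborel. complex_of_real (gauss z) * F (\<xi> - \<epsilon> n *\<^sub>R z)) \<longlonglongrightarrow> (LINT z|lborel. complex_of_real (gauss z) * F \<xi>)"
  proof (rule integral_dominated_convergence[where w = "\<lambda>z. B * gauss z"])
    show "AE z in lborel. (\<lambda>n. complex_of_real (gauss z) * F (\<xi> - \<epsilon> n *\<^sub>R z)) \<longlonglongrightarrow> complex_of_real (gauss z) * F \<xi>"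
    proof (rule AE_I2)
      fix z
      have "(\<lambda>n. \<xi> - \<epsilon> n *\<^sub>R z) \<longlonglongrightarrow> \<xi> - 0 *\<^sub>R z" by (intro tendsto_intros \<epsilon>)
      then have "(\<lambda>n. F (\<xi> - \<epsilon> n *\<^sub>R z)) \<longlonglongrightarrow> F \<xi>"
        using continuous_on_tendsto_compose[OF c, of _ \<xi>] by simp
      then show "(\<lambda>n. complex_of_real (gauss z) * F (\<xi> - \<epsilon> n *\<^sub>R z)) \<longlonglongrightarrow> complex_of_real (gauss z) * F \<xi>"
        by (intro tendsto_intros)
    qed
  qed (use integrable_gauss B B0 gauss_pos in
      \<open>auto simp: norm_mult less_imp_le mult.commute intro!: AE_I2 mult_right_mono\<close>)
  also have "(LINT z|lborel. complex_of_real (gauss z) * F \<xi>) = F \<xi>"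
    using integral_gauss by simp
  finally show ?thesis by (simp add: mollify_def)
qed

definition damping :: "real \<Rightarrow> real^3 \<Rightarrow> real" where
  "damping \<epsilon> x = exp (- (\<epsilon>\<^sup>2 * (x \<bullet> x)) / 2)"

lemma damping_eq: "damping \<epsilon> x = sqrt (2 * pi) ^ 3 * gauss (\<epsilon> *\<^sub>R x)"
  by (simp add: damping_def gauss_eq power2_eq_square mult_ac)

lemma damping_pos: "damping \<epsilon> x > 0"
  by (simp add: damping_def)

lemma damping_le_1: "damping \<epsilon> x \<le> 1"
  by (simp add: damping_def)

lemma measurable_damping [measurable]: "damping \<epsilon> \<in> borel_measurable borel"
  unfolding damping_def[abs_def] by measurable

lemma integrable_damping: "\<epsilon> > 0 \<Longrightarrow> integrable lborel (damping \<epsilon>)"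
  unfolding damping_eq[abs_def]
  using lborel_integrable_affine[OF _ integrable_gauss, of \<epsilon> 0] by simp

text \<open>A wide Gaussian is transformed into a narrow one: up to the factor \<open>(2 \<pi>)\<^sup>3\<close>, the right hand side
is the convolution kernel of \<open>mollify\<close>.\<close>

lemma damping_fourier:
  assumes "\<epsilon> > 0"
  shows "(LINT x|lborel. complex_of_real (damping \<epsilon> x) * cis (x \<bullet> w)) = (2 * pi) ^ 3 / \<epsilon> ^ 3 * gauss (w /\<^sub>R \<epsilon>)"
proof -
  let ?s = "complex_of_real (sqrt (2 * pi) ^ 3)"
  have s: "sqrt (2 * pi) ^ 6 = 8 * pi ^ 3"
    using power_mult[of "sqrt (2 * pi)" 2 3] by (simp add: power_mult_distrib)
  have "(LINT x|lborel. complex_of_real (damping \<epsilon> x) * cis (x \<bullet> w))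
      = \<bar>1 / \<epsilon>\<bar> ^ DIM(real^3) *\<^sub>R (LINT x|lborel. complex_of_real (damping \<epsilon> (0 + (1 / \<epsilon>) *\<^sub>R x)) * cis ((0 + (1 / \<epsilon>) *\<^sub>R x) \<bullet> w))"
    using assms by (intro lborel_integral_affine) auto
  also have "(LINT x|lborel. complex_of_real (damping \<epsilon> (0 + (1 / \<epsilon>) *\<^sub>R x)) * cis ((0 + (1 / \<epsilon>) *\<^sub>R x) \<bullet> w))
      = ?s * (LINT x|lborel. gauss x * cis (x \<bullet> (w /\<^sub>R \<epsilon>)))"
    using assms by (simp add: damping_eq divide_inverse mult_ac flip: integral_mult_right_zero integral_mult_left_zero)
  also have "(LINT x|lborel. gauss x * cis (x \<bullet> (w /\<^sub>R \<epsilon>))) = sqrt (2 * pi) ^ 3 * gauss (w /\<^sub>R \<epsilon>)"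
    by (subst gauss_fourier(2)) (simp add: gauss_eq)
  finally show ?thesis
    using assms by (simp add: scaleR_conv_of_real s power_divide flip: of_real_mult of_real_power mult.assoc)
qed

text \<open>The integrals defining \<open>synthesis G\<close> and \<open>fourier_integral F\<close> are pulled out one after the
other; this is legitimate because of the damping factor. The inner integral that is left is
the transform of the damping factor.\<close>

lemma regularised_parseval:
  assumes G: "integrable lborel G" and F: "integrable lborel F" and \<epsilon>: "\<epsilon> > 0"
  shows "(LINT x|lborel. complex_of_real (damping \<epsilon> x) * (synthesis G x * fourier_integral F x))
    = (2 * pi) ^ 3 * (LINT \<xi>|lborel. G \<xi> * mollify \<epsilon> F \<xi>)"
proof -
  have [measurable]: "G \<in> borel_measurable borel" "F \<in> borel_measurable borel" using F G by auto
  \<comment> \<open>The damping makes \<open>a\<close> integrable, which \<open>fourier_integral F\<close> need not be.\<close>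
  define a where "a x = complex_of_real (damping \<epsilon> x) * fourier_integral F x" for x
  have fm [measurable]: "fourier_integral F \<in> borel_measurable borel"
    unfolding fourier_integral_eq_synthesis[abs_def] by measurable
  have am: "a \<in> borel_measurable lborel" unfolding a_def by measurable
  have a: "integrable lborel a"
  proof (rule Bochner_Integration.integrable_bound[OF _ am])
    show "integrable lborel (\<lambda>x. damping \<epsilon> x * (LINT \<eta>|lborel. norm (F \<eta>)))"
      using integrable_damping[OF \<epsilon>] by simp
    show "AE x in lborel. norm (a x) \<le> norm (damping \<epsilon> x * (LINT \<eta>|lborel. norm (F \<eta>)))"
      using damping_pos norm_synthesis_le[of F]
      by (auto simp: a_def norm_mult fourier_integral_eq_synthesis less_imp_le abs_mult intro!: AE_I2 mult_left_mono order_trans[OF norm_synthesis_le])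
  qed
  have "(LINT x|lborel. complex_of_real (damping \<epsilon> x) * (synthesis G x * fourier_integral F x))
      = (LINT x|lborel. a x * (LINT \<xi>|lborel. cis (x \<bullet> \<xi>) * G \<xi>))"
    by (simp add: a_def synthesis_def mult_ac)
  also have "\<dots> = (LINT \<xi>|lborel. G \<xi> * (LINT x|lborel. cis (x \<bullet> \<xi>) * a x))"
    by (rule kernel_swap[OF a G]) simp_all
  also have "(\<lambda>\<xi>. LINT x|lborel. cis (x \<bullet> \<xi>) * a x) = (\<lambda>\<xi>. (2 * pi) ^ 3 * mollify \<epsilon> F \<xi>)"
  proof
    fix \<xi>
    have d: "integrable lborel (\<lambda>x. cis (x \<bullet> \<xi>) * complex_of_real (damping \<epsilon> x))"
      using integrable_damping[OF \<epsilon>] by (intro integrable_cis_mult integrable_of_real) auto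
    have "(LINT x|lborel. cis (x \<bullet> \<xi>) * a x)
        = (LINT x|lborel. (cis (x \<bullet> \<xi>) * complex_of_real (damping \<epsilon> x)) * (LINT y|lborel. cis (- (y \<bullet> x)) * F y))"
      by (simp add: a_def fourier_integral_def mult_ac)
    also have "\<dots> = (LINT y|lborel. F y * (LINT x|lborel. cis (- (y \<bullet> x)) * (cis (x \<bullet> \<xi>) * complex_of_real (damping \<epsilon> x))))"
      by (rule kernel_swap[OF d F]) simp_all
    also have "\<dots> = (LINT y|lborel. F y * (LINT x|lborel. complex_of_real (damping \<epsilon> x) * cis (x \<bullet> (\<xi> - y))))"
    proof -
      have "cis (- (y \<bullet> x)) * (cis (x \<bullet> \<xi>) * complex_of_real (damping \<epsilon> x)) = complex_of_real (damping \<epsilon> x) * cis (x \<bullet> (\<xi> - y))" for x y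
        by (simp add: cis_mult inner_diff_right inner_commute flip: mult.assoc)
      then show ?thesis by (simp only:)
    qed
    also have "\<dots> = (LINT y|lborel. F y * ((2 * pi) ^ 3 / \<epsilon> ^ 3 * gauss ((\<xi> - y) /\<^sub>R \<epsilon>)))"
      by (subst damping_fourier[OF \<epsilon>]) simp
    also have "\<dots> = \<bar>- \<epsilon>\<bar> ^ DIM(real^3) *\<^sub>R (LINT z|lborel. F (\<xi> + (- \<epsilon>) *\<^sub>R z) * ((2 * pi) ^ 3 / \<epsilon> ^ 3 * gauss ((\<xi> - (\<xi> + (- \<epsilon>) *\<^sub>R z)) /\<^sub>R \<epsilon>)))"
      using \<epsilon> by (intro lborel_integral_affine) auto
    also have "\<dots> = \<epsilon> ^ 3 *\<^sub>R (LINT z|lborel. (2 * pi) ^ 3 / \<epsilon> ^ 3 * (complex_of_real (gauss z) * F (\<xi> - \<epsilon> *\<^sub>R z)))"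
      using \<epsilon> by (simp add: mult_ac)
    also have "\<dots> = (2 * pi) ^ 3 * mollify \<epsilon> F \<xi>"
      using \<epsilon> by (simp add: mollify_def scaleR_conv_of_real)
    finally show "(LINT x|lborel. cis (x \<bullet> \<xi>) * a x) = (2 * pi) ^ 3 * mollify \<epsilon> F \<xi>" .
  qed
  finally show ?thesis by (simp add: mult.left_commute flip: integral_mult_right_zero)
qed

lemma mollified_pairing_tendsto:
  assumes G: "integrable lborel G" and F: "continuous_on UNIV F" "\<And>x. norm (F x) \<le> B" and \<epsilon>: "\<epsilon> \<longlonglongrightarrow> 0"
  shows "(\<lambda>n. LINT \<xi>|lborel. G \<xi> * mollify (\<epsilon> n) F \<xi>) \<longlonglongrightarrow> (LINT \<xi>|lborel. G \<xi> * F \<xi>)"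
proof (rule integral_dominated_convergence[where w = "\<lambda>\<xi>. norm (G \<xi>) * B"])
  have [measurable]: "F \<in> borel_measurable borel"
    using F(1) by (rule borel_measurable_continuous_onI)
  have [measurable]: "G \<in> borel_measurable borel" using G by auto
  show "(\<lambda>\<xi>. G \<xi> * F \<xi>) \<in> borel_measurable lborel" "(\<lambda>\<xi>. G \<xi> * mollify (\<epsilon> n) F \<xi>) \<in> borel_measurable lborel" for n
    by measurable
  show "AE \<xi> in lborel. norm (G \<xi> * mollify (\<epsilon> n) F \<xi>) \<le> norm (G \<xi>) * B" for n
    using F(2) by (auto simp: norm_mult intro!: AE_I2 mult_left_mono norm_mollify_le)
  show "AE \<xi> in lborel. (\<lambda>n. G \<xi> * mollify (\<epsilon> n) F \<xi>) \<longlonglongrightarrow> G \<xi> * F \<xi>"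
    by (intro AE_I2 tendsto_mult_left mollify_tendsto[OF F \<epsilon>])
qed (use G in auto)

lemma damping_tendsto: "\<epsilon> \<longlonglongrightarrow> 0 \<Longrightarrow> (\<lambda>n. damping (\<epsilon> n) x) \<longlonglongrightarrow> 1"
proof -
  assume "\<epsilon> \<longlonglongrightarrow> 0"
  then have "(\<lambda>n. exp (- ((\<epsilon> n)\<^sup>2 * (x \<bullet> x)) / 2)) \<longlonglongrightarrow> exp (- (0\<^sup>2 * (x \<bullet> x)) / 2)"
    by (intro tendsto_intros) auto
  then show ?thesis by (simp add: damping_def)
qed

text \<open>In \<open>regularised_parseval\<close> take for \<open>F\<close> the conjugate of \<open>G\<close>. As \<open>\<epsilon> \<longrightarrow> 0\<close>, the left hand side
increases to \<open>\<integral>|synthesis G|\<^sup>2\<close> by monotone convergence, and the right hand side converges because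
the mollified function converges boundedly. In particular the left hand side is finite.\<close>

lemma plancherel:
  assumes G: "integrable lborel G" "continuous_on UNIV G" "\<And>x. norm (G x) \<le> B"
  shows "integrable lborel (\<lambda>x. (norm (synthesis G x))\<^sup>2)"
    and "(LINT x|lborel. (norm (synthesis G x))\<^sup>2) = (2 * pi) ^ 3 * (LINT \<xi>|lborel. (norm (G \<xi>))\<^sup>2)"
proof -
  have [measurable]: "G \<in> borel_measurable borel" using G by auto
  define \<epsilon> where "\<epsilon> n = inverse (real (Suc n))" for n
  have \<epsilon>0: "\<epsilon> \<longlonglongrightarrow> 0" unfolding \<epsilon>_def by (rule LIMSEQ_inverse_real_of_nat)
  have \<epsilon>p: "\<epsilon> n > 0" for n by (simp add: \<epsilon>_def)
  define F where "F = (\<lambda>x. cnj (G x))"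
  have F: "integrable lborel F" "continuous_on UNIV F" "\<And>x. norm (F x) \<le> B"
    using G by (auto simp: F_def intro!: continuous_intros)
  have hat: "fourier_integral F x = cnj (synthesis G x)" for x
    unfolding fourier_integral_def synthesis_def F_def
    by (subst Bochner_Integration.integral_cnj[symmetric]) (simp add: cis_cnj inner_commute)
  define h where "h x = (norm (synthesis G x))\<^sup>2" for x
  have hm [measurable]: "h \<in> borel_measurable borel" unfolding h_def by measurable
  have int: "integrable lborel (\<lambda>x. damping (\<epsilon> n) x * h x)" for n
  proof (rule Bochner_Integration.integrable_bound)
    show "integrable lborel (\<lambda>x. damping (\<epsilon> n) x * (LINT \<eta>|lborel. norm (G \<eta>))\<^sup>2)"
      using integrable_damping[OF \<epsilon>p] by simp
    show "AE x in lborel. norm (damping (\<epsilon> n) x * h x) \<le> norm (damping (\<epsilon> n) x * (LINT \<eta>|lborel. norm (G \<eta>))\<^sup>2)"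
      using damping_pos by (auto simp: h_def abs_mult less_imp_le intro!: AE_I2 mult_left_mono power_mono norm_synthesis_le)
  qed simp
  have lim: "(\<lambda>n. LINT x|lborel. damping (\<epsilon> n) x * h x) \<longlonglongrightarrow> (2 * pi) ^ 3 * (LINT \<xi>|lborel. (norm (G \<xi>))\<^sup>2)"
  proof -
    have "complex_of_real (LINT x|lborel. damping (\<epsilon> n) x * h x)
        = (2 * pi) ^ 3 * (LINT \<xi>|lborel. G \<xi> * mollify (\<epsilon> n) F \<xi>)" for n
      using regularised_parseval[OF G(1) F(1) \<epsilon>p, of n]
      by (simp only: hat h_def of_real_mult complex_norm_square flip: integral_complex_of_real)
    moreover have "(\<lambda>n. (2 * pi) ^ 3 * (LINT \<xi>|lborel. G \<xi> * mollify (\<epsilon> n) F \<xi>)) \<longlonglongrightarrow>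
        (2 * pi) ^ 3 * (LINT \<xi>|lborel. G \<xi> * F \<xi>)"
      by (intro tendsto_mult_left mollified_pairing_tendsto[OF G(1) F(2,3) \<epsilon>0])
    moreover have "(2 * pi) ^ 3 * (LINT \<xi>|lborel. G \<xi> * F \<xi>) = complex_of_real ((2 * pi) ^ 3 * (LINT \<xi>|lborel. (norm (G \<xi>))\<^sup>2))"
    proof -
      have "complex_of_real (LINT \<xi>|lborel. (norm (G \<xi>))\<^sup>2) = (LINT \<xi>|lborel. G \<xi> * F \<xi>)"
        by (simp only: F_def complex_norm_square flip: integral_complex_of_real)
      then show ?thesis by simp
    qed
    ultimately have "(\<lambda>n. complex_of_real (LINT x|lborel. damping (\<epsilon> n) x * h x)) \<longlonglongrightarrow>
        complex_of_real ((2 * pi) ^ 3 * (LINT \<xi>|lborel. (norm (G \<xi>))\<^sup>2))"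
      by (simp only:)
    then show ?thesis by (simp only: tendsto_of_real_iff)
  qed
  have mono: "AE x in lborel. mono (\<lambda>n. damping (\<epsilon> n) x * h x)"
  proof (intro AE_I2 monoI mult_right_mono)
    fix x :: "real^3" and m n :: nat assume "m \<le> n"
    then have "(\<epsilon> n)\<^sup>2 \<le> (\<epsilon> m)\<^sup>2" by (intro power_mono) (auto simp: \<epsilon>_def)
    then show "damping (\<epsilon> m) x \<le> damping (\<epsilon> n) x" by (simp add: damping_def mult_right_mono)
  qed (simp add: h_def)
  have lim2: "AE x in lborel. (\<lambda>n. damping (\<epsilon> n) x * h x) \<longlonglongrightarrow> h x"
    using tendsto_mult_right[OF damping_tendsto[OF \<epsilon>0]] by (intro AE_I2) fastforce
  show "integrable lborel (\<lambda>x. (norm (synthesis G x))\<^sup>2)"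
    using integrable_monotone_convergence[OF int mono lim2 lim] by (simp add: h_def[abs_def])
  show "(LINT x|lborel. (norm (synthesis G x))\<^sup>2) = (2 * pi) ^ 3 * (LINT \<xi>|lborel. (norm (G \<xi>))\<^sup>2)"
    using integral_monotone_convergence[OF int mono lim2 lim] by (simp add: h_def[abs_def])
qed

text \<open>Now that both factors are known to be square integrable, their product is integrable, and the
damping factor may be removed by dominated convergence.\<close>

lemma parseval:
  fixes G F :: "real^3 \<Rightarrow> complex"
  assumes G: "integrable lborel G" "continuous_on UNIV G" "\<And>x. norm (G x) \<le> B"
    and F: "integrable lborel F" "continuous_on UNIV F" "\<And>x. norm (F x) \<le> C"
  shows "integrable lborel (\<lambda>x. synthesis G x * fourier_integral F x)"
    and "(LINT x|lborel. synthesis G x * fourier_integral F x) = (2 * pi) ^ 3 * (LINT \<xi>|lborel. G \<xi> * F \<xi>)"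
proof -
  have [measurable]: "G \<in> borel_measurable borel" "F \<in> borel_measurable borel" using G F by auto
  have [measurable]: "fourier_integral F \<in> borel_measurable borel"
    unfolding fourier_integral_eq_synthesis[abs_def] by measurable
  define \<epsilon> where "\<epsilon> n = inverse (real (Suc n))" for n
  have \<epsilon>0: "\<epsilon> \<longlonglongrightarrow> 0" unfolding \<epsilon>_def by (rule LIMSEQ_inverse_real_of_nat)
  have \<epsilon>p: "\<epsilon> n > 0" for n by (simp add: \<epsilon>_def)
  have F2: "integrable lborel (\<lambda>x. (norm (fourier_integral F x))\<^sup>2)"
    using lborel_integrable_affine[OF _ plancherel(1)[OF F], of "-1" 0]
    by (simp add: fourier_integral_eq_synthesis)
  show int: "integrable lborel (\<lambda>x. synthesis G x * fourier_integral F x)"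
  proof (rule Bochner_Integration.integrable_bound)
    show "integrable lborel (\<lambda>x. (norm (synthesis G x))\<^sup>2 + (norm (fourier_integral F x))\<^sup>2)"
      by (intro Bochner_Integration.integrable_add plancherel(1)[OF G] F2)
    have "norm (a * b) \<le> norm ((norm a)\<^sup>2 + (norm b)\<^sup>2)" for a b :: complex
    proof -
      have "0 \<le> norm a * norm b" by simp
      then show ?thesis using sum_squares_bound[of "norm a" "norm b"] by (simp add: norm_mult, linarith)
    qed
    then show "AE x in lborel. norm (synthesis G x * fourier_integral F x)
        \<le> norm ((norm (synthesis G x))\<^sup>2 + (norm (fourier_integral F x))\<^sup>2)" by (intro AE_I2)
  qed simp
  have "(\<lambda>n. LINT x|lborel. complex_of_real (damping (\<epsilon> n) x) * (synthesis G x * fourier_integral F x))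
      \<longlonglongrightarrow> (LINT x|lborel. synthesis G x * fourier_integral F x)"
  proof (rule integral_dominated_convergence[OF _ _ integrable_norm[OF int]])
    show "AE x in lborel. (\<lambda>n. complex_of_real (damping (\<epsilon> n) x) * (synthesis G x * fourier_integral F x)) \<longlonglongrightarrow> synthesis G x * fourier_integral F x"
      using tendsto_mult_right[OF tendsto_of_real[OF damping_tendsto[OF \<epsilon>0]]] by (intro AE_I2) fastforce
    show "AE x in lborel. norm (complex_of_real (damping (\<epsilon> n) x) * (synthesis G x * fourier_integral F x))
        \<le> norm (synthesis G x * fourier_integral F x)" for n
      using damping_le_1[of "\<epsilon> n"] less_imp_le[OF damping_pos, of "\<epsilon> n"]
      by (intro AE_I2) (simp only: norm_mult norm_of_real abs_of_nonneg, rule mult_left_le_one_le, auto)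
  qed simp_all
  moreover have "(\<lambda>n. LINT x|lborel. complex_of_real (damping (\<epsilon> n) x) * (synthesis G x * fourier_integral F x))
      \<longlonglongrightarrow> (2 * pi) ^ 3 * (LINT \<xi>|lborel. G \<xi> * F \<xi>)"
    unfolding regularised_parseval[OF G(1) F(1) \<epsilon>p]
    by (intro tendsto_mult_left mollified_pairing_tendsto[OF G(1) F(2,3) \<epsilon>0])
  ultimately show "(LINT x|lborel. synthesis G x * fourier_integral F x) = (2 * pi) ^ 3 * (LINT \<xi>|lborel. G \<xi> * F \<xi>)"
    by (rule LIMSEQ_unique)
qed

section \<open>Schwartz functions and uniqueness of the Fourier transform\<close>

lemma partials_closed:
  assumes "g \<in> S" "\<And>g j. g \<in> S \<Longrightarrow> partial j g \<in> S"
  shows "partials js g \<in> S"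
  by (induction js) (auto intro: assms)

text \<open>A set of differentiable functions that is closed under partial derivatives consists of smooth
functions. All smoothness proofs below exhibit such a set.\<close>

lemma C_classI:
  assumes "g \<in> S" "\<And>g j. g \<in> S \<Longrightarrow> partial j g \<in> S" "\<And>g x. g \<in> S \<Longrightarrow> g differentiable (at x)"
  shows "C_class n g"
proof -
  have "partials js g \<in> S" for js using partials_closed assms(1,2) .
  then show ?thesis
    unfolding C_class_def
    by (intro conjI allI impI continuous_at_imp_continuous_on ballI differentiable_imp_continuous_within assms(3)) auto
qed

lemma partial_eqI:
  assumes "(g has_derivative g') (at x)"
  shows "partial j g x = g' (axis j 1)"
  unfolding partial_def using frechet_derivative_at[OF assms] by simp

text \<open>Stated for each fixed direction, because this is the form in which partial derivatives use it.\<close>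

lemma real_polynomial_function_directional:
  assumes "real_polynomial_function (p :: 'a::euclidean_space \<Rightarrow> real)"
  shows "\<exists>D. (\<forall>x. (p has_derivative D x) (at x)) \<and> (\<forall>v. real_polynomial_function (\<lambda>x. D x v))"
  using assms
proof (induction rule: real_polynomial_function.induct)
  case (linear f)
  then show ?case
    by (intro exI[of _ "\<lambda>x. f"]) (auto intro: bounded_linear_imp_has_derivative real_polynomial_function.intros)
next
  case (const c)
  then show ?case
    by (intro exI[of _ "\<lambda>x v. 0"]) (auto intro: real_polynomial_function.intros)
next
  case (add f g)
  then obtain D E where "\<forall>x. (f has_derivative D x) (at x)" "\<forall>v. real_polynomial_function (\<lambda>x. D x v)"
    "\<forall>x. (g has_derivative E x) (at x)" "\<forall>v. real_polynomial_function (\<lambda>x. E x v)" by metis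
  then show ?case
    by (intro exI[of _ "\<lambda>x v. D x v + E x v"]) (auto intro: real_polynomial_function.intros has_derivative_add)
next
  case (mult f g)
  then obtain D E where "\<forall>x. (f has_derivative D x) (at x)" "\<forall>v. real_polynomial_function (\<lambda>x. D x v)"
    "\<forall>x. (g has_derivative E x) (at x)" "\<forall>v. real_polynomial_function (\<lambda>x. E x v)" by metis
  with mult.hyps show ?case
    by (intro exI[of _ "\<lambda>x v. f x * E x v + D x v * g x"] conjI allI has_derivative_mult
        real_polynomial_function.intros(3,4)) simp_all
qed

lemma real_polynomial_function_growth:
  assumes "real_polynomial_function (p :: 'a::euclidean_space \<Rightarrow> real)"
  shows "\<exists>C m. \<forall>x. \<bar>p x\<bar> \<le> C * (1 + norm x) ^ m"
  using assms
proof (induction rule: real_polynomial_function.induct)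
  case (linear f)
  then obtain K where K: "K > 0" "\<And>x. norm (f x) \<le> norm x * K" using bounded_linear.pos_bounded by blast
  have "\<bar>f x\<bar> \<le> K * (1 + norm x) ^ 1" for x
    using K(2)[of x] K(1) by (simp add: algebra_simps)
  then show ?case by blast
next
  case (const c)
  have "\<bar>c\<bar> \<le> \<bar>c\<bar> * (1 + norm x) ^ 0" for x :: 'a by simp
  then show ?case by blast
next
  case (add f g)
  then obtain C m D n where *: "\<And>x. \<bar>f x\<bar> \<le> C * (1 + norm x) ^ m" "\<And>x. \<bar>g x\<bar> \<le> D * (1 + norm x) ^ n"
    by metis
  have CD: "C \<ge> 0" "D \<ge> 0" using order_trans[OF abs_ge_zero *(1)[of 0]] order_trans[OF abs_ge_zero *(2)[of 0]] by auto
  have "\<bar>f x + g x\<bar> \<le> (C + D) * (1 + norm x) ^ (m + n)" for x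
  proof -
    have "C * (1 + norm x) ^ m \<le> C * (1 + norm x) ^ (m + n)" "D * (1 + norm x) ^ n \<le> D * (1 + norm x) ^ (m + n)"
      using CD by (auto intro!: mult_left_mono power_increasing)
    with *(1)[of x] *(2)[of x] show ?thesis unfolding distrib_right by linarith
  qed
  then show ?case by blast
next
  case (mult f g)
  then obtain C m D n where *: "\<And>x. \<bar>f x\<bar> \<le> C * (1 + norm x) ^ m" "\<And>x. \<bar>g x\<bar> \<le> D * (1 + norm x) ^ n"
    by metis
  have C: "C \<ge> 0" using order_trans[OF abs_ge_zero *(1)[of 0]] by auto
  have "\<bar>f x * g x\<bar> \<le> (C * D) * (1 + norm x) ^ (m + n)" for x
    using mult_mono[OF *(1)[of x] *(2)[of x]] C by (simp add: abs_mult power_add mult_ac)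
  then show ?case by blast
qed

lemma power_le_fact_exp: "x \<ge> 0 \<Longrightarrow> x ^ n \<le> fact n * exp (x :: real)"
proof -
  assume "x \<ge> 0"
  have "(\<Sum>k\<in>{n}. inverse (fact k) *\<^sub>R x ^ k) \<le> exp x"
    unfolding exp_def using \<open>x \<ge> 0\<close> summable_exp_generic[of x] by (intro sum_le_suminf) auto
  then show ?thesis by (simp add: field_simps)
qed

text \<open>Completing the square bounds the exponent by a constant minus \<open>|x|\<close>, and
\<open>exp (- |x|)\<close> beats every power.\<close>

lemma gaussian_decay:
  fixes b :: "'a::euclidean_space"
  assumes "s > 0"
  shows "\<exists>B. \<forall>x. (1 + norm x) ^ N * exp (- (s * (x \<bullet> x)) + b \<bullet> x) \<le> B"
proof (intro exI allI)
  fix x :: 'a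
  let ?r = "norm x" and ?K = "(norm b + 1)\<^sup>2 / (4 * s)"
  have "0 \<le> (2 * s * ?r - (norm b + 1))\<^sup>2 / (4 * s)" using assms by simp
  also have "\<dots> = s * ?r\<^sup>2 - (norm b + 1) * ?r + ?K"
    using assms by (simp add: power2_eq_square field_simps)
  finally have "- (s * (x \<bullet> x)) + b \<bullet> x \<le> ?K - ?r"
    using norm_cauchy_schwarz[of b x] by (simp add: power2_norm_eq_inner algebra_simps)
  then have "(1 + ?r) ^ N * exp (- (s * (x \<bullet> x)) + b \<bullet> x) \<le> (fact N * exp (1 + ?r)) * exp (?K - ?r)"
    by (intro mult_mono power_le_fact_exp) auto
  also have "\<dots> = fact N * exp (1 + ?K)" by (simp flip: exp_add add: mult.assoc)
  finally show "(1 + ?r) ^ N * exp (- (s * (x \<bullet> x)) + b \<bullet> x) \<le> fact N * exp (1 + ?K)" .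
qed

text \<open>Polynomials times this fixed Gaussian form a set that is closed under partial derivatives, and
each of its members decays faster than every power.\<close>

lemma schwartz_gaussian:
  assumes "s > 0"
  shows "schwartz (\<lambda>x. complex_of_real (c * exp (- (s * (x \<bullet> x)) + b \<bullet> x)))"
proof -
  let ?E = "\<lambda>x. exp (- (s * (x \<bullet> x)) + b \<bullet> x)"
  define S where "S = {\<lambda>x :: real^3. complex_of_real (p x * ?E x) | p. real_polynomial_function p}"
  have mem: "(\<lambda>x. complex_of_real (c * ?E x)) \<in> S"
    unfolding S_def mem_Collect_eq
    by (rule exI[where x = "\<lambda>x. c"], rule conjI[OF refl], rule real_polynomial_function.intros(2))
  have der: "\<exists>D. (\<forall>x. (g has_derivative D x) (at x)) \<and> (\<forall>v. (\<lambda>x. D x v) \<in> S)" if "g \<in> S" for g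
  proof -
    from that obtain p where p: "real_polynomial_function p" and g: "g = (\<lambda>x. complex_of_real (p x * ?E x))"
      unfolding S_def by blast
    obtain P where P: "\<And>x. (p has_derivative P x) (at x)" "\<And>v. real_polynomial_function (\<lambda>x. P x v)"
      using real_polynomial_function_directional[OF p] by blast
    \<comment> \<open>The derivative of the exponent in direction \<open>v\<close> is linear in the base point, so the factor in front
      of the Gaussian remains a polynomial.\<close>
    define D where "D x v = complex_of_real ((P x v + p x * (b \<bullet> v + (- 2 * s) * (x \<bullet> v))) * ?E x)" for x v
    have "(g has_derivative D x) (at x)" for x
      unfolding g D_def
      by (rule has_derivative_of_real) (auto intro!: derivative_eq_intros P simp: fun_eq_iff algebra_simps inner_commute)
    moreover have "(\<lambda>x. D x v) \<in> S" for v
      unfolding S_def D_def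
      by (intro CollectI exI conjI, rule refl)
         (intro real_polynomial_function.intros(3,4) P p real_polynomial_function.intros(2)
           real_polynomial_function.intros(1)[OF bounded_linear_inner_left])
    ultimately show ?thesis by blast
  qed
  have "partial j g \<in> S" "g differentiable (at x)" if g: "g \<in> S" for g j x
  proof -
    from der[OF g] obtain D where D: "\<And>x. (g has_derivative D x) (at x)" "\<And>v. (\<lambda>x. D x v) \<in> S" by blast
    have "partial j g = (\<lambda>x. D x (axis j 1))" by (intro ext partial_eqI D)
    then show "partial j g \<in> S" using D(2) by simp
    show "g differentiable (at x)" using D(1) differentiable_def by blast
  qed
  note cl = this
  show ?thesis
    unfolding schwartz_def
  proof (intro conjI allI)
    show "C_class n (\<lambda>x. complex_of_real (c * ?E x))" for n by (rule C_classI[OF mem cl])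
    fix js N
    have "partials js (\<lambda>x. complex_of_real (c * ?E x)) \<in> S" by (rule partials_closed[OF mem cl(1)])
    then obtain p where p: "real_polynomial_function p"
      and e: "partials js (\<lambda>x. complex_of_real (c * ?E x)) = (\<lambda>x. complex_of_real (p x * ?E x))"
      unfolding S_def by blast
    obtain C m where C: "\<And>x. \<bar>p x\<bar> \<le> C * (1 + norm x) ^ m" using real_polynomial_function_growth[OF p] by blast
    have C0: "C \<ge> 0" using order_trans[OF abs_ge_zero C[of 0]] by auto
    obtain B where B: "\<And>x. (1 + norm x) ^ (N + m) * ?E x \<le> B" using gaussian_decay[OF assms] by blast
    have "(1 + norm x) ^ N * norm (complex_of_real (p x * ?E x)) \<le> C * B" for x
    proof -
      have "(1 + norm x) ^ N * norm (complex_of_real (p x * ?E x)) = (1 + norm x) ^ N * (\<bar>p x\<bar> * ?E x)"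
        by (simp add: norm_mult)
      also have "\<dots> \<le> (1 + norm x) ^ N * (C * (1 + norm x) ^ m * ?E x)"
        by (intro mult_left_mono mult_right_mono C) auto
      also have "\<dots> = C * ((1 + norm x) ^ (N + m) * ?E x)" by (simp add: power_add)
      also have "\<dots> \<le> C * B" by (intro mult_left_mono B C0)
      finally show ?thesis .
    qed
    then show "\<exists>B. \<forall>x. (1 + norm x) ^ N * norm (partials js (\<lambda>x. complex_of_real (c * ?E x)) x) \<le> B"
      unfolding e by blast
  qed
qed

text \<open>The one-dimensional majorant from which integrability of Schwartz functions is deduced.\<close>

lemma integrable_1_div_plus_square: "integrable lborel (\<lambda>s::real. 1 / (1 + s\<^sup>2))"
proof -
  have "set_integrable lborel {0<..} (\<lambda>s::real. 1 / (1 + s\<^sup>2))"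
    using integrable_I0i_1_div_plus_square by (simp add: interval_lebesgue_integrable_def zero_ereal_def)
  then have "set_integrable lborel {0..} (\<lambda>s::real. 1 / (1 + s\<^sup>2))"
    unfolding set_integrable_def
    by (rule integrable_cong_AE_imp) (auto simp: indicator_def intro!: AE_I[where N = "{0}"])
  then obtain y where "has_bochner_integral lborel (\<lambda>s::real. indicator {0..} s *\<^sub>R (1 / (1 + s\<^sup>2))) y"
    unfolding set_integrable_def using has_bochner_integral_integrable by blast
  from has_bochner_integral_even_function[OF this] show ?thesis
    by (auto intro: integrable.intros)
qed

text \<open>For integrability, the decay of order 6 is compared with the product of the functions
\<open>1 / (1 + x\<^sub>i\<^sup>2)\<close> over the three coordinates.\<close>

lemma schwartz_bounds:
  assumes "schwartz \<phi>"
  shows "continuous_on UNIV \<phi>" and "\<exists>B. \<forall>x. norm (\<phi> x) \<le> B" and "integrable lborel \<phi>"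
proof -
  have "C_class 0 \<phi>" using assms by (simp add: schwartz_def)
  then show c: "continuous_on UNIV \<phi>" unfolding C_class_def by (auto dest: spec[of _ "[]"])
  have *: "\<exists>B. \<forall>x. (1 + norm x) ^ N * norm (\<phi> x) \<le> B" for N
  proof -
    have "\<forall>js N. \<exists>B. \<forall>x. (1 + norm x) ^ N * norm (partials js \<phi> x) \<le> B"
      using assms unfolding schwartz_def by blast
    then have "\<exists>B. \<forall>x. (1 + norm x) ^ N * norm (partials [] \<phi> x) \<le> B" by blast
    then show ?thesis by simp
  qed
  from *[of 0] show "\<exists>B. \<forall>x. norm (\<phi> x) \<le> B" by simp
  from *[of 6] obtain B where B: "\<And>x. (1 + norm x) ^ 6 * norm (\<phi> x) \<le> B" by blast
  show "integrable lborel \<phi>"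
  proof (rule Bochner_Integration.integrable_bound)
    let ?f = "\<lambda>x::real^3. \<Prod>b\<in>Basis. complex_of_real (1 / (1 + (x \<bullet> b)\<^sup>2))"
    show "integrable lborel (\<lambda>x. complex_of_real B * ?f x)"
      using lborel_product_integral(1)[of "\<lambda>b s. complex_of_real (1 / (1 + s\<^sup>2))"] integrable_1_div_plus_square
      by (intro integrable_mult_right) (simp del: of_real_divide)
    show "\<phi> \<in> borel_measurable lborel" using borel_measurable_continuous_onI[OF c] by simp
    show "AE x in lborel. norm (\<phi> x) \<le> norm (complex_of_real B * ?f x)"
    proof (rule AE_I2)
      fix x :: "real^3"
      have B0: "0 \<le> B" using order_trans[OF _ B[of x]] by simp
      let ?P = "\<Prod>b\<in>(Basis::(real^3) set). 1 + (x \<bullet> b)\<^sup>2"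
      have P0: "?P > 0" by (intro prod_pos) (simp add: add_pos_nonneg)
      have "?P \<le> (\<Prod>b\<in>(Basis::(real^3) set). (1 + norm x)\<^sup>2)"
      proof (intro prod_mono conjI)
        fix b :: "real^3" assume b: "b \<in> Basis"
        have "\<bar>x \<bullet> b\<bar> \<le> norm x" using Basis_le_norm[OF b] .
        then have "(x \<bullet> b)\<^sup>2 \<le> (norm x)\<^sup>2" by (metis abs_le_square_iff abs_norm_cancel)
        then show "1 + (x \<bullet> b)\<^sup>2 \<le> (1 + norm x)\<^sup>2" using norm_ge_zero[of x] unfolding power2_sum power_one by linarith
      qed simp
      also have "\<dots> = (1 + norm x) ^ 6" by simp
      finally have "?P * norm (\<phi> x) \<le> B" using B[of x] mult_right_mono[of ?P "(1 + norm x) ^ 6" "norm (\<phi> x)"] by simp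
      then have "norm (\<phi> x) \<le> B / ?P" using P0 by (simp add: pos_le_divide_eq mult.commute)
      have "?f x = complex_of_real (1 / ?P)"
        unfolding of_real_prod[symmetric] prod_dividef by simp
      then have *: "norm (complex_of_real B * ?f x) = B / ?P"
        using B0 P0 by (simp only: norm_mult norm_of_real abs_of_nonneg abs_divide) simp
      from \<open>norm (\<phi> x) \<le> B / ?P\<close> show "norm (\<phi> x) \<le> norm (complex_of_real B * ?f x)" unfolding * .
    qed
  qed
qed

text \<open>Parseval's identity against a Schwartz function is literally the definition of the distributional
transform.\<close>

lemma has_fourier_synthesis:
  fixes G :: "real^3 \<Rightarrow> complex"
  assumes G: "integrable lborel G" "continuous_on UNIV G" "\<And>x. norm (G x) \<le> B"
  shows "has_fourier (synthesis G) (\<lambda>\<xi>. (2 * pi) ^ 3 * G \<xi>)"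
  unfolding has_fourier_def
proof (intro allI impI)
  fix \<phi> assume s: "schwartz \<phi>"
  note \<phi> = schwartz_bounds[OF s]
  obtain C where C: "\<And>x. norm (\<phi> x) \<le> C" using \<phi>(2) by blast
  have [measurable]: "G \<in> borel_measurable borel" "\<phi> \<in> borel_measurable borel" using G \<phi> by auto
  have "integrable lborel (\<lambda>\<xi>. G \<xi> * \<phi> \<xi>)"
  proof (rule Bochner_Integration.integrable_bound)
    show "integrable lborel (\<lambda>\<xi>. G \<xi> * C)" using G(1) by simp
    have "norm (\<phi> x) \<le> norm (complex_of_real C)" for x
      unfolding norm_of_real by (rule order_trans[OF C abs_ge_self])
    then show "AE x in lborel. norm (G x * \<phi> x) \<le> norm (G x * C)"
      by (simp only: norm_mult) (intro AE_I2 mult_left_mono norm_ge_zero)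
  qed simp
  then show "integrable lborel (\<lambda>x. synthesis G x * fourier_integral \<phi> x) \<and>
    integrable lborel (\<lambda>\<xi>. (2 * pi) ^ 3 * G \<xi> * \<phi> \<xi>) \<and>
    (LINT x|lborel. synthesis G x * fourier_integral \<phi> x) = (LINT \<xi>|lborel. (2 * pi) ^ 3 * G \<xi> * \<phi> \<xi>)"
    using parseval[OF G \<phi>(3,1) C] by (simp add: mult.assoc)
qed

lemma mollify_eq_convolution:
  assumes [measurable]: "F \<in> borel_measurable borel" and "\<epsilon> > 0"
  shows "mollify \<epsilon> F \<xi> = (LINT y|lborel. complex_of_real (gauss ((\<xi> - y) /\<^sub>R \<epsilon>)) * F y) / \<epsilon> ^ 3"
proof -
  have "(LINT y|lborel. complex_of_real (gauss ((\<xi> - y) /\<^sub>R \<epsilon>)) * F y)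
    = \<bar>- \<epsilon>\<bar> ^ DIM(real^3) *\<^sub>R (LINT z|lborel. complex_of_real (gauss ((\<xi> - (\<xi> + (- \<epsilon>) *\<^sub>R z)) /\<^sub>R \<epsilon>)) * F (\<xi> + (- \<epsilon>) *\<^sub>R z))"
    using \<open>\<epsilon> > 0\<close> by (intro lborel_integral_affine) auto
  then show ?thesis using \<open>\<epsilon> > 0\<close> by (simp add: mollify_def scaleR_conv_of_real[where 'a = complex])
qed

text \<open>Orthogonality to all narrow Gaussians says that \<open>h\<close> is orthogonal to every mollified function, hence,
in the limit, to every bounded continuous integrable function. Such functions approximate
the indicator of a closed set, so the integral of \<open>h\<close> over closed sets vanishes; closed sets
generate the Borel sets and are stable under intersection.\<close>

lemma AE_zero_if_orthogonal_to_gaussians: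
  fixes h :: "real^3 \<Rightarrow> complex"
  assumes h: "integrable lborel h"
    and orth: "\<And>\<epsilon> y. \<epsilon> > 0 \<Longrightarrow> (LINT x|lborel. complex_of_real (gauss ((x - y) /\<^sub>R \<epsilon>)) * h x) = 0"
  shows "AE x in lborel. h x = 0"
proof -
  have [measurable]: "h \<in> borel_measurable borel" using h by auto
  define \<epsilon> where "\<epsilon> n = inverse (real (Suc n))" for n
  have \<epsilon>0: "\<epsilon> \<longlonglongrightarrow> 0" unfolding \<epsilon>_def by (rule LIMSEQ_inverse_real_of_nat)
  have \<epsilon>p: "\<epsilon> n > 0" for n by (simp add: \<epsilon>_def)
  have test: "(LINT x|lborel. h x * \<psi> x) = 0"
    if \<psi>: "integrable lborel \<psi>" "continuous_on UNIV \<psi>" "\<And>x. norm (\<psi> x) \<le> B" for \<psi> B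
  proof (rule LIMSEQ_unique)
    have [measurable]: "\<psi> \<in> borel_measurable borel" using \<psi> by auto
    show "(\<lambda>n. LINT x|lborel. h x * mollify (\<epsilon> n) \<psi> x) \<longlonglongrightarrow> (LINT x|lborel. h x * \<psi> x)"
      by (rule mollified_pairing_tendsto[OF h \<psi>(2,3) \<epsilon>0])
    have "(LINT x|lborel. h x * mollify (\<epsilon> n) \<psi> x) = 0" for n
    proof -
      have "(LINT x|lborel. h x * (LINT y|lborel. complex_of_real (gauss ((x - y) /\<^sub>R \<epsilon> n)) * \<psi> y))
          = (LINT y|lborel. \<psi> y * (LINT x|lborel. complex_of_real (gauss ((x - y) /\<^sub>R \<epsilon> n)) * h x))"
        using gauss_le_1 gauss_pos by (intro kernel_swap h \<psi>) (auto simp: abs_of_pos)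
      also have "\<dots> = 0" using orth[OF \<epsilon>p] by simp
      finally show ?thesis by (simp add: mollify_eq_convolution[OF _ \<epsilon>p])
    qed
    then show "(\<lambda>n. LINT x|lborel. h x * mollify (\<epsilon> n) \<psi> x) \<longlonglongrightarrow> 0" by simp
  qed
  have closed: "set_lebesgue_integral lborel C h = 0" if C: "closed C" for C
  proof (cases "C = {}")
    case True then show ?thesis by (simp add: set_lebesgue_integral_def)
  next
    case False
    \<comment> \<open>The damping factor makes the approximation of the indicator integrable.\<close>
    define \<psi> where "\<psi> n x = complex_of_real (exp (- (real n * infdist x C)) * damping (\<epsilon> n) x)" for n x
    have b: "norm (\<psi> n x) \<le> damping (\<epsilon> n) x" for n x
      using damping_pos[of "\<epsilon> n" x] by (simp add: \<psi>_def norm_mult infdist_nonneg mult_nonneg_nonneg)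
    then have b1: "norm (\<psi> n x) \<le> 1" for n x using damping_le_1 order_trans by blast
    have c: "continuous_on UNIV (\<psi> n)" for n
      unfolding \<psi>_def damping_def by (intro continuous_intros) auto
    then have [measurable]: "\<psi> n \<in> borel_measurable borel" for n by (rule borel_measurable_continuous_onI)
    have i: "integrable lborel (\<psi> n)" for n
      by (rule Bochner_Integration.integrable_bound[OF integrable_damping[OF \<epsilon>p[of n]]])
         (use b order_trans[OF _ abs_ge_self] in \<open>auto intro!: AE_I2\<close>)
    have lim: "(\<lambda>n. \<psi> n x) \<longlonglongrightarrow> indicator C x" for x
    proof (cases "x \<in> C")
      case True
      then have "infdist x C = 0" by simp
      then show ?thesis using True tendsto_of_real[OF damping_tendsto[OF \<epsilon>0]] by (simp add: \<psi>_def)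
    next
      case x: False
      then have d: "infdist x C > 0" using infdist_pos_not_in_closed[OF C False] by simp
      have "filterlim (\<lambda>n. infdist x C * real n) at_top sequentially"
        by (rule filterlim_tendsto_pos_mult_at_top[OF tendsto_const d filterlim_real_sequentially])
      then have "(\<lambda>n. exp (- (real n * infdist x C))) \<longlonglongrightarrow> 0"
        by (intro filterlim_compose[OF exp_at_bot] filterlim_compose[OF filterlim_uminus_at_bot_at_top]) (simp add: mult.commute)
      from tendsto_mult[OF this damping_tendsto[OF \<epsilon>0, of x]]
      have "(\<lambda>n. exp (- (real n * infdist x C)) * damping (\<epsilon> n) x) \<longlonglongrightarrow> 0" by simp
      from tendsto_of_real[OF this, where 'a = complex] x show ?thesis unfolding \<psi>_def by simp
    qed
    have "(\<lambda>n. LINT x|lborel. h x * \<psi> n x) \<longlonglongrightarrow> (LINT x|lborel. h x * indicator C x)"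
    proof (rule integral_dominated_convergence[where w = "\<lambda>x. norm (h x)"])
      have [measurable]: "C \<in> sets borel" using C by simp
      show "(\<lambda>x. h x * indicator C x) \<in> borel_measurable lborel" by measurable
      show "AE x in lborel. norm (h x * \<psi> n x) \<le> norm (h x)" for n
        using b1 by (auto simp: norm_mult intro!: AE_I2 mult_right_le_one_le)
    qed (use h lim in \<open>auto intro!: tendsto_mult_left\<close>)
    then have "(LINT x|lborel. h x * indicator C x) = 0"
      using test[OF i c b1] by (simp add: LIMSEQ_const_iff)
    moreover have "h x * indicator C x = indicator C x *\<^sub>R h x" for x by (simp add: indicator_def)
    ultimately show ?thesis unfolding set_lebesgue_integral_def by simp
  qed
  have si: "set_integrable lborel A h" if "A \<in> sets borel" for A
    using h that by (simp add: set_integrable_def integrable_mult_indicator)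
  show ?thesis
  proof (rule sigma_finite_measure.density_zero[OF lborel.sigma_finite_measure_axioms h])
    fix A :: "(real^3) set" assume "A \<in> sets lborel"
    then have A: "A \<in> sigma_sets UNIV (Collect closed)" by (simp add: borel_eq_closed)
    have "Int_stable (Collect closed :: (real^3) set set)" "Collect closed \<subseteq> Pow (UNIV :: (real^3) set)"
      by (auto simp: Int_stable_def)
    from this A show "set_lebesgue_integral lborel A h = 0"
    proof (induction rule: sigma_sets_induct_disjoint)
      case (compl A)
      then have A: "A \<in> sets borel" by (simp add: borel_eq_closed)
      have "set_lebesgue_integral lborel (A \<union> - A) h = set_lebesgue_integral lborel A h + set_lebesgue_integral lborel (- A) h"
        using A by (intro set_integral_Un si) auto
      with compl closed[of UNIV] show ?case by (simp add: Compl_eq_Diff_UNIV)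
    next
      case (union A)
      then have A: "A i \<in> sets borel" for i by (auto simp: borel_eq_closed)
      have "set_lebesgue_integral lborel (\<Union>i. A i) h = (\<Sum>i. set_lebesgue_integral lborel (A i) h)"
        using union(1) A by (intro lebesgue_integral_countable_add si) (auto simp: disjoint_family_on_def)
      with union(3) show ?case by simp
    next
      case (basic A)
      then show ?case by (simp add: closed)
    next
      case empty
      show ?case by (simp add: set_lebesgue_integral_def)
    qed
  qed
qed

text \<open>The difference of two transforms need not be integrable. Multiplied by a fixed Gaussian it is, and
a Gaussian times a Gaussian is again an admissible test function.\<close>

lemma has_fourier_unique:
  assumes "has_fourier g G" "has_fourier g G'"
  shows "AE x in lborel. G x = G' x"
proof -
  define h where "h x = (G x - G' x) * complex_of_real (exp (- (x \<bullet> x)))" for x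
  have pair: "integrable lborel (\<lambda>x. (G x - G' x) * \<phi> x)" "(LINT x|lborel. (G x - G' x) * \<phi> x) = 0" if "schwartz \<phi>" for \<phi>
  proof -
    from assms that have *: "integrable lborel (\<lambda>x. G x * \<phi> x)" "integrable lborel (\<lambda>x. G' x * \<phi> x)"
      "(LINT x|lborel. G x * \<phi> x) = (LINT x|lborel. G' x * \<phi> x)"
      unfolding has_fourier_def by metis+
    show "integrable lborel (\<lambda>x. (G x - G' x) * \<phi> x)" "(LINT x|lborel. (G x - G' x) * \<phi> x) = 0"
      using * by (simp_all add: left_diff_distrib)
  qed
  have "AE x in lborel. h x = 0"
  proof (rule AE_zero_if_orthogonal_to_gaussians)
    show "integrable lborel h"
      using pair(1)[OF schwartz_gaussian[of 1 1 0]] by (simp add: h_def[abs_def])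
    fix \<epsilon> :: real and y :: "real^3" assume e: "\<epsilon> > 0"
    \<comment> \<open>The product of the two Gaussians, expanded so that the quadratic and the linear part of the
      exponent are visible.\<close>
    have "complex_of_real (gauss ((x - y) /\<^sub>R \<epsilon>)) * h x = (G x - G' x) *
      complex_of_real (exp (- (y \<bullet> y) / (2 * \<epsilon>\<^sup>2)) / sqrt (2 * pi) ^ 3 * exp (- ((1 + 1 / (2 * \<epsilon>\<^sup>2)) * (x \<bullet> x)) + (y /\<^sub>R \<epsilon>\<^sup>2) \<bullet> x))" for x
    proof -
      have "- (((x - y) /\<^sub>R \<epsilon>) \<bullet> ((x - y) /\<^sub>R \<epsilon>)) / 2 + - (x \<bullet> x)
        = - (y \<bullet> y) / (2 * \<epsilon>\<^sup>2) + (- ((1 + 1 / (2 * \<epsilon>\<^sup>2)) * (x \<bullet> x)) + (y /\<^sub>R \<epsilon>\<^sup>2) \<bullet> x)"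
        using e by (simp add: inner_diff_left inner_diff_right inner_commute field_simps power2_eq_square)
      then have "gauss ((x - y) /\<^sub>R \<epsilon>) * exp (- (x \<bullet> x))
        = exp (- (y \<bullet> y) / (2 * \<epsilon>\<^sup>2)) / sqrt (2 * pi) ^ 3 * exp (- ((1 + 1 / (2 * \<epsilon>\<^sup>2)) * (x \<bullet> x)) + (y /\<^sub>R \<epsilon>\<^sup>2) \<bullet> x)"
        unfolding gauss_eq by (simp only: times_divide_eq_left times_divide_eq_right flip: exp_add)
      then show ?thesis unfolding h_def by (metis mult.commute mult.left_commute of_real_mult)
    qed
    then show "(LINT x|lborel. complex_of_real (gauss ((x - y) /\<^sub>R \<epsilon>)) * h x) = 0"
      using e by (simp only: pair(2)[OF schwartz_gaussian] add_pos_nonneg zero_less_one) (rule pair(2)[OF schwartz_gaussian], simp add: add_pos_pos)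
  qed
  then show ?thesis by eventually_elim (simp add: h_def)
qed

section \<open>Superpositions of plane waves\<close>

text \<open>Continuity and bounded support are exactly what survives from the mode equation, and they are
enough: superpositions of plane waves with such amplitudes are smooth, vanish at infinity and are
square integrable.\<close>

definition amplitude :: "(real^3 \<Rightarrow> complex) \<Rightarrow> bool" where
  "amplitude G \<longleftrightarrow> continuous_on UNIV G \<and> (\<exists>R. \<forall>\<eta>. norm \<eta> > R \<longrightarrow> G \<eta> = 0)"

lemma amplitude_continuous: "amplitude G \<Longrightarrow> continuous_on UNIV G"
  by (simp add: amplitude_def)

lemma amplitude_mult:
  assumes "amplitude G" "continuous_on UNIV m"
  shows "amplitude (\<lambda>\<eta>. m \<eta> * G \<eta>)"
  using assms unfolding amplitude_def by (auto intro!: continuous_intros)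

lemma amplitude_add:
  assumes "amplitude F" "amplitude G"
  shows "amplitude (\<lambda>\<eta>. F \<eta> + G \<eta>)"
proof -
  from assms obtain R S where "\<And>\<eta>. norm \<eta> > R \<Longrightarrow> F \<eta> = 0" "\<And>\<eta>. norm \<eta> > S \<Longrightarrow> G \<eta> = 0"
    unfolding amplitude_def by metis
  then have "\<forall>\<eta>. norm \<eta> > max R S \<longrightarrow> F \<eta> + G \<eta> = 0" by simp
  then have "\<exists>R. \<forall>\<eta>. norm \<eta> > R \<longrightarrow> F \<eta> + G \<eta> = 0" by blast
  with assms show ?thesis unfolding amplitude_def by (intro conjI continuous_intros) auto
qed

lemma amplitude_bounded:
  assumes "amplitude G" shows "\<exists>B. \<forall>\<eta>. norm (G \<eta>) \<le> B"
proof -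
  from assms obtain R where R: "\<And>\<eta>. norm \<eta> > R \<Longrightarrow> G \<eta> = 0" and c: "continuous_on UNIV G"
    unfolding amplitude_def by metis
  have "compact (G ` cball 0 R)" by (intro compact_continuous_image continuous_on_subset[OF c]) auto
  then obtain B where B: "\<And>\<eta>. \<eta> \<in> cball 0 R \<Longrightarrow> norm (G \<eta>) \<le> B"
    using compact_imp_bounded bounded_iff by (metis image_eqI)
  have "norm (G \<eta>) \<le> max B 0" for \<eta>
    using B[of \<eta>] R[of \<eta>] by (cases "norm \<eta> \<le> R") auto
  then show ?thesis by blast
qed

lemma integrable_bounded_support:
  fixes G :: "'a::euclidean_space \<Rightarrow> 'b::{banach, second_countable_topology}"
  assumes "G \<in> borel_measurable borel" "\<And>\<eta>. norm \<eta> > R \<Longrightarrow> G \<eta> = 0" "\<And>\<eta>. norm (G \<eta>) \<le> B"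
  shows "integrable lborel G"
proof (rule Bochner_Integration.integrable_bound)
  show "integrable lborel (\<lambda>x. B * indicat_real (cball (0::'a) R) x)"
    using emeasure_lborel_cball_finite[of "0::'a" R] by (intro integrable_mult_right integrable_real_indicator) auto
  show "AE x in lborel. norm (G x) \<le> norm (B * indicat_real (cball (0::'a) R) x)"
    using assms(2,3) order_trans[OF assms(3) abs_ge_self]
    by (intro AE_I2) (auto simp: indicator_def not_le)
qed (use assms in simp)

lemma amplitude_integrable:
  assumes "amplitude G" shows "integrable lborel G"
  using assms amplitude_bounded[OF assms] unfolding amplitude_def
  by (auto intro: integrable_bounded_support borel_measurable_continuous_onI)

lemma amplitude_measurable: "amplitude G \<Longrightarrow> G \<in> borel_measurable borel"
  by (auto simp: amplitude_def intro: borel_measurable_continuous_onI)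

lemma synthesis_add:
  assumes "amplitude F" "amplitude G"
  shows "synthesis (\<lambda>\<eta>. F \<eta> + G \<eta>) x = synthesis F x + synthesis G x"
  unfolding synthesis_def distrib_left
  by (intro Bochner_Integration.integral_add integrable_cis_mult amplitude_integrable assms) auto

lemma synthesis_cmult: "synthesis (\<lambda>\<eta>. c * F \<eta>) x = c * synthesis F x"
  unfolding synthesis_def mult.left_commute[of _ c] by (rule integral_mult_right_zero)

text \<open>The quadratic error makes differentiation under the integral sign a direct estimate.\<close>

lemma cis_linear_remainder: "norm (cis s - 1 - \<i> * s) \<le> s\<^sup>2"
proof -
  have "norm (cis s - (1 + \<i> * s)) \<le> \<bar>s\<bar> ^ 2 / 2"
    using iexp_approx1[of s 1] by (simp add: cis_conv_exp numeral_2_eq_2)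
  also have "\<dots> \<le> s\<^sup>2" by simp
  finally show ?thesis by (simp add: diff_diff_eq)
qed

lemma amplitude_frequency:
  assumes "amplitude G" shows "amplitude (\<lambda>\<eta>. \<i> * complex_of_real (h \<bullet> \<eta>) * G \<eta>)"
  by (intro amplitude_mult assms continuous_intros)

lemma synthesis_has_derivative:
  assumes G: "amplitude G"
  shows "(synthesis G has_derivative (\<lambda>h. synthesis (\<lambda>\<eta>. \<i> * complex_of_real (h \<bullet> \<eta>) * G \<eta>) x)) (at x)"
    (is "(_ has_derivative ?D) _")
proof (rule has_derivativeI_sandwich[of 1])
  have G': "amplitude (\<lambda>\<eta>. \<i> * complex_of_real (h \<bullet> \<eta>) * G \<eta>)" for h
    by (rule amplitude_frequency[OF G])
  have "linear ?D"
  proof (rule linearI)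
    show "?D (a + b) = ?D a + ?D b" for a b
      by (subst synthesis_add[OF G' G', symmetric]) (simp add: inner_add_left ring_distribs)
    show "?D (c *\<^sub>R a) = c *\<^sub>R ?D a" for c a
      unfolding scaleR_conv_of_real[where 'a = complex] by (subst synthesis_cmult[symmetric]) (simp add: mult_ac)
  qed
  then show "bounded_linear ?D" using linear_conv_bounded_linear by blast
  define K where "K = (LINT \<eta>|lborel. (norm \<eta>)\<^sup>2 * norm (G \<eta>))"
  have Ki: "integrable lborel (\<lambda>\<eta>. (norm \<eta>)\<^sup>2 * norm (G \<eta>))"
  proof -
    have "integrable lborel (\<lambda>\<eta>. norm (complex_of_real ((norm \<eta>)\<^sup>2) * G \<eta>))"
      by (intro integrable_norm amplitude_integrable amplitude_mult G continuous_intros)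
    then show ?thesis by (simp add: norm_mult norm_power)
  qed
  fix y :: "real^3" assume "y \<noteq> x"
  let ?h = "y - x"
  let ?r = "\<lambda>\<eta>. cis (y \<bullet> \<eta>) * G \<eta> - cis (x \<bullet> \<eta>) * G \<eta> - cis (x \<bullet> \<eta>) * (\<i> * complex_of_real (?h \<bullet> \<eta>) * G \<eta>)"
  have i1: "integrable lborel (\<lambda>\<eta>. cis (z \<bullet> \<eta>) * F \<eta>)" if "amplitude F" for z F
    by (intro integrable_cis_mult amplitude_integrable that) auto
  have "synthesis G y - synthesis G x - ?D ?h
    = (LINT \<eta>|lborel. ?r \<eta>)"
    unfolding synthesis_def
    by (subst Bochner_Integration.integral_diff[OF Bochner_Integration.integrable_diff[OF i1[OF G] i1[OF G]] i1[OF G']],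
        subst Bochner_Integration.integral_diff[OF i1[OF G] i1[OF G]]) (rule refl)
  also have "norm \<dots> \<le> (LINT \<eta>|lborel. (norm ?h)\<^sup>2 * ((norm \<eta>)\<^sup>2 * norm (G \<eta>)))"
  proof (rule order_trans[OF integral_norm_bound integral_mono])
    show "integrable lborel (\<lambda>\<eta>. norm (?r \<eta>))"
      by (intro integrable_norm Bochner_Integration.integrable_diff i1 G G')
    show "integrable lborel (\<lambda>\<eta>. (norm ?h)\<^sup>2 * ((norm \<eta>)\<^sup>2 * norm (G \<eta>)))"
      using Ki by (rule integrable_mult_right)
    fix \<eta> :: "real^3"
    have "cis (y \<bullet> \<eta>) = cis (x \<bullet> \<eta>) * cis (?h \<bullet> \<eta>)"
      by (simp add: cis_mult inner_diff_left)
    then have "norm (?r \<eta>)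
      = norm (cis (x \<bullet> \<eta>) * (cis (?h \<bullet> \<eta>) - 1 - \<i> * complex_of_real (?h \<bullet> \<eta>)) * G \<eta>)"
      by (simp add: algebra_simps)
    also have "\<dots> = norm (cis (?h \<bullet> \<eta>) - 1 - \<i> * complex_of_real (?h \<bullet> \<eta>)) * norm (G \<eta>)"
      by (simp only: norm_mult norm_cis mult_1)
    also have "\<dots> \<le> (norm ?h * norm \<eta>)\<^sup>2 * norm (G \<eta>)"
    proof (intro mult_right_mono order_trans[OF cis_linear_remainder])
      show "(?h \<bullet> \<eta>)\<^sup>2 \<le> (norm ?h * norm \<eta>)\<^sup>2"
        using power_mono[OF Cauchy_Schwarz_ineq2[of ?h \<eta>], of 2] by simp
    qed simp
    finally show "norm (?r \<eta>)
      \<le> (norm ?h)\<^sup>2 * ((norm \<eta>)\<^sup>2 * norm (G \<eta>))" by (simp add: power_mult_distrib mult.assoc)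
  qed
  also have "\<dots> = (norm ?h)\<^sup>2 * K" by (simp add: K_def)
  finally have "norm (synthesis G y - synthesis G x - ?D ?h) \<le> (norm ?h)\<^sup>2 * K" .
  then show "norm (synthesis G y - synthesis G x - ?D ?h) / norm ?h \<le> norm ?h * K"
    using \<open>y \<noteq> x\<close> by (simp add: divide_le_eq power2_eq_square mult_ac)
next
  have "((\<lambda>y. norm (y - x) * (LINT \<eta>|lborel. (norm \<eta>)\<^sup>2 * norm (G \<eta>))) \<longlongrightarrow> norm (x - x) * (LINT \<eta>|lborel. (norm \<eta>)\<^sup>2 * norm (G \<eta>))) (at x)"
    by (intro tendsto_intros)
  then show "((\<lambda>y. norm (y - x) * (LINT \<eta>|lborel. (norm \<eta>)\<^sup>2 * norm (G \<eta>))) \<longlongrightarrow> 0) (at x)" by simp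
qed simp

text \<open>The real part is harmless: for Hermitian amplitudes the superposition is real anyway
(\<open>of_real_wave\<close> below). Using it throughout yields real fields without side conditions.\<close>

definition wave :: "(real^3 \<Rightarrow> complex) \<Rightarrow> real^3 \<Rightarrow> real" where
  "wave G x = Re (synthesis G x)"

definition deriv_symbol :: "3 \<Rightarrow> (real^3 \<Rightarrow> complex) \<Rightarrow> real^3 \<Rightarrow> complex" where
  "deriv_symbol j G \<eta> = \<i> * complex_of_real (\<eta> $ j) * G \<eta>"

lemma amplitude_deriv_symbol: "amplitude G \<Longrightarrow> amplitude (deriv_symbol j G)"
  unfolding deriv_symbol_def by (intro amplitude_mult continuous_intros)

lemma wave_has_derivative:
  assumes "amplitude G"
  shows "(wave G has_derivative (\<lambda>h. wave (\<lambda>\<eta>. \<i> * complex_of_real (h \<bullet> \<eta>) * G \<eta>) x)) (at x)"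
  unfolding wave_def by (rule has_derivative_Re[OF synthesis_has_derivative[OF assms]])

lemma partial_wave:
  assumes "amplitude G" shows "partial j (wave G) = wave (deriv_symbol j G)"
  by (rule ext, subst partial_eqI[OF wave_has_derivative[OF assms]])
     (simp add: deriv_symbol_def[abs_def] inner_axis')

lemma C_class_wave:
  assumes "amplitude G" shows "C_class n (wave G)"
proof (rule C_classI)
  show "wave G \<in> {wave G |G. amplitude G}" using assms by blast
qed (auto simp: partial_wave intro: amplitude_deriv_symbol differentiableI[OF wave_has_derivative])

definition field :: "(3 \<Rightarrow> real^3 \<Rightarrow> complex) \<Rightarrow> real^3 \<Rightarrow> real^3" where
  "field G x = (\<chi> j. wave (G j) x)"

lemma field_nth [simp]: "field G x $ j = wave (G j) x"
  by (simp add: field_def)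

lemma field_has_derivative:
  assumes "\<And>j. amplitude (G j)"
  shows "(field G has_derivative (\<lambda>h. field (\<lambda>j \<eta>. \<i> * complex_of_real (h \<bullet> \<eta>) * G j \<eta>) x)) (at x)"
  by (subst has_derivative_componentwise_within)
     (auto simp: Basis_vec_def inner_axis intro!: wave_has_derivative assms)

lemma partial_field:
  assumes "\<And>j. amplitude (G j)" shows "partial k (field G) = field (\<lambda>j. deriv_symbol k (G j))"
  by (rule ext, subst partial_eqI[OF field_has_derivative[OF assms]])
     (simp_all add: deriv_symbol_def[abs_def] inner_axis')

lemma C_class_field:
  assumes "\<And>j. amplitude (G j)" shows "C_class n (field G)"
proof (rule C_classI)
  show "field G \<in> {field G |G. \<forall>j. amplitude (G j)}" using assms by blast
next
  fix g k assume "g \<in> {field G |G. \<forall>j. amplitude (G j)}"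
  then obtain H where "g = field H" "\<And>j. amplitude (H j)" by blast
  then show "partial k g \<in> {field G |G. \<forall>j. amplitude (G j)}"
    by (auto simp: partial_field intro!: exI[of _ "\<lambda>j. deriv_symbol k (H j)"] amplitude_deriv_symbol)
next
  fix g x assume "g \<in> {field G |G. \<forall>j. amplitude (G j)}"
  then obtain H where "g = field H" "\<And>j. amplitude (H j)" by blast
  then show "g differentiable (at x)" using differentiableI[OF field_has_derivative] by blast
qed

lemma continuous_wave: "amplitude G \<Longrightarrow> continuous_on UNIV (wave G)"
  using C_class_wave[of G 0] unfolding C_class_def by (auto dest: spec[of _ "[]"])

text \<open>The Riemann-Lebesgue lemma. Translating the frequency by \<open>s x = (\<pi> / |x|\<^sup>2) x\<close> changes the sign of
the exponential \<open>cis (x \<bullet> \<eta>)\<close>, so twice the superposition is the superposition of the difference of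
\<open>G\<close> and its translate. This difference is small in \<open>L\<^sup>1\<close>, because \<open>s x\<close> tends to zero.\<close>

lemma synthesis_tendsto_0:
  assumes G: "amplitude G"
  shows "(synthesis G \<longlongrightarrow> 0) at_infinity"
proof -
  define I where "I h = (LINT \<eta>|lborel. norm (G \<eta> - G (\<eta> + h)))" for h
  from G obtain R where R: "\<And>\<eta>. norm \<eta> > R \<Longrightarrow> G \<eta> = 0" and c: "continuous_on UNIV G"
    unfolding amplitude_def by metis
  obtain B where B: "\<And>\<eta>. norm (G \<eta>) \<le> B" using amplitude_bounded[OF G] by blast
  have [measurable]: "G \<in> borel_measurable borel" using amplitude_measurable[OF G] .
  have iG: "integrable lborel G" by (rule amplitude_integrable[OF G])
  have iGh: "integrable lborel (\<lambda>\<eta>. G (\<eta> + h))" for h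
    using lborel_integrable_affine[OF _ iG, of 1 h] by (simp add: add.commute)
  have I0: "(I \<longlongrightarrow> 0) (at 0)"
  proof (subst tendsto_at_iff_sequentially, intro allI impI)
    fix X :: "nat \<Rightarrow> real^3" assume "X \<longlonglongrightarrow> 0"
    then obtain N where N: "\<And>n. n \<ge> N \<Longrightarrow> norm (X n) < 1" 
      using LIMSEQ_D[of X 0 1] by auto
    have "(\<lambda>n. LINT \<eta>|lborel. norm (G \<eta> - G (\<eta> + X (n + N)))) \<longlonglongrightarrow> (LINT \<eta>|lborel. norm (G \<eta> - G (\<eta> + 0)))"
    proof (rule integral_dominated_convergence[where w = "\<lambda>\<eta>. (2 * B) * indicat_real (cball (0::real^3) (R + 1)) \<eta>"])
      show "integrable lborel (\<lambda>\<eta>. (2 * B) * indicat_real (cball (0::real^3) (R + 1)) \<eta>)"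
        using emeasure_lborel_cball_finite by (intro integrable_mult_right integrable_real_indicator) auto
      show "AE \<eta> in lborel. (\<lambda>n. norm (G \<eta> - G (\<eta> + X (n + N)))) \<longlonglongrightarrow> norm (G \<eta> - G (\<eta> + 0))"
        using LIMSEQ_ignore_initial_segment[OF \<open>X \<longlonglongrightarrow> 0\<close>, of N]
        by (intro AE_I2 tendsto_intros continuous_on_tendsto_compose[OF c]) auto
      show "AE \<eta> in lborel. norm (norm (G \<eta> - G (\<eta> + X (n + N)))) \<le> (2 * B) * indicat_real (cball (0::real^3) (R + 1)) \<eta>" for n
      proof (rule AE_I2)
        fix \<eta> :: "real^3"
        show "norm (norm (G \<eta> - G (\<eta> + X (n + N)))) \<le> (2 * B) * indicat_real (cball (0::real^3) (R + 1)) \<eta>"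
        proof (cases "\<eta> \<in> cball 0 (R + 1)")
          case True
          then show ?thesis using norm_triangle_ineq4[of "G \<eta>" "G (\<eta> + X (n + N))"] B[of \<eta>] B[of "\<eta> + X (n + N)"]
            by (simp add: indicator_def)
        next
          case False
          then have "norm \<eta> > R + 1" by simp
          moreover have "norm (\<eta> + X (n + N)) > R"
            using norm_diff_ineq[of \<eta> "X (n + N)"] N[of "n + N"] \<open>norm \<eta> > R + 1\<close> by simp
          ultimately show ?thesis using R by simp
        qed
      qed
    qed simp_all
    then have "(\<lambda>n. I (X (n + N))) \<longlonglongrightarrow> 0" by (simp add: I_def)
    then show "(I \<circ> X) \<longlonglongrightarrow> 0" using LIMSEQ_offset[of "I \<circ> X" N] by (simp add: o_def)
  qed
  have nz: "eventually (\<lambda>x. x \<noteq> (0 :: real^3)) at_infinity"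
    by (auto simp: eventually_at_infinity intro!: exI[of _ 1])
  \<comment> \<open>The translation is chosen such that \<open>x \<bullet> s x = \<pi>\<close>.\<close>
  define s where "s x = (pi / (x \<bullet> x)) *\<^sub>R x" for x :: "real^3"
  have ns: "norm (s x) = pi / norm x" for x
    by (simp add: s_def power2_norm_eq_inner[symmetric] power2_eq_square)
  have "((\<lambda>x::real^3. pi / norm x) \<longlongrightarrow> 0) at_infinity"
    by (rule real_tendsto_divide_at_top[OF tendsto_const filterlim_norm_at_top])
  then have "(s \<longlongrightarrow> 0) at_infinity" by (subst tendsto_norm_zero_iff[symmetric]) (simp only: ns)
  moreover have "eventually (\<lambda>x. s x \<noteq> 0) at_infinity"
    by (rule eventually_mono[OF nz]) (simp add: s_def)
  ultimately have "filterlim s (at 0) at_infinity" by (simp add: filterlim_at)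
  from filterlim_compose[OF I0 this] have Is: "((\<lambda>x. I (s x)) \<longlongrightarrow> 0) at_infinity" .
  have "norm (synthesis G x) \<le> I (s x)" if "x \<noteq> 0" for x
  proof -
    have "x \<bullet> s x = pi" using that by (simp add: s_def)
    have "synthesis G x = (LINT \<eta>|lborel. cis (x \<bullet> (s x + 1 *\<^sub>R \<eta>)) * G (s x + 1 *\<^sub>R \<eta>))"
      unfolding synthesis_def by (subst lborel_integral_affine[of 1 _ "s x"]) auto
    also have "\<dots> = (LINT \<eta>|lborel. - (cis (x \<bullet> \<eta>) * G (\<eta> + s x)))"
      using \<open>x \<bullet> s x = pi\<close> by (simp add: inner_add_right cis_mult[symmetric] add.commute)
    finally have "2 * synthesis G x = (LINT \<eta>|lborel. cis (x \<bullet> \<eta>) * G \<eta>) - (LINT \<eta>|lborel. cis (x \<bullet> \<eta>) * G (\<eta> + s x))"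
      by (simp add: synthesis_def)
    also have "\<dots> = (LINT \<eta>|lborel. cis (x \<bullet> \<eta>) * G \<eta> - cis (x \<bullet> \<eta>) * G (\<eta> + s x))"
      by (intro Bochner_Integration.integral_diff[symmetric] integrable_cis_mult iG iGh) auto
    also have "norm \<dots> \<le> I (s x)"
      unfolding I_def by (rule order_trans[OF integral_norm_bound]) (simp add: norm_mult flip: right_diff_distrib)
    finally have "2 * norm (synthesis G x) \<le> I (s x)" by (simp add: norm_mult)
    then show ?thesis using norm_ge_zero[of "synthesis G x"] by linarith
  qed
  then have "eventually (\<lambda>x. norm (synthesis G x) \<le> I (s x)) at_infinity"
    by (rule eventually_mono[OF nz])
  with Is show ?thesis by (rule Lim_null_comparison[rotated])
qed

lemma field_tendsto_0:
  assumes "\<And>j. amplitude (G j)" shows "((\<lambda>x. norm (field G x)) \<longlongrightarrow> 0) at_infinity"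
proof -
  have "((\<lambda>x. field G x $ j) \<longlongrightarrow> 0) at_infinity" for j
    using tendsto_Re[OF synthesis_tendsto_0[OF assms[of j]]] by (simp add: wave_def)
  then have "((\<lambda>x. field G x) \<longlongrightarrow> 0) at_infinity" by (intro vec_tendstoI) simp
  then show ?thesis by (rule tendsto_norm_zero)
qed

section \<open>Hermitian amplitudes and Sobolev norms\<close>

text \<open>A distributional transform is tested against a Gaussian, which has no zeros and can be divided
out.\<close>

lemma has_fourier_measurable:
  assumes "has_fourier g G" shows "G \<in> borel_measurable borel"
proof -
  have "integrable lborel (\<lambda>x. G x * complex_of_real (1 * exp (- (1 * (x \<bullet> x)) + 0 \<bullet> x)))"
    using assms schwartz_gaussian[of 1 1 0] unfolding has_fourier_def by fastforce
  then have [measurable]: "(\<lambda>x. G x * complex_of_real (1 * exp (- (1 * (x \<bullet> x)) + 0 \<bullet> x))) \<in> borel_measurable borel"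
    by auto
  have "(\<lambda>x. G x * complex_of_real (1 * exp (- (1 * (x \<bullet> x)) + 0 \<bullet> x)) / complex_of_real (exp (- (x \<bullet> x)))) \<in> borel_measurable borel"
    by measurable
  then show ?thesis by simp
qed

text \<open>The symmetry of the Fourier transforms of real functions.\<close>

definition hermitian :: "(real^3 \<Rightarrow> complex) \<Rightarrow> bool" where
  "hermitian G \<longleftrightarrow> (\<forall>\<eta>. G (- \<eta>) = cnj (G \<eta>))"

lemma hermitian_deriv_symbol: "hermitian G \<Longrightarrow> hermitian (deriv_symbol j G)"
  by (simp add: hermitian_def deriv_symbol_def)

lemma hermitian_diff: "hermitian F \<Longrightarrow> hermitian G \<Longrightarrow> hermitian (\<lambda>\<eta>. F \<eta> - G \<eta>)"
  by (simp add: hermitian_def)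

lemma amplitude_diff: "amplitude F \<Longrightarrow> amplitude G \<Longrightarrow> amplitude (\<lambda>\<eta>. F \<eta> - G \<eta>)"
  using amplitude_add[of F "\<lambda>\<eta>. (-1) * G \<eta>"] amplitude_mult[of G "\<lambda>_. -1"] by simp

lemma of_real_wave:
  assumes "amplitude G" "hermitian G"
  shows "complex_of_real (wave G x) = synthesis G x"
proof -
  have [measurable]: "G \<in> borel_measurable borel" by (rule amplitude_measurable[OF assms(1)])
  have "cnj (synthesis G x) = (LINT \<eta>|lborel. cis (x \<bullet> (- \<eta>)) * G (- \<eta>))"
    unfolding synthesis_def using assms(2)
    by (subst Bochner_Integration.integral_cnj[symmetric]) (simp add: cis_cnj hermitian_def)
  also have "\<dots> = synthesis G x"
    unfolding synthesis_def by (subst lborel_integral_affine[of "-1" _ 0]) simp_all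
  finally have "synthesis G x \<in> \<real>" by (simp add: Reals_cnj_iff)
  then show ?thesis by (simp add: wave_def of_real_Re)
qed

lemma has_fourier_wave:
  assumes "amplitude G" "hermitian G"
  shows "has_fourier (\<lambda>x. complex_of_real (wave G x)) (\<lambda>\<xi>. complex_of_real ((2 * pi) ^ 3) * G \<xi>)"
proof -
  obtain B where "\<And>\<eta>. norm (G \<eta>) \<le> B" using amplitude_bounded[OF assms(1)] by blast
  from has_fourier_synthesis[OF amplitude_integrable[OF assms(1)] amplitude_continuous[OF assms(1)] this]
  show ?thesis by (simp only: of_real_wave[OF assms])
qed

lemma wave_L2:
  assumes "amplitude G" "hermitian G"
  shows "integrable lborel (\<lambda>x. (wave G x)\<^sup>2)"
    and "(LINT x|lborel. (wave G x)\<^sup>2) = (2 * pi) ^ 3 * (LINT \<xi>|lborel. (norm (G \<xi>))\<^sup>2)"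
proof -
  have e: "(wave G x)\<^sup>2 = (norm (synthesis G x))\<^sup>2" for x
    by (subst of_real_wave[OF assms, symmetric]) simp
  obtain B where B: "\<And>\<eta>. norm (G \<eta>) \<le> B" using amplitude_bounded[OF assms(1)] by blast
  note pl = plancherel[OF amplitude_integrable[OF assms(1)] amplitude_continuous[OF assms(1)] B]
  show "integrable lborel (\<lambda>x. (wave G x)\<^sup>2)"
    and "(LINT x|lborel. (wave G x)\<^sup>2) = (2 * pi) ^ 3 * (LINT \<xi>|lborel. (norm (G \<xi>))\<^sup>2)"
    using pl by (simp_all only: e)
qed

lemma L2_norm_field:
  assumes "\<And>j. amplitude (G j)" "\<And>j. hermitian (G j)"
  shows "L2_norm (field G) = sqrt ((2 * pi) ^ 3 * (LINT \<xi>|lborel. (\<Sum>j\<in>UNIV. (norm (G j \<xi>))\<^sup>2)))"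
proof -
  have i: "integrable lborel (\<lambda>\<xi>. (norm (G j \<xi>))\<^sup>2)" for j
  proof -
    have "integrable lborel (\<lambda>\<xi>. norm (G j \<xi> * G j \<xi>))"
      by (intro integrable_norm amplitude_integrable amplitude_mult assms amplitude_continuous)
    then show ?thesis by (simp add: norm_mult power2_eq_square)
  qed
  have "(LINT x|lborel. (norm (field G x))\<^sup>2) = (LINT x|lborel. (\<Sum>j\<in>UNIV. (wave (G j) x)\<^sup>2))"
    by (simp add: norm_vec_def L2_set_def sum_nonneg)
  also have "\<dots> = (\<Sum>j\<in>UNIV. (2 * pi) ^ 3 * (LINT \<xi>|lborel. (norm (G j \<xi>))\<^sup>2))"
    by (subst Bochner_Integration.integral_sum) (simp_all only: wave_L2 assms)
  also have "\<dots> = (2 * pi) ^ 3 * (LINT \<xi>|lborel. (\<Sum>j\<in>UNIV. (norm (G j \<xi>))\<^sup>2))"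
    by (simp add: i sum_distrib_left)
  finally show ?thesis by (simp add: L2_norm_def)
qed

lemma sobolev_scalar_wave:
  assumes "amplitude G" "hermitian G"
  shows "sobolev_scalar k (\<lambda>x. complex_of_real (wave G x))"
  unfolding sobolev_scalar_def
proof (intro conjI exI)
  show "(\<lambda>x. complex_of_real (wave G x)) \<in> borel_measurable lborel"
    using borel_measurable_continuous_onI[OF continuous_wave[OF assms(1)]] by simp
  show "integrable lborel (\<lambda>x. (norm (complex_of_real (wave G x)))\<^sup>2)"
    using wave_L2(1)[OF assms] by simp
  show "has_fourier (\<lambda>x. complex_of_real (wave G x)) (\<lambda>\<xi>. complex_of_real ((2 * pi) ^ 3) * G \<xi>)"
    by (rule has_fourier_wave[OF assms])
  have "integrable lborel (\<lambda>\<xi>. norm (complex_of_real ((1 + (norm \<xi>)\<^sup>2) ^ k) *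
      ((complex_of_real ((2 * pi) ^ 3) * G \<xi>) * (complex_of_real ((2 * pi) ^ 3) * G \<xi>))))"
    by (intro integrable_norm amplitude_integrable amplitude_mult assms continuous_intros amplitude_continuous)
  then show "integrable lborel (\<lambda>\<xi>. (1 + (norm \<xi>)\<^sup>2) ^ k * (norm (complex_of_real ((2 * pi) ^ 3) * G \<xi>))\<^sup>2)"
    by (simp only: norm_mult norm_of_real abs_of_nonneg power2_eq_square zero_le_power add_nonneg_nonneg
        zero_le_one mult_nonneg_nonneg norm_ge_zero)
qed

text \<open>The norm is defined by a transform chosen by \<open>SOME\<close>; uniqueness almost everywhere permits replacing
it by the amplitude.\<close>

lemma sobolev_norm_scalar_wave:
  assumes "amplitude G" "hermitian G"
  shows "(sobolev_norm_scalar k (\<lambda>x. complex_of_real (wave G x)))\<^sup>2 =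
    (2 * pi) ^ 3 * (LINT \<xi>|lborel. (1 + (norm \<xi>)\<^sup>2) ^ k * (norm (G \<xi>))\<^sup>2)"
proof -
  let ?g = "\<lambda>x. complex_of_real (wave G x)" and ?c = "complex_of_real ((2 * pi) ^ 3)"
  have f: "has_fourier ?g (fourier ?g)"
    unfolding fourier_def using has_fourier_wave[OF assms] by (rule someI[of "has_fourier ?g"])
  have [measurable]: "fourier ?g \<in> borel_measurable borel" "G \<in> borel_measurable borel"
    using has_fourier_measurable[OF f] amplitude_measurable[OF assms(1)] by auto
  have "AE \<xi> in lborel. fourier ?g \<xi> = ?c * G \<xi>"
    by (rule has_fourier_unique[OF f has_fourier_wave[OF assms]])
  then have "(LINT \<xi>|lborel. (1 + (norm \<xi>)\<^sup>2) ^ k * (norm (fourier ?g \<xi>))\<^sup>2)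
      = (LINT \<xi>|lborel. (1 + (norm \<xi>)\<^sup>2) ^ k * (norm (?c * G \<xi>))\<^sup>2)"
    by (intro integral_cong_AE) (auto simp del: of_real_mult of_real_power)
  also have "\<dots> = (LINT \<xi>|lborel. ((2 * pi) ^ 3)\<^sup>2 * ((1 + (norm \<xi>)\<^sup>2) ^ k * (norm (G \<xi>))\<^sup>2))"
    by (simp only: norm_mult norm_of_real power_mult_distrib power2_abs mult.left_commute)
  also have "\<dots> = ((2 * pi) ^ 3)\<^sup>2 * (LINT \<xi>|lborel. (1 + (norm \<xi>)\<^sup>2) ^ k * (norm (G \<xi>))\<^sup>2)"
    by (rule integral_mult_right_zero)
  finally have e: "(LINT \<xi>|lborel. (1 + (norm \<xi>)\<^sup>2) ^ k * (norm (fourier ?g \<xi>))\<^sup>2)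
      = ((2 * pi) ^ 3)\<^sup>2 * (LINT \<xi>|lborel. (1 + (norm \<xi>)\<^sup>2) ^ k * (norm (G \<xi>))\<^sup>2)" .
  have cancel: "c\<^sup>2 * I / c = c * I" if "c > 0" for c I :: real
    using that by (simp add: power2_eq_square)
  have "(LINT \<xi>|lborel. (1 + (norm \<xi>)\<^sup>2) ^ k * (norm (fourier ?g \<xi>))\<^sup>2) / (2 * pi) ^ 3
      = (2 * pi) ^ 3 * (LINT \<xi>|lborel. (1 + (norm \<xi>)\<^sup>2) ^ k * (norm (G \<xi>))\<^sup>2)"
    unfolding e by (rule cancel) simp
  moreover have "0 \<le> (LINT \<xi>|lborel. (1 + (norm \<xi>)\<^sup>2) ^ k * (norm (G \<xi>))\<^sup>2)"
    by (intro integral_nonneg_AE AE_I2 mult_nonneg_nonneg zero_le_power) (simp_all add: add_nonneg_nonneg)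
  ultimately show ?thesis
    unfolding sobolev_norm_scalar_def by (simp only:) simp
qed

lemma sobolev_field:
  assumes "\<And>j. amplitude (G j)" "\<And>j. hermitian (G j)"
  shows "sobolev k (field G)"
  unfolding sobolev_def using sobolev_scalar_wave assms by simp

lemma sobolev_norm_field:
  assumes "\<And>j. amplitude (G j)" "\<And>j. hermitian (G j)"
  shows "sobolev_norm k (field G) =
    sqrt ((2 * pi) ^ 3 * (\<Sum>j\<in>UNIV. LINT \<xi>|lborel. (1 + (norm \<xi>)\<^sup>2) ^ k * (norm (G j \<xi>))\<^sup>2))"
  unfolding sobolev_norm_def by (simp only: field_nth sobolev_norm_scalar_wave assms sum_distrib_left)

lemma inverse_laplacian_wave:
  assumes "amplitude H" "hermitian H" "amplitude P" "hermitian P"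
    and "\<And>\<xi>. P \<xi> = complex_of_real (- 1 / (norm \<xi>)\<^sup>2) * H \<xi>"
  shows "inverse_laplacian (wave H) (wave P)"
proof -
  have "(\<lambda>\<xi>. complex_of_real ((2 * pi) ^ 3) * P \<xi>)
      = (\<lambda>\<xi>. complex_of_real (- 1 / (norm \<xi>)\<^sup>2) * (complex_of_real ((2 * pi) ^ 3) * H \<xi>))"
    by (simp only: assms(5) mult.left_commute)
  with has_fourier_wave[OF assms(3,4)]
  have "has_fourier (\<lambda>x. complex_of_real (wave P x))
      (\<lambda>\<xi>. complex_of_real (- 1 / (norm \<xi>)\<^sup>2) * (complex_of_real ((2 * pi) ^ 3) * H \<xi>))"
    by (simp only:)
  with has_fourier_wave[OF assms(1,2)] show ?thesis
    unfolding inverse_laplacian_def fourier_multiplier_def by (intro exI conjI)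
qed

lemma synthesis_diff:
  assumes "amplitude F" "amplitude G"
  shows "synthesis (\<lambda>\<eta>. F \<eta> - G \<eta>) x = synthesis F x - synthesis G x"
  unfolding synthesis_def right_diff_distrib
  by (intro Bochner_Integration.integral_diff integrable_cis_mult amplitude_integrable assms) auto

lemma field_diff:
  assumes "\<And>j. amplitude (F j)" "\<And>j. amplitude (G j)"
  shows "field F x - field G x = field (\<lambda>j \<eta>. F j \<eta> - G j \<eta>) x"
  by (simp add: vec_eq_iff wave_def synthesis_diff assms)

lemma gradient_wave: "amplitude Q \<Longrightarrow> gradient (wave Q) = field (\<lambda>j. deriv_symbol j Q)"
  by (simp add: fun_eq_iff gradient_def field_def partial_wave)

text \<open>The square of the Sobolev norm of a difference is an integral over a fixed ball of frequencies, where
the amplitudes are uniformly bounded; dominated convergence applies.\<close>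

lemma C_sobolev_field:
  assumes amp: "\<And>t j. t \<in> {0..T} \<Longrightarrow> amplitude (G t j)" "\<And>t j. t \<in> {0..T} \<Longrightarrow> hermitian (G t j)"
    and supp: "\<And>t j \<eta>. t \<in> {0..T} \<Longrightarrow> norm \<eta> > R \<Longrightarrow> G t j \<eta> = 0"
    and cont: "\<And>j. continuous_on ({0..T} \<times> UNIV) (\<lambda>(t, \<eta>). G t j \<eta>)"
  shows "C_sobolev T k (\<lambda>t. field (G t))"
  unfolding C_sobolev_def
proof (intro ballI conjI)
  fix t assume t: "t \<in> {0..T}"
  show "sobolev k (field (G t))" using sobolev_field amp t by blast
  define D where "D j s = (LINT \<xi>|lborel. (1 + (norm \<xi>)\<^sup>2) ^ k * (norm (G s j \<xi> - G t j \<xi>))\<^sup>2)" for j s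
  have "(D j \<longlongrightarrow> 0) (at t within {0..T})" for j
  proof (subst tendsto_at_iff_sequentially, intro allI impI)
    fix X :: "nat \<Rightarrow> real" assume "\<forall>i. X i \<in> {0..T} - {t}" and X: "X \<longlonglongrightarrow> t"
    then have Xi: "X i \<in> {0..T}" for i by blast
    have "compact ((\<lambda>(t, \<eta>). G t j \<eta>) ` ({0..T} \<times> cball 0 R))"
      by (intro compact_continuous_image continuous_on_subset[OF cont] compact_Times) auto
    then obtain B where "\<forall>y \<in> (\<lambda>(t, \<eta>). G t j \<eta>) ` ({0..T} \<times> cball 0 R). norm y \<le> B"
      using compact_imp_bounded bounded_iff by metis
    then have B: "norm (G s j \<eta>) \<le> B" if "s \<in> {0..T}" "norm \<eta> \<le> R" for s \<eta>
      using that by force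
    let ?d = "\<lambda>n \<xi>. (1 + (norm \<xi>)\<^sup>2) ^ k * (norm (G (X n) j \<xi> - G t j \<xi>))\<^sup>2"
      and ?w = "\<lambda>\<xi>. ((1 + R\<^sup>2) ^ k * (2 * B)\<^sup>2) * indicat_real (cball (0::real^3) R) \<xi>"
    have "(\<lambda>n. D j (X n)) \<longlonglongrightarrow> (LINT \<xi>|lborel. (1 + (norm \<xi>)\<^sup>2) ^ k * (norm (G t j \<xi> - G t j \<xi>))\<^sup>2)"
      unfolding D_def
    proof (rule integral_dominated_convergence[where w = ?w])
      have [measurable]: "G s j \<in> borel_measurable borel" if "s \<in> {0..T}" for s
        using amplitude_measurable[OF amp(1)[OF that]] .
      note [measurable] = this[OF Xi] this[OF t]
      show "?d n \<in> borel_measurable lborel" for n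
        by measurable
      show "integrable lborel ?w"
        using emeasure_lborel_cball_finite by (intro integrable_mult_right integrable_real_indicator) auto
      show "AE \<xi> in lborel. (\<lambda>n. ?d n \<xi>)
          \<longlonglongrightarrow> (1 + (norm \<xi>)\<^sup>2) ^ k * (norm (G t j \<xi> - G t j \<xi>))\<^sup>2"
      proof (rule AE_I2)
        fix \<xi> :: "real^3"
        have "(\<lambda>n. (X n, \<xi>)) \<longlonglongrightarrow> (t, \<xi>)" by (intro tendsto_Pair X tendsto_const)
        from continuous_on_tendsto_compose[OF cont[of j] this]
        have "(\<lambda>n. G (X n) j \<xi>) \<longlonglongrightarrow> G t j \<xi>" using t Xi by simp
        then show "(\<lambda>n. ?d n \<xi>)
          \<longlonglongrightarrow> (1 + (norm \<xi>)\<^sup>2) ^ k * (norm (G t j \<xi> - G t j \<xi>))\<^sup>2" by (intro tendsto_intros)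
      qed
      show "AE \<xi> in lborel. norm (?d n \<xi>)
          \<le> ?w \<xi>" for n
      proof (rule AE_I2)
        fix \<xi> :: "real^3"
        show "norm (?d n \<xi>)
          \<le> ?w \<xi>"
        proof (cases "norm \<xi> \<le> R")
          case True
          have 1: "norm (G (X n) j \<xi> - G t j \<xi>) \<le> 2 * B"
            using norm_triangle_ineq4[of "G (X n) j \<xi>" "G t j \<xi>"] B[OF Xi True, of n] B[OF t True] by simp
          have "?d n \<xi> \<le> (1 + R\<^sup>2) ^ k * (2 * B)\<^sup>2"
            by (intro mult_mono power_mono 1 add_left_mono True) (simp_all add: add_nonneg_nonneg)
          moreover have "0 \<le> ?d n \<xi>"
            by (intro mult_nonneg_nonneg zero_le_power) (simp_all add: add_nonneg_nonneg)
          ultimately show ?thesis using True by simp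
        next
          case False
          then show ?thesis using supp[OF Xi] supp[OF t] by simp
        qed
      qed
    qed simp
    then show "(D j \<circ> X) \<longlonglongrightarrow> 0" by (simp add: o_def)
  qed
  then have "((\<lambda>s. sqrt ((2 * pi) ^ 3 * (\<Sum>j\<in>UNIV. D j s))) \<longlongrightarrow> sqrt ((2 * pi) ^ 3 * (\<Sum>j\<in>(UNIV::3 set). 0))) (at t within {0..T})"
    by (intro tendsto_intros)
  moreover have "sobolev_norm k (\<lambda>x. field (G s) x - field (G t) x) = sqrt ((2 * pi) ^ 3 * (\<Sum>j\<in>UNIV. D j s))"
    if s: "s \<in> {0..T}" for s
  proof -
    have "(\<lambda>x. field (G s) x - field (G t) x) = field (\<lambda>j \<eta>. G s j \<eta> - G t j \<eta>)"
      by (rule ext, rule field_diff) (use amp s t in blast)+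
    then show ?thesis
      by (simp only: D_def) (rule sobolev_norm_field; intro amplitude_diff hermitian_diff amp s t)
  qed
  ultimately show "((\<lambda>s. sobolev_norm k (\<lambda>x. field (G s) x - field (G t) x)) \<longlongrightarrow> 0) (at t within {0..T})"
    by (subst tendsto_cong[of _ "\<lambda>s. sqrt ((2 * pi) ^ 3 * (\<Sum>j\<in>UNIV. D j s))"])
       (simp_all add: eventually_at_filter)
qed

section \<open>Differential equations depending on a parameter\<close>

text \<open>Rescaling to the unit interval turns the variable end point into a second parameter.\<close>

lemma continuous_indefinite_integral_with_parameter:
  fixes g :: "'p::topological_space \<Rightarrow> real \<Rightarrow> 'e::banach"
  assumes g: "continuous_on (UNIV \<times> {0..T}) (\<lambda>(p, s). g p s)"
  shows "continuous_on ({0..T} \<times> UNIV) (\<lambda>(t, p). integral {0..t} (g p))"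
proof -
  have "continuous_on ({0..T} \<times> UNIV) (\<lambda>y. integral (cbox 0 1) (\<lambda>\<sigma>. g (snd y) (fst y * \<sigma>)))"
  proof (rule integral_continuous_on_param)
    have "(\<lambda>(y, \<sigma>). g (snd y) (fst y * \<sigma>)) = (\<lambda>(p, s). g p s) \<circ> (\<lambda>(y, \<sigma>). (snd y, fst y * \<sigma>))"
      by auto
    moreover have "continuous_on (({0..T} \<times> UNIV) \<times> cbox 0 1) ((\<lambda>(p, s). g p s) \<circ> (\<lambda>(y, \<sigma>). (snd y, fst y * \<sigma>)))"
      by (intro continuous_on_compose continuous_on_subset[OF g])
         (auto intro!: continuous_intros mult_le_one mult_left_le order_trans[OF mult_left_le] simp: split_beta)
    ultimately show "continuous_on (({0..T} \<times> UNIV) \<times> cbox 0 1) (\<lambda>(y, \<sigma>). g (snd y) (fst y * \<sigma>))"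
      by (simp only:)
  qed
  then have "continuous_on ({0..T} \<times> UNIV) (\<lambda>y. fst y *\<^sub>R integral {0..1} (\<lambda>\<sigma>. g (snd y) (fst y * \<sigma>)))"
    by (intro continuous_intros) simp
  moreover have "fst y *\<^sub>R integral {0..1} (\<lambda>\<sigma>. g (snd y) (fst y * \<sigma>)) = (case y of (t, p) \<Rightarrow> integral {0..t} (g p))"
    if y: "y \<in> {0..T} \<times> UNIV" for y
  proof (cases "fst y = 0")
    case False
    then have t: "fst y > 0" using y by auto
    have c: "continuous_on {0..fst y} (g (snd y))"
      by (rule continuous_on_compose2[OF g, of _ "\<lambda>s. (snd y, s)", simplified]) (use y in \<open>auto intro!: continuous_intros\<close>)
    have "(g (snd y) has_integral integral {0..fst y} (g (snd y))) {0..fst y}"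
      by (intro integrable_integral integrable_continuous_real c)
    moreover have "(\<lambda>x. x / fst y) ` {0..fst y} = {0..1}"
      using t by (simp add: image_divide_atLeastAtMost)
    ultimately have "((\<lambda>\<sigma>. g (snd y) (fst y * \<sigma>)) has_integral (1 / fst y) *\<^sub>R integral {0..fst y} (g (snd y))) {0..1}"
      using has_integral_stretch_real[of "g (snd y)" _ 0 "fst y" "fst y"] t by simp
    then show ?thesis using t by (simp add: integral_unique split_beta)
  qed (auto simp: split_beta)
  ultimately show ?thesis by (simp cong: continuous_on_cong)
qed

text \<open>Picard's fixed point argument, carried out in the space of bounded continuous functions of time and
parameter jointly, so that continuity in the parameter is part of the result. The unknown is
multiplied by \<open>exp (- L t)\<close> with \<open>L > 2 M\<close>, which turns the integral operator into a
contraction with factor \<open>1/2\<close> on the whole interval at once.\<close>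

lemma lipschitz_ode_with_parameter:
  fixes A :: "real \<Rightarrow> 'p::metric_space \<Rightarrow> 'e::euclidean_space \<Rightarrow> 'e" and v0 :: 'e
  assumes T: "0 \<le> T"
    and cont: "continuous_on ({0..T} \<times> UNIV \<times> UNIV) (\<lambda>(t, p, v). A t p v)"
    and lip: "\<And>t p v w. t \<in> {0..T} \<Longrightarrow> norm (A t p v - A t p w) \<le> M * norm (v - w)"
    and zero: "\<And>t p. t \<in> {0..T} \<Longrightarrow> A t p 0 = 0"
    and M: "0 \<le> M"
  shows "\<exists>V. continuous_on ({0..T} \<times> UNIV) (\<lambda>(t, p). V t p) \<and> (\<forall>p. V 0 p = v0) \<and>
    (\<forall>t\<in>{0..T}. \<forall>p. ((\<lambda>s. V s p) has_vector_derivative A t p (V t p)) (at t within {0..T}))"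
proof -
  define L where "L = 2 * M + 1"
  have L: "L > 0" using M by (simp add: L_def)
  \<comment> \<open>Time is clamped to \<open>[0,T]\<close>, because the function space consists of functions on the whole line.\<close>
  define \<tau> where "\<tau> t = max 0 (min T t)" for t
  have \<tau>: "\<tau> t \<in> {0..T}" "t \<in> {0..T} \<Longrightarrow> \<tau> t = t" for t using T by (auto simp: \<tau>_def)
  have bound: "norm (A t p v) \<le> M * norm v" if "t \<in> {0..T}" for t p v
    using lip[OF that, of p v 0] zero[OF that] by simp
  define g where "g w p s = A s p (exp (L * s) *\<^sub>R apply_bcontfun w (s, p))" for w :: "(real \<times> 'p) \<Rightarrow>\<^sub>C 'e" and p s
  have gc: "continuous_on (UNIV \<times> {0..T}) (\<lambda>(p, s). g w p s)" for w
  proof -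
    have "continuous_on (UNIV \<times> {0..T}) (\<lambda>y. (\<lambda>(t, p, v). A t p v) (snd y, fst y, exp (L * snd y) *\<^sub>R apply_bcontfun w (snd y, fst y)))"
      by (rule continuous_on_compose2[OF cont])
         (auto intro!: continuous_intros continuous_on_compose2[OF continuous_on_apply_bcontfun[of UNIV w]])
    then show ?thesis by (simp add: g_def split_beta)
  qed
  have gc1: "continuous_on {0..t} (g w p)" if "t \<in> {0..T}" for w p t
    by (rule continuous_on_compose2[OF gc, of _ "\<lambda>s. (p, s)", simplified]) (use that in \<open>auto intro!: continuous_intros\<close>)
  have exp_int: "((\<lambda>s. exp (L * s)) has_integral (exp (L * t) - 1) / L) {0..t}" if "t \<in> {0..T}" for t
  proof -
    have "((\<lambda>s. exp (L * s)) has_integral (exp (L * t) / L - exp (L * 0) / L)) {0..t}"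
      using L that by (intro fundamental_theorem_of_calculus)
        (auto intro!: derivative_eq_intros simp flip: has_real_derivative_iff_has_vector_derivative)
    then show ?thesis by (simp add: diff_divide_distrib)
  qed
  have weight: "exp (- (L * t)) * (M * d * ((exp (L * t) - 1) / L)) \<le> d / 2" if "t \<in> {0..T}" "0 \<le> d" for t d
  proof -
    have "exp (- (L * t)) * (M * d * ((exp (L * t) - 1) / L)) = M / L * (d * (1 - exp (- (L * t))))"
      by (simp add: exp_minus field_simps)
    also have "\<dots> \<le> 1 / 2 * d"
    proof (intro mult_mono)
      show "M / L \<le> 1 / 2" using M by (simp add: L_def field_simps)
      show "d * (1 - exp (- (L * t))) \<le> d" "0 \<le> d * (1 - exp (- (L * t)))"
        using that L by (auto intro: mult_left_le)
    qed simp
    finally show ?thesis by simp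
  qed
  have int_bound: "exp (- (L * t)) * norm (integral {0..t} h) \<le> d / 2"
    if "t \<in> {0..T}" "0 \<le> d" "continuous_on {0..t} h" "\<And>s. s \<in> {0..t} \<Longrightarrow> norm (h s) \<le> M * d * exp (L * s)"
    for t d and h :: "real \<Rightarrow> 'e"
  proof -
    have i: "((\<lambda>s. M * d * exp (L * s)) has_integral (M * d * ((exp (L * t) - 1) / L))) {0..t}"
      by (intro has_integral_mult_right exp_int that)
    have "norm (integral {0..t} h) \<le> integral {0..t} (\<lambda>s. M * d * exp (L * s))"
      using i that by (intro integral_norm_bound_integral integrable_continuous_real) (auto intro!: continuous_intros)
    also have "\<dots> = M * d * ((exp (L * t) - 1) / L)" using i by (rule integral_unique)
    finally have "exp (- (L * t)) * norm (integral {0..t} h) \<le> exp (- (L * t)) * (M * d * ((exp (L * t) - 1) / L))"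
      by (intro mult_left_mono) auto
    then show ?thesis using weight[OF that(1,2)] by (rule order_trans)
  qed
  define F where "F w y = exp (- (L * \<tau> (fst y))) *\<^sub>R (v0 + integral {0..\<tau> (fst y)} (g w (snd y)))" for w y
  have Fb: "F w \<in> bcontfun" for w
  proof (rule bcontfun_normI)
    have "continuous_on UNIV (\<lambda>y. (\<lambda>(t, p). integral {0..t} (g w p)) (\<tau> (fst y), snd y))"
      by (rule continuous_on_compose2[OF continuous_indefinite_integral_with_parameter[OF gc]])
         (use \<tau> in \<open>auto intro!: continuous_intros simp: \<tau>_def\<close>)
    then show "continuous_on UNIV (F w)"
      unfolding F_def \<tau>_def by (auto intro!: continuous_intros)
    fix y :: "real \<times> 'p"
    have "norm (F w y) \<le> exp (- (L * \<tau> (fst y))) * norm v0 + exp (- (L * \<tau> (fst y))) * norm (integral {0..\<tau> (fst y)} (g w (snd y)))"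
      by (simp add: F_def flip: distrib_left) (rule norm_triangle_ineq)
    also have "\<dots> \<le> 1 * norm v0 + norm w / 2"
    proof (intro add_mono mult_right_mono int_bound \<tau>(1) gc1 norm_ge_zero)
      show "exp (- (L * \<tau> (fst y))) \<le> 1" using L \<tau>(1)[of "fst y"] by simp
      fix s assume "s \<in> {0..\<tau> (fst y)}"
      then have s: "s \<in> {0..T}" using \<tau>(1)[of "fst y"] by auto
      have "norm (g w (snd y) s) \<le> M * norm (exp (L * s) *\<^sub>R apply_bcontfun w (s, snd y))"
        unfolding g_def by (rule bound[OF s])
      also have "\<dots> \<le> M * (exp (L * s) * norm w)"
        using M norm_bounded[of w] by (intro mult_left_mono) auto
      finally show "norm (g w (snd y) s) \<le> M * norm w * exp (L * s)" by (simp add: mult_ac)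
    qed
    finally show "norm (F w y) \<le> norm v0 + norm w / 2" by simp
  qed
  define \<Phi> where "\<Phi> w = Bcontfun (F w)" for w
  have \<Phi>: "apply_bcontfun (\<Phi> w) = F w" for w
    unfolding \<Phi>_def by (rule Bcontfun_inverse[OF Fb])
  have "dist (\<Phi> w) (\<Phi> w') \<le> (1/2) * dist w w'" for w w'
  proof (rule dist_bound)
    fix y :: "real \<times> 'p"
    let ?t = "\<tau> (fst y)" and ?p = "snd y"
    have "F w y - F w' y = exp (- (L * ?t)) *\<^sub>R integral {0..?t} (\<lambda>s. g w ?p s - g w' ?p s)"
      unfolding F_def
      by (subst Henstock_Kurzweil_Integration.integral_diff)
         (auto intro!: integrable_continuous_real gc1 \<tau> simp: algebra_simps)
    then have "dist (F w y) (F w' y) = exp (- (L * ?t)) * norm (integral {0..?t} (\<lambda>s. g w ?p s - g w' ?p s))"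
      by (simp add: dist_norm)
    also have "\<dots> \<le> dist w w' / 2"
    proof (intro int_bound \<tau>(1) continuous_intros gc1 zero_le_dist)
      fix s assume "s \<in> {0..\<tau> (fst y)}"
      then have s: "s \<in> {0..T}" using \<tau>(1)[of "fst y"] by auto
      have "norm (g w ?p s - g w' ?p s) \<le> M * norm (exp (L * s) *\<^sub>R apply_bcontfun w (s, ?p) - exp (L * s) *\<^sub>R apply_bcontfun w' (s, ?p))"
        unfolding g_def by (rule lip[OF s])
      also have "\<dots> = M * (exp (L * s) * dist (apply_bcontfun w (s, ?p)) (apply_bcontfun w' (s, ?p)))"
        by (simp add: dist_norm flip: scaleR_diff_right)
      also have "\<dots> \<le> M * (exp (L * s) * dist w w')"
        using M dist_bounded by (intro mult_left_mono) auto
      finally show "norm (g w ?p s - g w' ?p s) \<le> M * dist w w' * exp (L * s)" by (simp add: mult_ac)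
    qed
    finally show "dist (apply_bcontfun (\<Phi> w) y) (apply_bcontfun (\<Phi> w') y) \<le> 1 / 2 * dist w w'"
      by (simp add: \<Phi>)
  qed
  then obtain w where w: "\<Phi> w = w"
    using banach_fix_type[of "1/2" \<Phi>] by auto
  define V where "V t p = exp (L * t) *\<^sub>R apply_bcontfun w (t, p)" for t p
  have V: "V t p = v0 + integral {0..t} (\<lambda>s. A s p (V s p))" if "t \<in> {0..T}" for t p
  proof -
    have "apply_bcontfun w (t, p) = F w (t, p)" by (metis \<Phi> w)
    also have "\<dots> = exp (- (L * t)) *\<^sub>R (v0 + integral {0..t} (\<lambda>s. A s p (V s p)))"
      using \<tau>(2)[OF that] by (simp add: F_def g_def[abs_def] V_def)
    finally show ?thesis unfolding V_def[of t] by (simp add: exp_minus)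
  qed
  show ?thesis
  proof (intro exI[of _ V] conjI allI ballI)
    show "continuous_on ({0..T} \<times> UNIV) (\<lambda>(t, p). V t p)"
      unfolding V_def split_beta
      by (intro continuous_intros continuous_on_compose2[OF continuous_on_apply_bcontfun[of UNIV w]]) auto
    show "V 0 p = v0" for p using V[of 0 p] T by simp
    fix t p assume t: "t \<in> {0..T}"
    have c: "continuous_on {0..T} (\<lambda>s. A s p (V s p))"
      using gc1[of T w p] T by (simp add: g_def[abs_def] V_def)
    have "((\<lambda>u. v0 + integral {0..u} (\<lambda>s. A s p (V s p))) has_vector_derivative A t p (V t p)) (at t within {0..T})"
      using has_vector_derivative_add[OF has_vector_derivative_const integral_has_vector_derivative[OF c t]] by simp
    then show "((\<lambda>s. V s p) has_vector_derivative A t p (V t p)) (at t within {0..T})"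
      by (rule has_vector_derivative_transform[OF t, rotated]) (rule V)
  qed
qed

text \<open>Gronwall's inequality in energy form: \<open>exp (- (2 M + 1) t) (|D|\<^sup>2 + \<kappa>\<^sup>2)\<close> is nonincreasing, because
\<open>2 |D| \<kappa> \<le> |D|\<^sup>2 + \<kappa>\<^sup>2\<close>. Working with the square avoids the points where the norm is not
differentiable.\<close>

lemma perturbed_growth_bound:
  fixes D :: "real \<Rightarrow> 'e::real_inner"
  assumes der: "\<And>t. t \<in> {0..T} \<Longrightarrow> (D has_vector_derivative D' t) (at t within {0..T})"
    and bd: "\<And>t. t \<in> {0..T} \<Longrightarrow> norm (D' t) \<le> M * norm (D t) + \<kappa>"
    and D0: "D 0 = 0" and \<kappa>: "0 \<le> \<kappa>" and M: "0 \<le> M" and t: "t \<in> {0..T}"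
  shows "norm (D t) \<le> \<kappa> * exp ((M + 1/2) * t)"
proof -
  define h where "h s = exp (- (2 * M + 1) * s) * (D s \<bullet> D s + \<kappa>\<^sup>2)" for s
  define h' where "h' s = exp (- (2 * M + 1) * s) * (2 * (D s \<bullet> D' s)) - (2 * M + 1) * exp (- (2 * M + 1) * s) * (D s \<bullet> D s + \<kappa>\<^sup>2)" for s
  have hd: "(h has_real_derivative h' s) (at s within {0..T})" if "s \<in> {0..T}" for s
  proof -
    have "((\<lambda>s. D s \<bullet> D s) has_real_derivative 2 * (D s \<bullet> D' s)) (at s within {0..T})"
    proof -
      have d: "(D has_derivative (\<lambda>h. h *\<^sub>R D' s)) (at s within {0..T})"
        using der[OF that] by (simp add: has_vector_derivative_def)
      have "(\<lambda>h. D s \<bullet> (h *\<^sub>R D' s) + (h *\<^sub>R D' s) \<bullet> D s) = (*) (2 * (D s \<bullet> D' s))"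
        by (auto simp: inner_commute)
      with has_derivative_inner[OF d d] show ?thesis
        unfolding has_field_derivative_def by (simp only:)
    qed
    then show ?thesis
      unfolding h_def h'_def by (auto intro!: derivative_eq_intros simp: algebra_simps)
  qed
  have neg: "h' s \<le> 0" if s: "s \<in> {0..T}" for s
  proof -
    have "2 * (D s \<bullet> D' s) \<le> 2 * (norm (D s) * norm (D' s))" using norm_cauchy_schwarz by simp
    also have "\<dots> \<le> 2 * (norm (D s) * (M * norm (D s) + \<kappa>))"
      using bd[OF s] by (intro mult_left_mono) auto
    also have "\<dots> = 2 * M * (norm (D s))\<^sup>2 + 2 * norm (D s) * \<kappa>" by (simp add: power2_eq_square algebra_simps)
    also have "\<dots> \<le> 2 * M * (norm (D s))\<^sup>2 + ((norm (D s))\<^sup>2 + \<kappa>\<^sup>2)"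
      using sum_squares_bound[of "norm (D s)" \<kappa>] by simp
    also have "\<dots> \<le> (2 * M + 1) * ((norm (D s))\<^sup>2 + \<kappa>\<^sup>2)"
      using M by (simp add: algebra_simps)
    finally have "2 * (D s \<bullet> D' s) \<le> (2 * M + 1) * (D s \<bullet> D s + \<kappa>\<^sup>2)" by (simp add: power2_norm_eq_inner)
    then have "exp (- (2 * M + 1) * s) * (2 * (D s \<bullet> D' s)) \<le> exp (- (2 * M + 1) * s) * ((2 * M + 1) * (D s \<bullet> D s + \<kappa>\<^sup>2))"
      by (intro mult_left_mono) auto
    then show ?thesis by (simp add: h'_def mult_ac)
  qed
  have "h t \<le> h 0"
  proof (cases "t = 0")
    case False
    with t have "0 \<le> t" by simp
    then show ?thesis
    proof (rule DERIV_nonpos_imp_decreasing_open)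
      fix s assume s: "0 < s" "s < t"
      then have "at s within {0..T} = at s" using t by (intro at_within_interior) (auto simp: interior_atLeastAtMost_real)
      then show "\<exists>y. DERIV h s :> y \<and> y \<le> 0" using hd[of s] neg[of s] s t by auto
    next
      have "continuous_on {0..T} h" using hd by (rule DERIV_continuous_on)
      then show "continuous_on {0..t} h" by (rule continuous_on_subset) (use t in auto)
    qed
  qed simp
  then have "exp (- (2 * M + 1) * t) * ((norm (D t))\<^sup>2 + \<kappa>\<^sup>2) \<le> \<kappa>\<^sup>2"
    using D0 by (simp add: h_def power2_norm_eq_inner)
  then have "(norm (D t))\<^sup>2 + \<kappa>\<^sup>2 \<le> \<kappa>\<^sup>2 * exp ((2 * M + 1) * t)"
  proof -
    define e where "e = exp ((2 * M + 1) * t)"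
    assume "exp (- (2 * M + 1) * t) * ((norm (D t))\<^sup>2 + \<kappa>\<^sup>2) \<le> \<kappa>\<^sup>2"
    moreover have "exp (- (2 * M + 1) * t) = inverse e" unfolding e_def exp_minus[symmetric] by (simp add: algebra_simps)
    ultimately have "inverse e * ((norm (D t))\<^sup>2 + \<kappa>\<^sup>2) \<le> \<kappa>\<^sup>2" by (simp only:)
    moreover have "e > 0" by (simp add: e_def)
    ultimately show ?thesis unfolding e_def[symmetric] by (simp add: field_simps)
  qed
  then have "(norm (D t))\<^sup>2 \<le> \<kappa>\<^sup>2 * exp ((2 * M + 1) * t)"
    using zero_le_power2[of \<kappa>] by linarith
  also have "\<dots> = (\<kappa> * exp ((M + 1/2) * t))\<^sup>2"
  proof -
    have "exp ((2 * M + 1) * t) = (exp ((M + 1/2) * t))\<^sup>2"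
      by (subst exp_double[symmetric]) (simp add: algebra_simps)
    then show ?thesis by (simp only: power_mult_distrib)
  qed
  finally show ?thesis by (rule power2_le_imp_le) (use \<kappa> in simp)
qed

section \<open>Plane-wave modes of the linearized system\<close>

text \<open>The wave vector, at time \<open>t\<close>, of the plane wave that is transported by the shear and has the wave
vector \<open>\<xi>\<close> at time 0. The inverse map is \<open>wavevec (- t)\<close>.\<close>

definition wavevec :: "real \<Rightarrow> real^3 \<Rightarrow> real^3" where
  "wavevec t \<xi> = vector [\<xi> $ 1, \<xi> $ 2 - t * \<xi> $ 1, \<xi> $ 3]"

lemma wavevec_nth [simp]:
  "wavevec t \<xi> $ 1 = \<xi> $ 1" "wavevec t \<xi> $ 2 = \<xi> $ 2 - t * \<xi> $ 1" "wavevec t \<xi> $ 3 = \<xi> $ 3"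
  by (simp_all add: wavevec_def)

text \<open>If the velocity amplitude at the frequency \<open>\<eta>\<close> is \<open>v\<close>, then the pressure has the amplitude
\<open>\<i> press f \<eta> v\<close>: inverting \<open>- \<Delta>\<close> is division by \<open>|\<eta>|\<^sup>2\<close>, and one factor \<open>\<i>\<close> comes from the first
derivatives of the velocity.\<close>

definition press :: "real \<Rightarrow> real^3 \<Rightarrow> real^3 \<Rightarrow> real" where
  "press f \<eta> v = ((2 - f) * \<eta> $ 1 * v $ 2 + f * \<eta> $ 2 * v $ 1) / (\<eta> \<bullet> \<eta>)"

text \<open>The time derivative of a velocity amplitude in the moving frame. The transport term \<open>y \<partial>\<^sub>x\<close> is
absent because it is accounted for by the motion of the wave vector; the four terms are the
advection of the background shear, the Coriolis force, the viscosity, and the pressure gradient,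
in which \<open>\<i>\<^sup>2 = -1\<close> changes the sign.\<close>

definition mode_rate :: "real \<Rightarrow> real \<Rightarrow> real^3 \<Rightarrow> real^3 \<Rightarrow> real^3" where
  "mode_rate f \<nu> \<eta> v = - vector [v $ 2, 0, 0] - f *\<^sub>R vector [- (v $ 2), v $ 1, 0]
     - (\<nu> * (\<eta> \<bullet> \<eta>)) *\<^sub>R v + press f \<eta> v *\<^sub>R \<eta>"

lemma inner_3: "x \<bullet> y = x $ 1 * y $ 1 + x $ 2 * y $ 2 + x $ 3 * (y :: real^3) $ 3"
  by (simp add: inner_vec_def sum_3)

lemma mode_rate_nth:
  "mode_rate f \<nu> \<eta> v $ 1 = - ((1 - f) * v $ 2) - \<nu> * (\<eta> \<bullet> \<eta>) * v $ 1 + press f \<eta> v * \<eta> $ 1"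
  "mode_rate f \<nu> \<eta> v $ 2 = - (f * v $ 1) - \<nu> * (\<eta> \<bullet> \<eta>) * v $ 2 + press f \<eta> v * \<eta> $ 2"
  "mode_rate f \<nu> \<eta> v $ 3 = - \<nu> * (\<eta> \<bullet> \<eta>) * v $ 3 + press f \<eta> v * \<eta> $ 3"
  by (simp_all add: mode_rate_def algebra_simps)

lemma continuous_on_vec_nth [continuous_intros]:
  "continuous_on S g \<Longrightarrow> continuous_on S (\<lambda>x. g x $ (j :: 'n::finite))"
  by (rule continuous_on_component)

lemma continuous_on_vector3 [continuous_intros]:
  fixes a b c :: "'a::topological_space \<Rightarrow> real"
  assumes "continuous_on S a" "continuous_on S b" "continuous_on S c"
  shows "continuous_on S (\<lambda>x. vector [a x, b x, c x] :: real^3)"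
proof -
  have "(vector [a x, b x, c x] :: real^3) = (\<chi> i. if i = 1 then a x else if i = 2 then b x else c x)" for x
    by (simp add: vec_eq_iff forall_3)
  moreover have "continuous_on S (\<lambda>x. if i = 1 then a x else if i = 2 then b x else c x)" for i :: 3
    using assms by (cases "i = 1"; cases "i = 2") simp_all
  ultimately show ?thesis by (simp only: continuous_on_vec_lambda)
qed

lemma continuous_wavevec [continuous_intros]:
  assumes "continuous_on S g" "continuous_on S h"
  shows "continuous_on S (\<lambda>x. wavevec (g x) (h x))"
  unfolding wavevec_def by (intro continuous_intros assms)

lemma press_minus: "press f (- \<eta>) v = - press f \<eta> v"
proof -
  have "(2 - f) * (- \<eta> $ 1) * v $ 2 + f * (- \<eta> $ 2) * v $ 1 = - ((2 - f) * \<eta> $ 1 * v $ 2 + f * \<eta> $ 2 * v $ 1)"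
    by (simp add: algebra_simps)
  then show ?thesis by (simp only: press_def vector_uminus_component inner_minus_left inner_minus_right minus_minus minus_divide_left)
qed

lemma press_0 [simp]: "press f \<eta> 0 = 0"
  by (simp add: press_def)

lemma mode_rate_0 [simp]: "mode_rate f \<nu> \<eta> 0 = 0"
  by (simp add: vec_eq_iff forall_3 mode_rate_nth)

text \<open>The first two components of \<open>mode_rate\<close> form a closed system. The third component can be recovered
from incompressibility, so only the planar system has to be solved.\<close>

definition plane_rate :: "real \<Rightarrow> real \<Rightarrow> real^3 \<Rightarrow> real \<times> real \<Rightarrow> real \<times> real" where
  "plane_rate f \<nu> \<eta> v =
    (let p = ((2 - f) * \<eta> $ 1 * snd v + f * \<eta> $ 2 * fst v) / (\<eta> \<bullet> \<eta>) in
     (- ((1 - f) * snd v) - \<nu> * (\<eta> \<bullet> \<eta>) * fst v + p * \<eta> $ 1,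
      - (f * fst v) - \<nu> * (\<eta> \<bullet> \<eta>) * snd v + p * \<eta> $ 2))"

lemma plane_rate_linear:
  "plane_rate f \<nu> \<eta> (v - w) = plane_rate f \<nu> \<eta> v - plane_rate f \<nu> \<eta> w"
  by (simp add: plane_rate_def Let_def algebra_simps diff_divide_distrib add_divide_distrib)

text \<open>On the box used below the first two components of \<open>\<eta>\<close> are smaller than the third one by the factor
\<open>\<theta>\<close>, and \<open>|\<eta>|\<^sup>2 \<le> \<theta>\<close> as well. Every coefficient by which the planar system differs from its limit
is a combination of \<open>\<nu> |\<eta>|\<^sup>2\<close> and of \<open>\<eta>\<^sub>i \<eta>\<^sub>j / |\<eta>|\<^sup>2\<close> with \<open>i, j \<le> 2\<close>, hence of size \<open>\<theta>\<close>.\<close>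

lemma plane_rate_near_limit:
  fixes a b :: real
  assumes f: "0 < f" "f < 1" and \<nu>: "\<nu> > 0" and \<theta>: "0 < \<theta>" "\<theta> \<le> 1" and r: "r = \<theta> / 3"
    and \<eta>: "\<bar>\<eta> $ 1\<bar> \<le> r * \<theta>" "\<bar>\<eta> $ 2\<bar> \<le> r * \<theta>" "r \<le> \<eta> $ 3" "\<eta> $ 3 \<le> 2 * r"
  shows "\<eta> \<bullet> \<eta> \<le> \<theta>"
    and "norm (plane_rate f \<nu> \<eta> (a, b) - (- ((1 - f) * b), - (f * a))) \<le> 4 * (\<nu> + 2) * \<theta> * norm (a, b)"
proof -
  have r0: "r > 0" using \<theta> r by simp
  have sq: "x\<^sup>2 \<le> r\<^sup>2" if "\<bar>x\<bar> \<le> r * \<theta>" for x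
  proof -
    have "r * \<theta> \<le> r" using r0 \<theta> by simp
    with that have "\<bar>x\<bar> \<le> \<bar>r\<bar>" using r0 by linarith
    then show ?thesis by (simp add: abs_le_square_iff)
  qed
  have z: "(\<eta> $ 3)\<^sup>2 \<le> (2 * r)\<^sup>2" "r\<^sup>2 \<le> (\<eta> $ 3)\<^sup>2" using \<eta> r0 by (intro power_mono; simp)+
  have e: "\<eta> \<bullet> \<eta> = (\<eta> $ 1)\<^sup>2 + (\<eta> $ 2)\<^sup>2 + (\<eta> $ 3)\<^sup>2" by (simp add: inner_3 power2_eq_square)
  have "\<eta> \<bullet> \<eta> \<le> 6 * r\<^sup>2" using sq[OF \<eta>(1)] sq[OF \<eta>(2)] z by (simp add: e power_mult_distrib)
  also have "\<dots> \<le> \<theta>\<^sup>2" by (simp add: r power_divide)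
  also have "\<dots> \<le> \<theta>" using \<theta> by (simp add: power2_eq_square mult_left_le)
  finally show le: "\<eta> \<bullet> \<eta> \<le> \<theta>" .
  have ge: "r\<^sup>2 \<le> \<eta> \<bullet> \<eta>" using z by (simp add: e add_increasing)
  define p where "p = ((2 - f) * \<eta> $ 1 * b + f * \<eta> $ 2 * a) / (\<eta> \<bullet> \<eta>)"
  let ?m = "\<bar>a\<bar> + \<bar>b\<bar>"
  have m: "?m \<ge> 0" by simp
  have "\<bar>(2 - f) * \<eta> $ 1 * b + f * \<eta> $ 2 * a\<bar> \<le> 2 * (r * \<theta>) * \<bar>b\<bar> + 2 * (r * \<theta>) * \<bar>a\<bar>"
  proof (rule order_trans[OF abs_triangle_ineq], intro add_mono)
    show "\<bar>(2 - f) * \<eta> $ 1 * b\<bar> \<le> 2 * (r * \<theta>) * \<bar>b\<bar>" "\<bar>f * \<eta> $ 2 * a\<bar> \<le> 2 * (r * \<theta>) * \<bar>a\<bar>"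
      unfolding abs_mult using f \<eta> by (intro mult_mono; simp)+
  qed
  also have "\<dots> = 2 * (r * \<theta>) * ?m" by (simp add: algebra_simps)
  finally have num: "\<bar>(2 - f) * \<eta> $ 1 * b + f * \<eta> $ 2 * a\<bar> \<le> 2 * (r * \<theta>) * ?m" .
  have p: "\<bar>p\<bar> \<le> (2 * (r * \<theta>) * ?m) / r\<^sup>2"
    unfolding p_def abs_divide using num ge r0 \<theta> m by (intro frac_le) auto
  have pe: "\<bar>p * x\<bar> \<le> 2 * \<theta> * ?m" if "\<bar>x\<bar> \<le> r * \<theta>" for x
  proof -
    have "\<bar>p * x\<bar> \<le> (2 * (r * \<theta>) * ?m) / r\<^sup>2 * (r * \<theta>)"
      unfolding abs_mult using r0 \<theta> m by (intro mult_mono[OF p that] divide_nonneg_nonneg mult_nonneg_nonneg) simp_all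
    also have "\<dots> = 2 * \<theta>\<^sup>2 * ?m" using r0 by (simp add: power2_eq_square)
    also have "\<dots> \<le> 2 * \<theta> * ?m"
      using \<theta> m by (intro mult_right_mono mult_left_mono) (auto simp: power2_eq_square mult_left_le)
    finally show ?thesis .
  qed
  have visc: "\<bar>\<nu> * (\<eta> \<bullet> \<eta>) * x\<bar> \<le> \<nu> * \<theta> * ?m" if "\<bar>x\<bar> \<le> ?m" for x
  proof -
    have "\<bar>\<nu> * (\<eta> \<bullet> \<eta>)\<bar> \<le> \<nu> * \<theta>" using \<nu> le by (simp add: abs_mult)
    from mult_mono[OF this that] show ?thesis using \<nu> \<theta> by (simp add: abs_mult)
  qed
  have "plane_rate f \<nu> \<eta> (a, b) - (- ((1 - f) * b), - (f * a)) = (p * \<eta> $ 1 - \<nu> * (\<eta> \<bullet> \<eta>) * a, p * \<eta> $ 2 - \<nu> * (\<eta> \<bullet> \<eta>) * b)"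
    by (simp add: plane_rate_def p_def)
  also have "norm \<dots> \<le> \<bar>p * \<eta> $ 1 - \<nu> * (\<eta> \<bullet> \<eta>) * a\<bar> + \<bar>p * \<eta> $ 2 - \<nu> * (\<eta> \<bullet> \<eta>) * b\<bar>"
    by (simp add: norm_Pair sqrt_sum_squares_le_sum_abs)
  also have "\<dots> \<le> (2 * \<theta> * ?m + \<nu> * \<theta> * ?m) + (2 * \<theta> * ?m + \<nu> * \<theta> * ?m)"
    by (intro add_mono order_trans[OF abs_triangle_ineq4] pe visc \<eta>) auto
  also have "\<dots> = 2 * (\<nu> + 2) * \<theta> * ?m" by (simp add: algebra_simps)
  also have "\<dots> \<le> 2 * (\<nu> + 2) * \<theta> * (2 * norm (a, b))"
  proof (intro mult_left_mono)
    show "?m \<le> 2 * norm (a, b)" using norm_fst_le[of a b] norm_snd_le[of b a] by simp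
  qed (use \<nu> \<theta> in auto)
  also have "\<dots> = 4 * (\<nu> + 2) * \<theta> * norm (a, b)" by (simp add: algebra_simps)
  finally show "norm (plane_rate f \<nu> \<eta> (a, b) - (- ((1 - f) * b), - (f * a))) \<le> 4 * (\<nu> + 2) * \<theta> * norm (a, b)" .
qed

text \<open>The vector \<open>(\<surd>(1 - f), - \<surd>f)\<close> is the unit eigenvector of the limit system with eigenvalue \<open>\<Lambda>\<close>. The
difference between the true mode and the exact exponential solves a perturbed equation with zero
initial value and a forcing of size \<open>\<theta>\<close>, and the constants multiplying \<open>\<theta>\<close> depend on \<open>f\<close>, \<open>\<nu>\<close>
and \<open>T\<close> only.\<close>

lemma plane_mode_exists:
  fixes f \<nu> T \<epsilon> :: real
  assumes f: "0 < f" "f < 1" and \<nu>: "\<nu> > 0" and T: "T > 0" and \<epsilon>: "\<epsilon> > 0"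
  defines "\<Lambda> \<equiv> sqrt (f * (1 - f))"
  shows "\<exists>lo hi W \<theta>. 0 < \<theta> \<and> \<theta> \<le> 1 \<and> (\<forall>j. lo $ j < hi $ j) \<and> 0 < lo $ 3 \<and>
    (\<forall>t\<in>{0..T}. \<forall>\<xi>\<in>cbox lo hi. norm (wavevec t \<xi>) \<le> 1 \<and>
       \<bar>wavevec t \<xi> $ 1\<bar> \<le> \<theta> * \<xi> $ 3 \<and> \<bar>wavevec t \<xi> $ 2\<bar> \<le> \<theta> * \<xi> $ 3) \<and>
    continuous_on ({0..T} \<times> UNIV) (\<lambda>(t, \<xi>). W t \<xi>) \<and>
    (\<forall>\<xi>. W 0 \<xi> = (sqrt (1 - f), - sqrt f)) \<and>
    (\<forall>t\<in>{0..T}. \<forall>\<xi>\<in>cbox lo hi.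
       ((\<lambda>s. W s \<xi>) has_vector_derivative plane_rate f \<nu> (wavevec t \<xi>) (W t \<xi>)) (at t within {0..T}) \<and>
       norm (W t \<xi> - exp (\<Lambda> * t) *\<^sub>R (sqrt (1 - f), - sqrt f)) \<le> \<epsilon> \<and> \<theta> * (2 * norm (W t \<xi>)) \<le> \<epsilon>)"
proof -
  define M where "M = 2 + 4 * (\<nu> + 2)"
  have M: "M \<ge> 0" using \<nu> by (simp add: M_def)
  have \<Lambda>: "\<Lambda> \<ge> 0" using f by (simp add: \<Lambda>_def)
  define E where "E = 4 * (\<nu> + 2) * exp (\<Lambda> * T) * exp ((M + 1/2) * T)"
  have E: "E > 0" using \<nu> by (simp add: E_def)
  define K where "K = E + 2 * (exp (\<Lambda> * T) + E)"
  have K: "K > 0" using E by (simp add: K_def add_pos_pos)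
  \<comment> \<open>\<open>\<theta> E\<close> bounds the error in the plane and \<open>\<theta> K\<close> in addition the third component.\<close>
  define \<theta> where "\<theta> = min 1 (\<epsilon> / K)"
  have \<theta>: "0 < \<theta>" "\<theta> \<le> 1" "\<theta> * K \<le> \<epsilon>"
    using \<epsilon> K by (auto simp: \<theta>_def min_def field_simps)
  \<comment> \<open>The box reaches from \<open>r\<close> to \<open>2 r\<close> along the third axis and has the half width \<open>\<delta>\<close> in the other
    directions; the factor \<open>1 + T\<close> leaves room for the drift \<open>t \<xi>\<^sub>1\<close> of the second component.\<close>
  define r where "r = \<theta> / 3"
  define \<delta> where "\<delta> = r * \<theta> / (1 + T)"
  have r: "r > 0" using \<theta> by (simp add: r_def)
  have \<delta>: "\<delta> > 0" "\<delta> * (1 + T) = r * \<theta>" using r \<theta> T by (simp_all add: \<delta>_def)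
  define lo :: "real^3" where "lo = vector [- \<delta>, - \<delta>, r]"
  define hi :: "real^3" where "hi = vector [\<delta>, \<delta>, 2 * r]"
  have lohi: "\<forall>j. lo $ j < hi $ j" using \<delta> r by (simp add: forall_3 lo_def hi_def)
  have \<delta>le: "\<delta> \<le> r * \<theta>" using \<delta>(2) mult_pos_pos[OF \<delta>(1) T] unfolding distrib_left by linarith
  have box: "\<bar>wavevec t \<xi> $ 1\<bar> \<le> r * \<theta>" "\<bar>wavevec t \<xi> $ 2\<bar> \<le> r * \<theta>" "r \<le> wavevec t \<xi> $ 3" "wavevec t \<xi> $ 3 \<le> 2 * r"
    if t: "t \<in> {0..T}" and \<xi>: "\<xi> \<in> cbox lo hi" for t \<xi>
  proof -
    have b: "\<bar>\<xi> $ 1\<bar> \<le> \<delta>" "\<bar>\<xi> $ 2\<bar> \<le> \<delta>" "r \<le> \<xi> $ 3" "\<xi> $ 3 \<le> 2 * r"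
      using \<xi> unfolding mem_box_cart forall_3 by (simp_all add: lo_def hi_def abs_le_iff)
    have "\<bar>t * \<xi> $ 1\<bar> \<le> T * \<delta>" unfolding abs_mult using t b T by (intro mult_mono) auto
    then have "\<bar>\<xi> $ 2 - t * \<xi> $ 1\<bar> \<le> \<delta> * (1 + T)" using b by (simp add: algebra_simps abs_le_iff)
    then show "\<bar>wavevec t \<xi> $ 1\<bar> \<le> r * \<theta>" "\<bar>wavevec t \<xi> $ 2\<bar> \<le> r * \<theta>" "r \<le> wavevec t \<xi> $ 3" "wavevec t \<xi> $ 3 \<le> 2 * r"
      using b \<delta> \<delta>le by simp_all
  qed
  note near = plane_rate_near_limit[OF f \<nu> \<theta>(1,2) r_def box]
  have prate: "norm (plane_rate f \<nu> (wavevec t \<xi>) v) \<le> M * norm v" if "t \<in> {0..T}" "\<xi> \<in> cbox lo hi" for t \<xi> v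
  proof -
    obtain a b where v: "v = (a, b)" by (cases v)
    have "norm (- ((1 - f) * b), - (f * a)) \<le> \<bar>(1 - f) * b\<bar> + \<bar>f * a\<bar>"
      using sqrt_sum_squares_le_sum_abs[of "- ((1 - f) * b)" "- (f * a)"] by (simp add: norm_Pair)
    also have "\<dots> \<le> 1 * \<bar>b\<bar> + 1 * \<bar>a\<bar>"
      unfolding abs_mult using f by (intro add_mono mult_right_mono) auto
    also have "\<dots> \<le> 2 * norm v" using norm_fst_le[of a b] norm_snd_le[of b a] by (simp add: v)
    finally have 1: "norm (- ((1 - f) * b), - (f * a)) \<le> 2 * norm v" .
    have "4 * (\<nu> + 2) * \<theta> * norm v \<le> 4 * (\<nu> + 2) * 1 * norm v"
      using \<theta> \<nu> by (intro mult_right_mono mult_left_mono) auto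
    with near(2)[OF that that that that, of a b] have 2: "norm (plane_rate f \<nu> (wavevec t \<xi>) v - (- ((1 - f) * b), - (f * a))) \<le> 4 * (\<nu> + 2) * norm v"
      by (simp add: v)
    have "norm (plane_rate f \<nu> (wavevec t \<xi>) v)
        \<le> norm (plane_rate f \<nu> (wavevec t \<xi>) v - (- ((1 - f) * b), - (f * a))) + norm (- ((1 - f) * b), - (f * a))"
      using norm_triangle_ineq[of "plane_rate f \<nu> (wavevec t \<xi>) v - (- ((1 - f) * b), - (f * a))" "(- ((1 - f) * b), - (f * a))"]
      by (simp only: diff_add_cancel)
    also have "\<dots> \<le> M * norm v" using 1 2 by (simp add: M_def distrib_right)
    finally show ?thesis .
  qed
  \<comment> \<open>Clamping \<open>\<xi>\<close> to the box extends the coefficients to all parameters without enlarging their bounds.\<close>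
  define A where "A t \<xi> v = plane_rate f \<nu> (wavevec t (Topology_Euclidean_Space.clamp lo hi \<xi>)) v" for t \<xi> v
  have cl: "Topology_Euclidean_Space.clamp lo hi \<xi> \<in> cbox lo hi" for \<xi>
    using lohi by (intro clamp_in_interval) (auto simp: Basis_vec_def inner_axis less_imp_le)
  have lim: "plane_rate f \<nu> \<eta> 0 = 0" for \<eta> by (simp add: plane_rate_def zero_prod_def)
  have clc: "continuous_on UNIV (Topology_Euclidean_Space.clamp lo hi)"
    by (rule clamp_continuous_on[where f = "\<lambda>x. x"]) (rule continuous_on_id)
  have nz: "wavevec t \<xi> \<bullet> wavevec t \<xi> \<noteq> 0" if "t \<in> {0..T}" "\<xi> \<in> cbox lo hi" for t \<xi>
    using box(3)[OF that] r by (auto simp: vec_eq_iff forall_3)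
  have "\<exists>V. continuous_on ({0..T} \<times> UNIV) (\<lambda>(t, p). V t p) \<and> (\<forall>p. V 0 p = (sqrt (1 - f), - sqrt f)) \<and>
    (\<forall>t\<in>{0..T}. \<forall>p. ((\<lambda>s. V s p) has_vector_derivative A t p (V t p)) (at t within {0..T}))"
  proof (rule lipschitz_ode_with_parameter)
    show "continuous_on ({0..T} \<times> UNIV \<times> UNIV) (\<lambda>(t, p, v). A t p v)"
      unfolding A_def plane_rate_def Let_def split_beta
      by (intro continuous_intros continuous_on_compose2[OF clc]) (auto simp: nz cl simp del: inner_eq_zero_iff)
    show "norm (A t p v - A t p w) \<le> M * norm (v - w)" if "t \<in> {0..T}" for t p v w
      unfolding A_def plane_rate_linear[symmetric] by (rule prate[OF that cl])
  qed (use T M lim in \<open>auto simp: A_def\<close>)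
  then obtain W where W: "continuous_on ({0..T} \<times> UNIV) (\<lambda>(t, p). W t p)" "\<And>p. W 0 p = (sqrt (1 - f), - sqrt f)"
    "\<And>t p. t \<in> {0..T} \<Longrightarrow> ((\<lambda>s. W s p) has_vector_derivative A t p (W t p)) (at t within {0..T})" by blast
  define v :: "real \<times> real" where "v = (sqrt (1 - f), - sqrt f)"
  have nv: "norm v = 1" using f by (simp add: v_def norm_Pair)
  have eig: "(- ((1 - f) * snd v), - (f * fst v)) = \<Lambda> *\<^sub>R v"
  proof -
    have "(1 - f) * sqrt f = sqrt (f * (1 - f)) * sqrt (1 - f)" "f * sqrt (1 - f) = sqrt (f * (1 - f)) * sqrt f"
      using f by (simp_all add: real_sqrt_mult mult.commute mult.left_commute)
    then show ?thesis by (simp add: v_def \<Lambda>_def)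
  qed
  have est: "norm (W t \<xi> - exp (\<Lambda> * t) *\<^sub>R v) \<le> \<theta> * E" if t: "t \<in> {0..T}" and \<xi>: "\<xi> \<in> cbox lo hi" for t \<xi>
  proof -
    define D where "D s = W s \<xi> - exp (\<Lambda> * s) *\<^sub>R v" for s
    define D' where "D' s = A s \<xi> (W s \<xi>) - (\<Lambda> * exp (\<Lambda> * s)) *\<^sub>R v" for s
    have "norm (D t) \<le> (4 * (\<nu> + 2) * \<theta> * exp (\<Lambda> * T)) * exp ((M + 1/2) * t)"
    proof (rule perturbed_growth_bound[where T = T and D' = D'])
      fix s assume s: "s \<in> {0..T}"
      have "((\<lambda>s. exp (\<Lambda> * s)) has_real_derivative \<Lambda> * exp (\<Lambda> * s)) (at s within {0..T})"
        by (auto intro!: derivative_eq_intros)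
      from has_vector_derivative_scaleR[OF this has_vector_derivative_const]
      have ex: "((\<lambda>s. exp (\<Lambda> * s) *\<^sub>R v) has_vector_derivative (\<Lambda> * exp (\<Lambda> * s)) *\<^sub>R v) (at s within {0..T})"
        by simp
      show "(D has_vector_derivative D' s) (at s within {0..T})"
        unfolding D_def D'_def by (intro has_vector_derivative_diff W(3)[OF s] ex)
      let ?w = "exp (\<Lambda> * s) *\<^sub>R v"
      have "D' s = plane_rate f \<nu> (wavevec s \<xi>) (D s) + (plane_rate f \<nu> (wavevec s \<xi>) ?w - (- ((1 - f) * snd ?w), - (f * fst ?w)))"
      proof -
        have "(- ((1 - f) * snd ?w), - (f * fst ?w)) = exp (\<Lambda> * s) *\<^sub>R (- ((1 - f) * snd v), - (f * fst v))"
          by (simp add: mult_ac)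
        also have "\<dots> = (\<Lambda> * exp (\<Lambda> * s)) *\<^sub>R v" unfolding eig by (simp add: mult.commute)
        finally show ?thesis
          using \<xi> by (simp add: D'_def D_def A_def plane_rate_linear)
      qed
      also have "norm \<dots> \<le> M * norm (D s) + 4 * (\<nu> + 2) * \<theta> * norm ?w"
      proof (intro order_trans[OF norm_triangle_ineq] add_mono prate s \<xi>)
        show "norm (plane_rate f \<nu> (wavevec s \<xi>) ?w - (- ((1 - f) * snd ?w), - (f * fst ?w))) \<le> 4 * (\<nu> + 2) * \<theta> * norm ?w"
          using near(2)[OF s \<xi> s \<xi> s \<xi> s \<xi>, of "fst ?w" "snd ?w"] by (simp only: prod.collapse)
      qed
      also have "\<dots> \<le> M * norm (D s) + 4 * (\<nu> + 2) * \<theta> * exp (\<Lambda> * T)"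
        unfolding norm_scaleR nv using s \<nu> \<theta> \<Lambda> by (intro add_left_mono mult_left_mono) (auto intro: mult_left_mono)
      finally show "norm (D' s) \<le> M * norm (D s) + 4 * (\<nu> + 2) * \<theta> * exp (\<Lambda> * T)" .
    qed (use \<nu> \<theta> M t in \<open>auto simp: D_def W(2) v_def\<close>)
    also have "\<dots> \<le> (4 * (\<nu> + 2) * \<theta> * exp (\<Lambda> * T)) * exp ((M + 1/2) * T)"
      using \<nu> \<theta> M t by (intro mult_left_mono) (auto intro: mult_left_mono)
    finally show ?thesis by (simp add: D_def E_def mult_ac)
  qed
  have "norm (W t \<xi> - exp (\<Lambda> * t) *\<^sub>R v) \<le> \<epsilon> \<and> \<theta> * (2 * norm (W t \<xi>)) \<le> \<epsilon>" if t: "t \<in> {0..T}" and \<xi>: "\<xi> \<in> cbox lo hi" for t \<xi>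
  proof -
    have "\<theta> * E \<le> \<theta> * K" using \<theta> E by (intro mult_left_mono) (auto simp: K_def)
    then have 1: "norm (W t \<xi> - exp (\<Lambda> * t) *\<^sub>R v) \<le> \<epsilon>" using est[OF t \<xi>] \<theta> by linarith
    have "norm (W t \<xi>) \<le> norm (W t \<xi> - exp (\<Lambda> * t) *\<^sub>R v) + norm (exp (\<Lambda> * t) *\<^sub>R v)"
      by (metis diff_add_cancel norm_triangle_ineq)
    also have "\<dots> \<le> E + exp (\<Lambda> * T)"
    proof (intro add_mono)
      have "\<theta> * E \<le> E" using \<theta> E by simp
      then show "norm (W t \<xi> - exp (\<Lambda> * t) *\<^sub>R v) \<le> E" using est[OF t \<xi>] by linarith
      show "norm (exp (\<Lambda> * t) *\<^sub>R v) \<le> exp (\<Lambda> * T)"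
        unfolding norm_scaleR nv using t \<Lambda> by (auto intro: mult_left_mono)
    qed
    finally have "2 * norm (W t \<xi>) \<le> K" using E by (simp add: K_def)
    then have "\<theta> * (2 * norm (W t \<xi>)) \<le> \<theta> * K" using \<theta> by (intro mult_left_mono) auto
    with 1 \<theta> show ?thesis by linarith
  qed
  moreover have "((\<lambda>s. W s \<xi>) has_vector_derivative plane_rate f \<nu> (wavevec t \<xi>) (W t \<xi>)) (at t within {0..T})"
    if "t \<in> {0..T}" "\<xi> \<in> cbox lo hi" for t \<xi>
    using W(3)[OF that(1), of \<xi>] that(2) by (simp add: A_def)
  moreover have "norm (wavevec t \<xi>) \<le> 1 \<and> \<bar>wavevec t \<xi> $ 1\<bar> \<le> \<theta> * \<xi> $ 3 \<and> \<bar>wavevec t \<xi> $ 2\<bar> \<le> \<theta> * \<xi> $ 3"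
    if t: "t \<in> {0..T}" and \<xi>: "\<xi> \<in> cbox lo hi" for t \<xi>
  proof -
    have "(norm (wavevec t \<xi>))\<^sup>2 \<le> 1\<^sup>2" using near(1)[OF t \<xi> t \<xi> t \<xi> t \<xi>] \<theta> by (simp add: power2_norm_eq_inner)
    then have "norm (wavevec t \<xi>) \<le> 1" by (rule power2_le_imp_le) simp
    moreover have "r * \<theta> \<le> \<theta> * \<xi> $ 3" using box(3)[OF t \<xi>] \<theta> by (simp add: mult.commute mult_left_mono)
    ultimately show ?thesis using box(1,2)[OF t \<xi>] by linarith
  qed
  moreover have "0 < lo $ 3" using r by (simp add: lo_def)
  ultimately show ?thesis
    using \<theta> lohi W(1,2) unfolding v_def by (intro exI[of _ lo] exI[of _ hi] exI[of _ W] exI[of _ \<theta>]) blast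
qed

section \<open>The growing mode and the moving frame\<close>

lemma vec_has_vector_derivative:
  fixes g :: "real \<Rightarrow> real^'n"
  assumes "\<And>j. ((\<lambda>s. g s $ j) has_vector_derivative D $ j) (at t within S)"
  shows "(g has_vector_derivative D) (at t within S)"
  using assms unfolding has_vector_derivative_def
  by (subst has_derivative_componentwise_within) (auto simp: Basis_vec_def inner_axis)

text \<open>The third component is defined by incompressibility, \<open>\<eta> \<bullet> V = 0\<close>. That it satisfies the third
equation is then forced: the pressure is chosen precisely so that the rate of change of \<open>\<eta> \<bullet> V\<close>
vanishes, the term \<open>\<eta>\<^sub>1 V\<^sub>2\<close> from the motion of the wave vector included.\<close>

lemma growing_mode_exists:
  fixes f \<nu> T \<epsilon> :: real
  assumes f: "0 < f" "f < 1" and \<nu>: "\<nu> > 0" and T: "T > 0" and \<epsilon>: "\<epsilon> > 0"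
  defines "\<Lambda> \<equiv> sqrt (f * (1 - f))"
  shows "\<exists>lo hi V. (\<forall>j. lo $ j < hi $ j) \<and> 0 < lo $ 3 \<and>
    (\<forall>t\<in>{0..T}. \<forall>\<xi>\<in>cbox lo hi. norm (wavevec t \<xi>) \<le> 1) \<and>
    continuous_on ({0..T} \<times> UNIV) (\<lambda>(t, \<xi>). V t \<xi>) \<and>
    (\<forall>t\<in>{0..T}. \<forall>\<xi>\<in>cbox lo hi.
       ((\<lambda>s. V s \<xi>) has_vector_derivative mode_rate f \<nu> (wavevec t \<xi>) (V t \<xi>)) (at t within {0..T}) \<and>
       wavevec t \<xi> \<bullet> V t \<xi> = 0 \<and>
       exp (\<Lambda> * t) - \<epsilon> \<le> norm (V t \<xi>) \<and> norm (V t \<xi>) \<le> exp (\<Lambda> * t) + \<epsilon>) \<and>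
    (\<forall>\<xi>\<in>cbox lo hi. 1 \<le> norm (V 0 \<xi>))"
proof -
  have "\<epsilon> / 2 > 0" using \<epsilon> by simp
  from plane_mode_exists[OF f \<nu> T this, folded \<Lambda>_def]
  obtain lo hi :: "real^3" and W \<theta> where \<theta>: "0 < \<theta>" "\<theta> \<le> 1" and lohi: "\<forall>j. lo $ j < hi $ j" "0 < lo $ 3"
    and box': "\<forall>t\<in>{0..T}. \<forall>\<xi>\<in>cbox lo hi. norm (wavevec t \<xi>) \<le> 1 \<and>
       \<bar>wavevec t \<xi> $ 1\<bar> \<le> \<theta> * \<xi> $ 3 \<and> \<bar>wavevec t \<xi> $ 2\<bar> \<le> \<theta> * \<xi> $ 3"
    and Wc: "continuous_on ({0..T} \<times> UNIV) (\<lambda>(t, \<xi>). W t \<xi>)"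
    and W0': "\<forall>\<xi>. W 0 \<xi> = (sqrt (1 - f), - sqrt f)"
    and W': "\<forall>t\<in>{0..T}. \<forall>\<xi>\<in>cbox lo hi.
       ((\<lambda>s. W s \<xi>) has_vector_derivative plane_rate f \<nu> (wavevec t \<xi>) (W t \<xi>)) (at t within {0..T}) \<and>
       norm (W t \<xi> - exp (\<Lambda> * t) *\<^sub>R (sqrt (1 - f), - sqrt f)) \<le> \<epsilon> / 2 \<and> \<theta> * (2 * norm (W t \<xi>)) \<le> \<epsilon> / 2"
    by (elim exE conjE) (rule that)
  note box = box'[rule_format] and W0 = W0'[rule_format] and Wd = W'[rule_format, THEN conjunct1]
    and Wn = W'[rule_format, THEN conjunct2]
  define h where "h = lo $ 3"
  have h: "h > 0" using lohi by (simp add: h_def)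
  have \<xi>3: "h \<le> \<xi> $ 3" if "\<xi> \<in> cbox lo hi" for \<xi> using that by (simp add: mem_box_cart h_def)
  \<comment> \<open>The maximum with \<open>h\<close> changes nothing on the box and makes the quotient continuous everywhere.\<close>
  define V :: "real \<Rightarrow> real^3 \<Rightarrow> real^3" where
    "V t \<xi> = vector [fst (W t \<xi>), snd (W t \<xi>),
       - (wavevec t \<xi> $ 1 * fst (W t \<xi>) + wavevec t \<xi> $ 2 * snd (W t \<xi>)) / max h (\<xi> $ 3)]" for t \<xi>
  have V12: "V t \<xi> $ 1 = fst (W t \<xi>)" "V t \<xi> $ 2 = snd (W t \<xi>)" for t \<xi> by (simp_all add: V_def)
  have V3: "V t \<xi> $ 3 = - (wavevec t \<xi> $ 1 * fst (W t \<xi>) + wavevec t \<xi> $ 2 * snd (W t \<xi>)) / \<xi> $ 3"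
    if "\<xi> \<in> cbox lo hi" for t \<xi> using \<xi>3[OF that] by (simp add: V_def)
  have Vc: "continuous_on ({0..T} \<times> UNIV) (\<lambda>(t, \<xi>). V t \<xi>)"
    using Wc unfolding V_def split_beta
    by (intro continuous_intros) (use h in \<open>auto simp: max_def\<close>)
  have nV: "(norm (V t \<xi>))\<^sup>2 = (norm (W t \<xi>))\<^sup>2 + (V t \<xi> $ 3)\<^sup>2" for t \<xi>
    by (simp add: power2_norm_eq_inner inner_3 inner_prod_def V12 power2_eq_square[of "V t \<xi> $ 3"])
  have lowV: "norm (W t \<xi>) \<le> norm (V t \<xi>)" for t \<xi>
    by (rule power2_le_imp_le) (simp_all add: nV)
  have upV: "norm (V t \<xi>) \<le> norm (W t \<xi>) + \<bar>V t \<xi> $ 3\<bar>" for t \<xi>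
    by (rule power2_le_imp_le) (simp_all add: nV power2_sum)
  have nv: "norm (sqrt (1 - f), - sqrt f) = 1" using f by (simp add: norm_Pair)
  have bounds: "exp (\<Lambda> * t) - \<epsilon> \<le> norm (V t \<xi>)" "norm (V t \<xi>) \<le> exp (\<Lambda> * t) + \<epsilon>"
    if t: "t \<in> {0..T}" and \<xi>: "\<xi> \<in> cbox lo hi" for t \<xi>
  proof -
    have "\<bar>norm (W t \<xi>) - norm (exp (\<Lambda> * t) *\<^sub>R (sqrt (1 - f), - sqrt f))\<bar> \<le> \<epsilon> / 2"
      using norm_triangle_ineq3 order_trans Wn[OF t \<xi>] by blast
    then have w: "\<bar>norm (W t \<xi>) - exp (\<Lambda> * t)\<bar> \<le> \<epsilon> / 2" unfolding norm_scaleR nv by simp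
    have p: "\<xi> $ 3 > 0" using \<xi>3[OF \<xi>] h by simp
    have "\<bar>wavevec t \<xi> $ 1 * fst (W t \<xi>) + wavevec t \<xi> $ 2 * snd (W t \<xi>)\<bar>
        \<le> \<theta> * \<xi> $ 3 * norm (W t \<xi>) + \<theta> * \<xi> $ 3 * norm (W t \<xi>)"
    proof (rule order_trans[OF abs_triangle_ineq], intro add_mono)
      show "\<bar>wavevec t \<xi> $ 1 * fst (W t \<xi>)\<bar> \<le> \<theta> * \<xi> $ 3 * norm (W t \<xi>)"
        unfolding abs_mult using box[OF t \<xi>] norm_fst_le[of "fst (W t \<xi>)" "snd (W t \<xi>)"] \<theta> p by (intro mult_mono) simp_all
      show "\<bar>wavevec t \<xi> $ 2 * snd (W t \<xi>)\<bar> \<le> \<theta> * \<xi> $ 3 * norm (W t \<xi>)"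
        unfolding abs_mult using box[OF t \<xi>] norm_snd_le[of "snd (W t \<xi>)" "fst (W t \<xi>)"] \<theta> p by (intro mult_mono) simp_all
    qed
    also have "\<dots> = \<theta> * (2 * norm (W t \<xi>)) * \<xi> $ 3" by simp
    finally have "\<bar>V t \<xi> $ 3\<bar> \<le> \<theta> * (2 * norm (W t \<xi>))"
      unfolding V3[OF \<xi>] abs_divide abs_minus_cancel using p by (simp add: divide_le_eq)
    then have v3: "\<bar>V t \<xi> $ 3\<bar> \<le> \<epsilon> / 2" using Wn[OF t \<xi>] by linarith
    show "exp (\<Lambda> * t) - \<epsilon> \<le> norm (V t \<xi>)" using lowV[of t \<xi>] w \<epsilon> by linarith
    show "norm (V t \<xi>) \<le> exp (\<Lambda> * t) + \<epsilon>" using upV[of t \<xi>] v3 w by linarith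
  qed
  have div: "wavevec t \<xi> \<bullet> V t \<xi> = 0" if "\<xi> \<in> cbox lo hi" for t \<xi>
    using \<xi>3[OF that] h by (simp add: inner_3 V12 V3[OF that])
  have one: "1 \<le> norm (V 0 \<xi>)" for \<xi> using lowV[of 0 \<xi>] unfolding W0 nv .
  have der: "((\<lambda>s. V s \<xi>) has_vector_derivative mode_rate f \<nu> (wavevec t \<xi>) (V t \<xi>)) (at t within {0..T})"
    if t: "t \<in> {0..T}" and \<xi>: "\<xi> \<in> cbox lo hi" for t \<xi>
  proof (rule vec_has_vector_derivative)
    fix j :: 3
    let ?\<eta> = "wavevec t \<xi>" and ?a = "fst (W t \<xi>)" and ?b = "snd (W t \<xi>)"
    let ?a' = "fst (plane_rate f \<nu> ?\<eta> (W t \<xi>))" and ?b' = "snd (plane_rate f \<nu> ?\<eta> (W t \<xi>))"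
    have da: "((\<lambda>s. fst (W s \<xi>)) has_vector_derivative ?a') (at t within {0..T})"
      by (rule bounded_linear.has_vector_derivative[OF bounded_linear_fst Wd[OF t \<xi>]])
    have db: "((\<lambda>s. snd (W s \<xi>)) has_vector_derivative ?b') (at t within {0..T})"
      by (rule bounded_linear.has_vector_derivative[OF bounded_linear_snd Wd[OF t \<xi>]])
    define p where "p = press f ?\<eta> (V t \<xi>)"
    have ab: "?a' = - ((1 - f) * ?b) - \<nu> * (?\<eta> \<bullet> ?\<eta>) * ?a + p * ?\<eta> $ 1"
      "?b' = - (f * ?a) - \<nu> * (?\<eta> \<bullet> ?\<eta>) * ?b + p * ?\<eta> $ 2"
      by (simp_all add: p_def press_def plane_rate_def V12)
    consider "j = 1" | "j = 2" | "j = 3" using exhaust_3 by blast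
    then show "((\<lambda>s. V s \<xi> $ j) has_vector_derivative mode_rate f \<nu> ?\<eta> (V t \<xi>) $ j) (at t within {0..T})"
    proof cases
      case 1
      then show ?thesis using da by (simp only: V12 mode_rate_nth ab p_def)
    next
      case 2
      then show ?thesis using db by (simp only: V12 mode_rate_nth ab p_def)
    next
      case 3
      have p0: "\<xi> $ 3 > 0" using \<xi>3[OF \<xi>] h by simp
      have N: "?\<eta> \<bullet> ?\<eta> = (?\<eta> $ 1)\<^sup>2 + (?\<eta> $ 2)\<^sup>2 + (\<xi> $ 3)\<^sup>2" by (simp add: inner_3 power2_eq_square)
      then have "?\<eta> \<bullet> ?\<eta> > 0" using p0 by (simp add: add_nonneg_pos)
      then have pN: "p * (?\<eta> \<bullet> ?\<eta>) = (2 - f) * ?\<eta> $ 1 * ?b + f * ?\<eta> $ 2 * ?a"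
        by (simp add: p_def press_def V12)
      have "((\<lambda>s. - (wavevec s \<xi> $ 1 * fst (W s \<xi>) + wavevec s \<xi> $ 2 * snd (W s \<xi>)) / \<xi> $ 3)
          has_real_derivative - (\<xi> $ 1 * ?a' + (- \<xi> $ 1 * ?b + ?\<eta> $ 2 * ?b')) / \<xi> $ 3) (at t within {0..T})"
        using da db unfolding has_real_derivative_iff_has_vector_derivative[symmetric]
        by (intro DERIV_cdivide) (auto intro!: derivative_eq_intros simp: algebra_simps)
      also have "- (\<xi> $ 1 * ?a' + (- \<xi> $ 1 * ?b + ?\<eta> $ 2 * ?b')) / \<xi> $ 3 = mode_rate f \<nu> ?\<eta> (V t \<xi>) $ 3"
      proof -
        have v: "V t \<xi> $ 3 * \<xi> $ 3 = - (?\<eta> $ 1 * ?a + ?\<eta> $ 2 * ?b)" using p0 by (simp only: V3[OF \<xi>]) simp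
        have "- (\<xi> $ 1 * ?a' + (- \<xi> $ 1 * ?b + ?\<eta> $ 2 * ?b')) = (- \<nu> * (?\<eta> \<bullet> ?\<eta>) * V t \<xi> $ 3 + p * \<xi> $ 3) * \<xi> $ 3"
        proof -
          define n where "n = ?\<eta> \<bullet> ?\<eta>"
          define e1 e2 e3 a b v3 where "e1 = ?\<eta> $ 1" and "e2 = ?\<eta> $ 2" and "e3 = \<xi> $ 3" and "a = ?a" and "b = ?b" and "v3 = V t \<xi> $ 3"
          have x: "\<xi> $ 1 = e1" by (simp add: e1_def)
          have N': "n = e1\<^sup>2 + e2\<^sup>2 + e3\<^sup>2" and pN': "p * n = (2 - f) * e1 * b + f * e2 * a" and v': "v3 * e3 = - (e1 * a + e2 * b)"
            using N pN v by (simp_all only: n_def e1_def e2_def e3_def a_def b_def v3_def)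
          have "- (e1 * (- ((1 - f) * b) - \<nu> * n * a + p * e1) + (- e1 * b + e2 * (- (f * a) - \<nu> * n * b + p * e2)))
            = (2 - f) * e1 * b + f * e2 * a + \<nu> * n * (e1 * a + e2 * b) - p * (e1\<^sup>2 + e2\<^sup>2)"
            by (simp add: algebra_simps power2_eq_square)
          also have "\<dots> = p * n + \<nu> * n * (- (v3 * e3)) - p * (n - e3\<^sup>2)"
            using pN' v' N' by simp
          also have "\<dots> = (- \<nu> * n * v3 + p * e3) * e3" by (simp add: algebra_simps power2_eq_square)
          finally show ?thesis
            unfolding ab x by (simp only: n_def e1_def e2_def e3_def a_def b_def v3_def)
        qed
        then show ?thesis using p0 by (simp add: mode_rate_nth p_def)
      qed
      finally show ?thesis
        using 3 V3[OF \<xi>] by (simp add: has_real_derivative_iff_has_vector_derivative)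
    qed
  qed
  have conj: "\<forall>t\<in>{0..T}. \<forall>\<xi>\<in>cbox lo hi.
       ((\<lambda>s. V s \<xi>) has_vector_derivative mode_rate f \<nu> (wavevec t \<xi>) (V t \<xi>)) (at t within {0..T}) \<and>
       wavevec t \<xi> \<bullet> V t \<xi> = 0 \<and>
       exp (\<Lambda> * t) - \<epsilon> \<le> norm (V t \<xi>) \<and> norm (V t \<xi>) \<le> exp (\<Lambda> * t) + \<epsilon>"
    using der div bounds by blast
  have small: "\<forall>t\<in>{0..T}. \<forall>\<xi>\<in>cbox lo hi. norm (wavevec t \<xi>) \<le> 1" using box by blast
  show ?thesis
    by (intro exI[of _ lo] exI[of _ hi] exI[of _ V] conjI lohi small Vc conj) (use one in blast)
qed

lemma linear_wavevec: "linear (wavevec t)"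
  by (rule linearI) (simp_all add: vec_eq_iff forall_3 algebra_simps)

lemma wavevec_inverse [simp]: "wavevec t (wavevec (- t) \<eta>) = \<eta>" "wavevec (- t) (wavevec t \<eta>) = \<eta>"
  by (simp_all add: vec_eq_iff forall_3)

lemma wavevec_minus [simp]: "wavevec t (- \<eta>) = - wavevec t \<eta>"
  by (simp add: vec_eq_iff forall_3)

lemma measurable_wavevec [measurable]: "wavevec t \<in> borel_measurable borel"
  by (intro borel_measurable_continuous_onI continuous_intros)

text \<open>A shear has determinant 1, so it preserves the volume of boxes.\<close>

lemma lborel_distr_wavevec: "distr lborel borel (wavevec t) = (lborel :: (real^3) measure)"
proof (rule lborel_eqI[symmetric])
  fix l u :: "real^3" assume lu: "\<And>b. b \<in> Basis \<Longrightarrow> l \<bullet> b \<le> u \<bullet> b"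
  have pre: "wavevec t -` box l u = wavevec (- t) ` box l u"
  proof (intro set_eqI iffI)
    fix \<xi> assume "\<xi> \<in> wavevec t -` box l u"
    then show "\<xi> \<in> wavevec (- t) ` box l u" by (intro image_eqI[of _ _ "wavevec t \<xi>"]) auto
  qed auto
  have det: "det (matrix (wavevec (- t))) = 1"
    by (simp add: det_3 matrix_def axis_def)
  have m: "measure lebesgue (wavevec (- t) ` box l u) = measure lebesgue (box l u)"
    using measure_linear_image[OF linear_wavevec, of "box l u" "- t"] by (simp add: det)
  have l: "wavevec (- t) ` box l u \<in> lmeasurable"
    by (rule measurable_linear_image[OF linear_wavevec]) simp
  have b: "wavevec (- t) ` box l u \<in> sets borel"
    unfolding pre[symmetric] using measurable_sets[OF measurable_wavevec, of "box l u" t] by simp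
  have "emeasure (distr lborel borel (wavevec t)) (box l u) = emeasure lborel (wavevec (- t) ` box l u)"
    by (simp add: emeasure_distr pre)
  also have "\<dots> = emeasure lebesgue (wavevec (- t) ` box l u)" using b by simp
  also have "\<dots> = ennreal (measure lebesgue (box l u))"
    using l by (simp add: emeasure_eq_measure2 m)
  also have "\<dots> = emeasure lborel (box l u)"
    using lu by (simp add: measure_def emeasure_lborel_box_eq)
  finally show "emeasure (distr lborel borel (wavevec t)) (box l u) = (\<Prod>b\<in>Basis. (u - l) \<bullet> b)"
    using lu by simp
qed simp

lemma integral_wavevec:
  fixes g :: "real^3 \<Rightarrow> 'b::{banach, second_countable_topology}"
  assumes "g \<in> borel_measurable borel"
  shows "(LINT \<xi>|lborel. g (wavevec t \<xi>)) = (LINT \<eta>|lborel. g \<eta>)"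
  using integral_distr[of "wavevec t" lborel borel g] assms by (simp add: lborel_distr_wavevec)

lemma integrable_wavevec:
  fixes g :: "real^3 \<Rightarrow> 'b::{banach, second_countable_topology}"
  assumes "integrable lborel g"
  shows "integrable lborel (\<lambda>\<xi>. g (wavevec t \<xi>))"
  using integrable_distr[of "wavevec t" lborel borel g] assms by (simp add: lborel_distr_wavevec)

text \<open>Substituting the moving wave vector replaces the time-dependent support of the amplitude by a fixed cube,
which makes differentiation with respect to time possible: in the fixed frame the amplitude is not
known to be differentiable in time.\<close>

lemma wave_moving_frame:
  assumes G: "amplitude G" and supp: "\<And>\<xi>. G (wavevec s \<xi>) \<noteq> 0 \<Longrightarrow> norm \<xi> \<le> 1"
  shows "wave G x = integral (cbox (vec (-1)) (vec 1)) (\<lambda>\<xi>. Re (cis (x \<bullet> wavevec s \<xi>) * G (wavevec s \<xi>)))"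
proof -
  let ?g = "\<lambda>\<eta>. Re (cis (x \<bullet> \<eta>) * G \<eta>)" and ?Q = "cbox (vec (-1)) (vec 1) :: (real^3) set"
  have i: "integrable lborel (\<lambda>\<eta>. cis (x \<bullet> \<eta>) * G \<eta>)"
    by (intro integrable_cis_mult amplitude_integrable G) auto
  then have ig: "integrable lborel ?g" by (rule integrable_Re)
  have "wave G x = (LINT \<eta>|lborel. ?g \<eta>)"
    unfolding wave_def synthesis_def by (rule integral_Re[OF i, symmetric])
  also have "\<dots> = (LINT \<xi>|lborel. ?g (wavevec s \<xi>))"
    using ig by (intro integral_wavevec[symmetric]) auto
  also have "\<dots> = integral UNIV (\<lambda>\<xi>. ?g (wavevec s \<xi>))"
    by (rule integral_lborel[symmetric]) (rule integrable_wavevec[OF ig])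
  also have "(\<lambda>\<xi>. ?g (wavevec s \<xi>)) = (\<lambda>\<xi>. if \<xi> \<in> ?Q then ?g (wavevec s \<xi>) else 0)"
  proof
    fix \<xi>
    have "\<xi> \<in> ?Q" if "norm \<xi> \<le> 1"
      using component_le_norm_cart[of \<xi>] that by (auto simp: mem_box_cart abs_le_iff intro: order_trans)
        (metis abs_le_iff minus_le_iff order_trans)
    then show "?g (wavevec s \<xi>) = (if \<xi> \<in> ?Q then ?g (wavevec s \<xi>) else 0)"
      using supp[of \<xi>] by (cases "G (wavevec s \<xi>) = 0") simp_all
  qed
  also have "integral UNIV \<dots> = integral ?Q (\<lambda>\<xi>. ?g (wavevec s \<xi>))"
    by (rule integral_restrict_UNIV)
  finally show ?thesis .
qed

section \<open>Wave packets as solutions of the linearized system\<close>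

lemma wave_real_eq: "wave (\<lambda>\<eta>. complex_of_real a * G \<eta>) x = a * wave G x"
  by (simp add: wave_def synthesis_cmult)

lemma wave_add: "amplitude F \<Longrightarrow> amplitude G \<Longrightarrow> wave (\<lambda>\<eta>. F \<eta> + G \<eta>) x = wave F x + wave G x"
  by (simp add: wave_def synthesis_add)

lemma wave_diff: "amplitude F \<Longrightarrow> amplitude G \<Longrightarrow> wave (\<lambda>\<eta>. F \<eta> - G \<eta>) x = wave F x - wave G x"
  by (simp add: wave_def synthesis_diff)

lemma amplitude_slice:
  assumes c: "continuous_on ({0..T} \<times> UNIV) (\<lambda>(t, \<eta>). a t \<eta>)" and t: "t \<in> {0..T}"
    and s: "\<And>\<eta>. a t \<eta> \<noteq> 0 \<Longrightarrow> norm \<eta> \<le> 1"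
  shows "amplitude (a t)"
proof -
  have "continuous_on UNIV (\<lambda>\<eta>. (\<lambda>(t, \<eta>). a t \<eta>) (t, \<eta>))"
    by (rule continuous_on_compose2[OF c]) (use t in \<open>auto intro!: continuous_intros\<close>)
  moreover have "\<forall>\<eta>. norm \<eta> > 1 \<longrightarrow> a t \<eta> = 0" using s by force
  ultimately show ?thesis unfolding amplitude_def by auto
qed

lemma C_sobolev_cong:
  assumes "\<And>t. t \<in> {0..T} \<Longrightarrow> u t = v t"
  shows "C_sobolev T k u \<longleftrightarrow> C_sobolev T k v"
proof -
  have "((\<lambda>s. sobolev_norm k (\<lambda>x. u s x - u t x)) \<longlongrightarrow> 0) (at t within {0..T}) \<longleftrightarrow>
      ((\<lambda>s. sobolev_norm k (\<lambda>x. v s x - v t x)) \<longlongrightarrow> 0) (at t within {0..T})" if "t \<in> {0..T}" for t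
    unfolding assms[OF that] by (rule tendsto_cong) (auto simp: eventually_at_filter assms intro!: always_eventually)
  with assms show ?thesis unfolding C_sobolev_def by auto
qed

text \<open>\<open>U t \<xi>\<close> is the amplitude of the mode labelled by \<open>\<xi>\<close>. The lower bound \<open>h\<close> for \<open>|\<xi>\<^sub>3|\<close> on the
support keeps the packet away from frequency zero, where the pressure symbol is singular.\<close>

locale wave_packet =
  fixes f \<nu> T h :: real and U :: "real \<Rightarrow> real^3 \<Rightarrow> real^3"
  assumes T: "0 < T" and h: "0 < h"
    and U_cont: "continuous_on ({0..T} \<times> UNIV) (\<lambda>(t, \<xi>). U t \<xi>)"
    and U_even: "\<And>t \<xi>. U t (- \<xi>) = U t \<xi>"
    and U_support: "\<And>t s \<xi>. t \<in> {0..T} \<Longrightarrow> s \<in> {0..T} \<Longrightarrow> U t \<xi> \<noteq> 0 \<Longrightarrow> norm (wavevec s \<xi>) \<le> 1 \<and> h \<le> \<bar>\<xi> $ 3\<bar>"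
    and U_ode: "\<And>t \<xi>. t \<in> {0..T} \<Longrightarrow>
      ((\<lambda>s. U s \<xi>) has_vector_derivative mode_rate f \<nu> (wavevec t \<xi>) (U t \<xi>)) (at t within {0..T})"
    and U_div: "\<And>t \<xi>. t \<in> {0..T} \<Longrightarrow> wavevec t \<xi> \<bullet> U t \<xi> = 0"
begin

text \<open>The same amplitude in the fixed frame, as a function of the actual wave vector.\<close>

definition profile :: "real \<Rightarrow> real^3 \<Rightarrow> real^3" where
  "profile t \<eta> = U t (wavevec (- t) \<eta>)"

definition vamp :: "real \<Rightarrow> 3 \<Rightarrow> real^3 \<Rightarrow> complex" where
  "vamp t j \<eta> = complex_of_real (profile t \<eta> $ j)"

definition pamp :: "real \<Rightarrow> real^3 \<Rightarrow> complex" where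
  "pamp t \<eta> = \<i> * complex_of_real (press f \<eta> (profile t \<eta>))"

definition velocity :: "real \<Rightarrow> real^3 \<Rightarrow> real^3" where
  "velocity t = field (vamp t)"

definition pressure :: "real \<Rightarrow> real^3 \<Rightarrow> real" where
  "pressure t = wave (pamp t)"

lemma profile_support:
  assumes "t \<in> {0..T}" "profile t \<eta> \<noteq> 0" shows "norm \<eta> \<le> 1" "h\<^sup>2 \<le> \<eta> \<bullet> \<eta>"
proof -
  from U_support[OF assms(1,1), of "wavevec (- t) \<eta>"] assms(2)
  have *: "norm \<eta> \<le> 1" "h \<le> \<bar>\<eta> $ 3\<bar>" by (simp_all add: profile_def)
  show "norm \<eta> \<le> 1" by (rule *(1))
  have "h\<^sup>2 \<le> (\<eta> $ 3)\<^sup>2" using power_mono[OF *(2), of 2] h by simp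
  also have "\<dots> \<le> \<eta> \<bullet> \<eta>" by (simp add: inner_3 power2_eq_square)
  finally show "h\<^sup>2 \<le> \<eta> \<bullet> \<eta>" .
qed

lemma profile_even: "profile t (- \<eta>) = profile t \<eta>"
  by (simp add: profile_def U_even)

lemma profile_cont: "continuous_on ({0..T} \<times> UNIV) (\<lambda>y. profile (fst y) (snd y))"
proof -
  have "continuous_on ({0..T} \<times> UNIV) (\<lambda>y. (\<lambda>(t, \<xi>). U t \<xi>) (fst y, wavevec (- fst y) (snd y)))"
    by (rule continuous_on_compose2[OF U_cont]) (auto intro!: continuous_intros)
  then show ?thesis by (simp add: profile_def)
qed

text \<open>On the support, \<open>|\<eta>|\<^sup>2\<close> may be replaced by its maximum with \<open>h\<^sup>2\<close>, and the denominator of the new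
expression has no zeros.\<close>

lemma press_cont: "continuous_on ({0..T} \<times> UNIV) (\<lambda>y. press f (snd y) (profile (fst y) (snd y)))"
proof -
  let ?n = "\<lambda>y. (2 - f) * snd y $ 1 * profile (fst y) (snd y) $ 2 + f * snd y $ 2 * profile (fst y) (snd y) $ 1"
  have "continuous_on ({0..T} \<times> UNIV) (\<lambda>y. ?n y / max (h\<^sup>2) (snd y \<bullet> snd y))"
    by (intro continuous_intros profile_cont) (use h in \<open>auto simp: max_def\<close>)
  moreover have "?n y / max (h\<^sup>2) (snd y \<bullet> snd y) = press f (snd y) (profile (fst y) (snd y))"
    if "y \<in> {0..T} \<times> UNIV" for y
    using profile_support(2)[of "fst y" "snd y"] that
    by (cases "profile (fst y) (snd y) = 0") (auto simp: press_def max_absorb2)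
  ultimately show ?thesis by (simp cong: continuous_on_cong)
qed

lemma rate_cont: "continuous_on ({0..T} \<times> UNIV) (\<lambda>y. mode_rate f \<nu> (snd y) (profile (fst y) (snd y)))"
  unfolding mode_rate_def by (intro continuous_intros profile_cont press_cont)

lemma vamp_cont: "continuous_on ({0..T} \<times> UNIV) (\<lambda>(t, \<eta>). vamp t j \<eta>)"
  unfolding vamp_def split_beta by (intro continuous_intros profile_cont)

lemma pamp_cont: "continuous_on ({0..T} \<times> UNIV) (\<lambda>(t, \<eta>). pamp t \<eta>)"
  unfolding pamp_def split_beta by (intro continuous_intros press_cont)

lemma vamp_support: "t \<in> {0..T} \<Longrightarrow> vamp t j \<eta> \<noteq> 0 \<Longrightarrow> norm \<eta> \<le> 1"
  using profile_support(1)[of t \<eta>] by (force simp: vamp_def)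

lemma pamp_support: "t \<in> {0..T} \<Longrightarrow> pamp t \<eta> \<noteq> 0 \<Longrightarrow> norm \<eta> \<le> 1"
  using profile_support(1)[of t \<eta>] by (force simp: pamp_def)

lemma amplitude_vamp: "t \<in> {0..T} \<Longrightarrow> amplitude (vamp t j)"
  using amplitude_slice[of T "\<lambda>t. vamp t j", OF vamp_cont] vamp_support by blast

lemma amplitude_pamp: "t \<in> {0..T} \<Longrightarrow> amplitude (pamp t)"
  using amplitude_slice[of T pamp, OF pamp_cont] pamp_support by blast

lemma hermitian_vamp: "hermitian (vamp t j)"
  by (simp add: hermitian_def vamp_def profile_even)

lemma hermitian_pamp: "hermitian (pamp t)"
  by (simp add: hermitian_def pamp_def profile_even press_minus)

lemma amplitude_rate:
  assumes "t \<in> {0..T}"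
  shows "amplitude (\<lambda>\<eta>. complex_of_real (mode_rate f \<nu> \<eta> (profile t \<eta>) $ j))"
proof (rule amplitude_slice[of T "\<lambda>t \<eta>. complex_of_real (mode_rate f \<nu> \<eta> (profile t \<eta>) $ j)", OF _ assms])
  show "continuous_on ({0..T} \<times> UNIV) (\<lambda>(t, \<eta>). complex_of_real (mode_rate f \<nu> \<eta> (profile t \<eta>) $ j))"
    unfolding split_beta by (intro continuous_intros rate_cont)
  show "complex_of_real (mode_rate f \<nu> \<eta> (profile t \<eta>) $ j) \<noteq> 0 \<Longrightarrow> norm \<eta> \<le> 1" for \<eta>
    using profile_support(1)[OF assms, of \<eta>] by force
qed

lemma C_sobolev_velocity: "C_sobolev T k velocity"
  unfolding velocity_def[abs_def]
  by (rule C_sobolev_field[where R = 1])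
     (use amplitude_vamp hermitian_vamp vamp_support vamp_cont in \<open>force+\<close>)

lemma gradient_pressure: "t \<in> {0..T} \<Longrightarrow> gradient (pressure t) = field (\<lambda>j. deriv_symbol j (pamp t))"
  unfolding pressure_def by (rule gradient_wave[OF amplitude_pamp])

lemma C_sobolev_gradient_pressure: "C_sobolev T k (\<lambda>t. gradient (pressure t))"
proof -
  have "C_sobolev T k (\<lambda>t. field (\<lambda>j. deriv_symbol j (pamp t)))"
  proof (rule C_sobolev_field[where R = 1])
    show "continuous_on ({0..T} \<times> UNIV) (\<lambda>(t, \<eta>). deriv_symbol j (pamp t) \<eta>)" for j
      using pamp_cont unfolding deriv_symbol_def split_beta by (intro continuous_intros)
    show "deriv_symbol j (pamp t) \<eta> = 0" if "t \<in> {0..T}" "1 < norm \<eta>" for t j \<eta>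
      using pamp_support[OF that(1), of \<eta>] that(2) by (auto simp: deriv_symbol_def)
    show "amplitude (deriv_symbol j (pamp t))" "hermitian (deriv_symbol j (pamp t))" if "t \<in> {0..T}" for t j
      by (intro amplitude_deriv_symbol hermitian_deriv_symbol amplitude_pamp hermitian_pamp that)+
  qed
  then show ?thesis by (rule C_sobolev_cong[THEN iffD1, rotated]) (simp add: gradient_pressure)
qed

text \<open>In the moving frame the phase \<open>x \<bullet> wavevec s \<xi>\<close> has the time derivative \<open>- x\<^sub>2 \<xi>\<^sub>1\<close>. Its contribution is
exactly the transport term \<open>- x\<^sub>2 \<partial>\<^sub>1\<close>, and the amplitude contributes \<open>mode_rate\<close>.\<close>

lemma velocity_time_derivative:
  assumes t: "t \<in> {0..T}"
  shows "((\<lambda>s. velocity s x $ j) has_vector_derivative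
      wave (\<lambda>\<eta>. complex_of_real (mode_rate f \<nu> \<eta> (profile t \<eta>) $ j)) x - x $ 2 * wave (deriv_symbol 1 (vamp t j)) x)
    (at t within {0..T})"
proof -
  let ?Q = "cbox (vec (-1)) (vec 1) :: (real^3) set"
  let ?R = "\<lambda>t \<eta>. complex_of_real (mode_rate f \<nu> \<eta> (profile t \<eta>) $ j)"
  define F where "F s \<xi> = cos (x \<bullet> wavevec s \<xi>) * U s \<xi> $ j" for s \<xi>
  define F' where "F' s \<xi> = x $ 2 * \<xi> $ 1 * sin (x \<bullet> wavevec s \<xi>) * U s \<xi> $ j
    + cos (x \<bullet> wavevec s \<xi>) * mode_rate f \<nu> (wavevec s \<xi>) (U s \<xi>) $ j" for s \<xi>
  have small: "norm \<xi> \<le> 1" if "s \<in> {0..T}" "U s \<xi> \<noteq> 0" for s \<xi>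
  proof -
    have "wavevec 0 \<xi> = \<xi>" by (simp add: vec_eq_iff forall_3)
    then show ?thesis using U_support[OF that(1) _ that(2), of 0] T by simp
  qed
  have pw: "profile s (wavevec s \<xi>) = U s \<xi>" for s \<xi> by (simp add: profile_def)
  have vel: "velocity s x $ j = integral ?Q (F s)" if s: "s \<in> {0..T}" for s
  proof -
    have "wave (vamp s j) x = integral ?Q (\<lambda>\<xi>. Re (cis (x \<bullet> wavevec s \<xi>) * vamp s j (wavevec s \<xi>)))"
    proof (rule wave_moving_frame[OF amplitude_vamp[OF s]])
      show "vamp s j (wavevec s \<xi>) \<noteq> 0 \<Longrightarrow> norm \<xi> \<le> 1" for \<xi>
        using small[OF s, of \<xi>] by (force simp: vamp_def pw)
    qed
    then show ?thesis by (simp add: velocity_def F_def[abs_def] vamp_def pw)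
  qed
  have Uc: "continuous_on ({0..T} \<times> ?Q) (\<lambda>y. U (fst y) (snd y))"
    using continuous_on_subset[OF U_cont, of "{0..T} \<times> ?Q"] by (auto simp: split_beta)
  have "continuous_on ({0..T} \<times> ?Q) (\<lambda>y. (\<lambda>y. mode_rate f \<nu> (snd y) (profile (fst y) (snd y))) (fst y, wavevec (fst y) (snd y)))"
    by (rule continuous_on_compose2[OF rate_cont]) (auto intro!: continuous_intros)
  then have Rc: "continuous_on ({0..T} \<times> ?Q) (\<lambda>y. mode_rate f \<nu> (wavevec (fst y) (snd y)) (U (fst y) (snd y)))"
    by (simp add: pw)
  have "((\<lambda>s. integral ?Q (F s)) has_vector_derivative integral ?Q (F' t)) (at t within {0..T})"
  proof (rule leibniz_rule_vector_derivative[OF _ _ _ t])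
    show "convex {0..T}" by simp
    show "continuous_on ({0..T} \<times> ?Q) (\<lambda>(s, \<xi>). F' s \<xi>)"
      unfolding F'_def split_beta by (intro continuous_intros Uc Rc)
    fix s assume s: "s \<in> {0..T}"
    have "continuous_on ?Q (\<lambda>\<xi>. (\<lambda>y. U (fst y) (snd y)) (s, \<xi>))"
      by (rule continuous_on_compose2[OF Uc]) (use s in \<open>auto intro!: continuous_intros\<close>)
    then show "F s integrable_on ?Q"
      unfolding F_def by (intro integrable_continuous continuous_intros) simp
    fix \<xi> assume "\<xi> \<in> ?Q"
    have "((\<lambda>s. U s \<xi> $ j) has_real_derivative mode_rate f \<nu> (wavevec s \<xi>) (U s \<xi>) $ j) (at s within {0..T})"
      unfolding has_real_derivative_iff_has_vector_derivative
      by (rule bounded_linear.has_vector_derivative[OF bounded_linear_vec_nth U_ode[OF s]])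
    moreover have "((\<lambda>s. x \<bullet> wavevec s \<xi>) has_real_derivative - (x $ 2 * \<xi> $ 1)) (at s within {0..T})"
      unfolding inner_3 by (auto intro!: derivative_eq_intros)
    ultimately have "((\<lambda>s. F s \<xi>) has_real_derivative F' s \<xi>) (at s within {0..T})"
      unfolding F_def F'_def by (auto intro!: derivative_eq_intros simp: algebra_simps)
    then show "((\<lambda>s. F s \<xi>) has_vector_derivative F' s \<xi>) (at s within {0..T})"
      by (simp add: has_real_derivative_iff_has_vector_derivative)
  qed
  then have "((\<lambda>s. velocity s x $ j) has_vector_derivative integral ?Q (F' t)) (at t within {0..T})"
    by (rule has_vector_derivative_transform[OF t, rotated]) (rule vel)
  moreover have "integral ?Q (F' t) = wave (?R t) x - x $ 2 * wave (deriv_symbol 1 (vamp t j)) x"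
  proof -
    let ?G = "\<lambda>\<eta>. ?R t \<eta> - complex_of_real (x $ 2) * deriv_symbol 1 (vamp t j) \<eta>"
    have a: "amplitude (\<lambda>\<eta>. complex_of_real (x $ 2) * deriv_symbol 1 (vamp t j) \<eta>)"
      by (intro amplitude_mult amplitude_deriv_symbol amplitude_vamp t continuous_intros)
    have "wave ?G x = integral ?Q (\<lambda>\<xi>. Re (cis (x \<bullet> wavevec t \<xi>) * ?G (wavevec t \<xi>)))"
    proof (rule wave_moving_frame[OF amplitude_diff[OF amplitude_rate[OF t] a]])
      show "?G (wavevec t \<xi>) \<noteq> 0 \<Longrightarrow> norm \<xi> \<le> 1" for \<xi>
        using small[OF t, of \<xi>] by (cases "U t \<xi> = 0") (simp_all add: vamp_def pw deriv_symbol_def)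
    qed
    also have "(\<lambda>\<xi>. Re (cis (x \<bullet> wavevec t \<xi>) * ?G (wavevec t \<xi>))) = F' t"
      by (rule ext) (simp add: F'_def vamp_def pw deriv_symbol_def algebra_simps)
    finally have "integral ?Q (F' t) = wave ?G x" by simp
    also have "\<dots> = wave (?R t) x - x $ 2 * wave (deriv_symbol 1 (vamp t j)) x"
      by (simp add: wave_diff[OF amplitude_rate[OF t] a] wave_real_eq)
    finally show ?thesis .
  qed
  ultimately show ?thesis by simp
qed

lemma partial_velocity:
  "t \<in> {0..T} \<Longrightarrow> partial k (velocity t) = field (\<lambda>j. deriv_symbol k (vamp t j))"
  unfolding velocity_def by (rule partial_field[OF amplitude_vamp])

lemma laplacian_velocity:
  "t \<in> {0..T} \<Longrightarrow> laplacian (velocity t) x $ j = (\<Sum>k\<in>UNIV. wave (deriv_symbol k (deriv_symbol k (vamp t j))) x)"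
  unfolding laplacian_def
  by (simp add: partial_velocity partial_field amplitude_deriv_symbol amplitude_vamp)

text \<open>Each of the three components of \<open>mode_rate\<close> has this form, with suitable \<open>c\<close> and \<open>i\<close>; this treats all
components of the momentum equation at once.\<close>

lemma wave_rate:
  assumes t: "t \<in> {0..T}"
  shows "wave (\<lambda>\<eta>. complex_of_real (- c * profile t \<eta> $ i - \<nu> * (\<eta> \<bullet> \<eta>) * profile t \<eta> $ j + press f \<eta> (profile t \<eta>) * \<eta> $ j)) x
    = - c * velocity t x $ i + \<nu> * laplacian (velocity t) x $ j - gradient (pressure t) x $ j"
proof -
  let ?L = "\<lambda>k. deriv_symbol k (deriv_symbol k (vamp t j))"
  have L: "amplitude (?L k)" for k by (intro amplitude_deriv_symbol amplitude_vamp t)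
  have a: "amplitude (vamp t i)" "amplitude (deriv_symbol j (pamp t))"
    by (intro amplitude_deriv_symbol amplitude_vamp amplitude_pamp t)+
  have m: "amplitude G \<Longrightarrow> amplitude (\<lambda>\<eta>. complex_of_real b * G \<eta>)" for b G
    by (intro amplitude_mult continuous_intros)
  have e: "complex_of_real (- c * profile t \<eta> $ i - \<nu> * (\<eta> \<bullet> \<eta>) * profile t \<eta> $ j + press f \<eta> (profile t \<eta>) * \<eta> $ j)
    = complex_of_real (- c) * vamp t i \<eta> + complex_of_real \<nu> * (?L 1 \<eta> + ?L 2 \<eta> + ?L 3 \<eta>) - deriv_symbol j (pamp t) \<eta>" for \<eta>
    by (simp add: vamp_def pamp_def deriv_symbol_def inner_3 algebra_simps)
  show ?thesis
    unfolding e laplacian_velocity[OF t] gradient_pressure[OF t]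
    by (simp add: wave_diff wave_add wave_real_eq amplitude_add m L a sum_3 velocity_def
        del: of_real_minus)
qed

lemma momentum_equation:
  assumes t: "t \<in> {0..T}"
  shows "(\<lambda>s. velocity s x) differentiable (at t within {0..T})"
    and "vector_derivative (\<lambda>s. velocity s x) (at t within {0..T})
         + vector [velocity t x $ 2, 0, 0]
         + (x $ 2) *\<^sub>R partial 1 (velocity t) x
         + f *\<^sub>R vector [- (velocity t x $ 2), velocity t x $ 1, 0]
       = \<nu> *\<^sub>R laplacian (velocity t) x - gradient (pressure t) x" (is ?momentum)
proof -
  define D :: "real^3" where "D = (\<chi> j. wave (\<lambda>\<eta>. complex_of_real (mode_rate f \<nu> \<eta> (profile t \<eta>) $ j)) x
      - x $ 2 * wave (deriv_symbol 1 (vamp t j)) x)"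
  have D: "((\<lambda>s. velocity s x) has_vector_derivative D) (at t within {0..T})"
    by (rule vec_has_vector_derivative) (simp add: D_def velocity_time_derivative[OF t])
  then show "(\<lambda>s. velocity s x) differentiable (at t within {0..T})"
    by (rule differentiableI_vector)
  have vd: "vector_derivative (\<lambda>s. velocity s x) (at t within {0..T}) = D"
    by (rule vector_derivative_within_closed_interval[OF T t D])
  have r: "mode_rate f \<nu> \<eta> v $ 1 = - (1 - f) * v $ 2 - \<nu> * (\<eta> \<bullet> \<eta>) * v $ 1 + press f \<eta> v * \<eta> $ 1"
    "mode_rate f \<nu> \<eta> v $ 2 = - f * v $ 1 - \<nu> * (\<eta> \<bullet> \<eta>) * v $ 2 + press f \<eta> v * \<eta> $ 2"
    "mode_rate f \<nu> \<eta> v $ 3 = - 0 * v $ 1 - \<nu> * (\<eta> \<bullet> \<eta>) * v $ 3 + press f \<eta> v * \<eta> $ 3" for \<eta> v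
    by (simp_all add: mode_rate_nth algebra_simps)
  have DD: "D $ 1 = (- (1 - f) * velocity t x $ 2 + \<nu> * laplacian (velocity t) x $ 1 - gradient (pressure t) x $ 1) - x $ 2 * wave (deriv_symbol 1 (vamp t 1)) x"
    "D $ 2 = (- f * velocity t x $ 1 + \<nu> * laplacian (velocity t) x $ 2 - gradient (pressure t) x $ 2) - x $ 2 * wave (deriv_symbol 1 (vamp t 2)) x"
    "D $ 3 = (- 0 * velocity t x $ 1 + \<nu> * laplacian (velocity t) x $ 3 - gradient (pressure t) x $ 3) - x $ 2 * wave (deriv_symbol 1 (vamp t 3)) x"
    by (simp_all only: D_def vec_lambda_beta r wave_rate[OF t])
  show ?momentum
    unfolding vd vec_eq_iff forall_3 by (simp add: DD partial_velocity[OF t] algebra_simps)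
qed

lemma pressure_equation:
  assumes t: "t \<in> {0..T}"
  shows "inverse_laplacian
       (\<lambda>x. 2 * partial 1 (velocity t) x $ 2 + f * (partial 2 (velocity t) x $ 1 - partial 1 (velocity t) x $ 2))
       (\<lambda>x. - pressure t x)"
proof -
  let ?H = "\<lambda>\<eta>. complex_of_real (2 - f) * deriv_symbol 1 (vamp t 2) \<eta> + complex_of_real f * deriv_symbol 2 (vamp t 1) \<eta>"
  let ?P = "\<lambda>\<eta>. complex_of_real (- 1) * pamp t \<eta>"
  have m: "amplitude G \<Longrightarrow> amplitude (\<lambda>\<eta>. complex_of_real b * G \<eta>)" for b G
    by (intro amplitude_mult continuous_intros)
  have d: "amplitude (deriv_symbol k (vamp t j))" for k j by (intro amplitude_deriv_symbol amplitude_vamp t)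
  have "inverse_laplacian (wave ?H) (wave ?P)"
  proof (rule inverse_laplacian_wave)
    show "amplitude ?H" by (intro amplitude_add m d)
    show "amplitude ?P" by (intro m amplitude_pamp t)
    show "hermitian ?H" using hermitian_deriv_symbol[OF hermitian_vamp] by (simp add: hermitian_def)
    show "hermitian ?P" using hermitian_pamp by (simp add: hermitian_def)
    show "?P \<eta> = complex_of_real (- 1 / (norm \<eta>)\<^sup>2) * ?H \<eta>" for \<eta>
      unfolding power2_norm_eq_inner
      by (simp add: pamp_def deriv_symbol_def vamp_def press_def add_divide_distrib) (simp add: algebra_simps add_divide_distrib)
  qed
  moreover have "wave ?H = (\<lambda>x. 2 * partial 1 (velocity t) x $ 2 + f * (partial 2 (velocity t) x $ 1 - partial 1 (velocity t) x $ 2))"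
    by (rule ext, unfold wave_add[OF m[OF d] m[OF d]] wave_real_eq partial_velocity[OF t] field_nth) (simp add: algebra_simps)
  moreover have "wave ?P = (\<lambda>x. - pressure t x)"
    by (rule ext, unfold wave_real_eq pressure_def) simp
  ultimately show ?thesis by (simp only:) 
qed

lemma divergence_velocity:
  assumes t: "t \<in> {0..T}"
  shows "divergence (velocity t) x = 0"
proof -
  let ?G = "\<lambda>j. deriv_symbol j (vamp t j)"
  have a: "amplitude (?G j)" for j by (intro amplitude_deriv_symbol amplitude_vamp t)
  have "divergence (velocity t) x = wave (?G 1) x + wave (?G 2) x + wave (?G 3) x"
    by (simp add: divergence_def partial_velocity[OF t] sum_3)
  also have "\<dots> = wave (\<lambda>\<eta>. ?G 1 \<eta> + ?G 2 \<eta> + ?G 3 \<eta>) x"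
    by (simp add: wave_add amplitude_add a)
  also have "(\<lambda>\<eta>. ?G 1 \<eta> + ?G 2 \<eta> + ?G 3 \<eta>) = (\<lambda>\<eta>. 0)"
  proof
    fix \<eta>
    have "?G 1 \<eta> + ?G 2 \<eta> + ?G 3 \<eta> = \<i> * complex_of_real (\<eta> \<bullet> profile t \<eta>)"
      by (simp add: deriv_symbol_def vamp_def inner_3 algebra_simps)
    also have "\<eta> \<bullet> profile t \<eta> = 0" using U_div[OF t, of "wavevec (- t) \<eta>"] by (simp add: profile_def)
    finally show "?G 1 \<eta> + ?G 2 \<eta> + ?G 3 \<eta> = 0" by simp
  qed
  also have "wave (\<lambda>\<eta>. 0) x = 0" by (simp add: wave_def synthesis_def)
  finally show ?thesis .
qed

theorem linearized_solution_wave_packet: "linearized_solution f \<nu> T velocity pressure"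
  unfolding linearized_solution_def
proof (intro ballI conjI allI)
  fix t assume t: "t \<in> {0..T}"
  show "C_class 2 (velocity t)" unfolding velocity_def by (rule C_class_field[OF amplitude_vamp[OF t]])
  show "C_class 1 (pressure t)" unfolding pressure_def by (rule C_class_wave[OF amplitude_pamp[OF t]])
  show "((\<lambda>x. norm (velocity t x)) \<longlongrightarrow> 0) at_infinity"
    unfolding velocity_def by (rule field_tendsto_0[OF amplitude_vamp[OF t]])
qed (rule momentum_equation pressure_equation divergence_velocity; assumption)+

lemma L2_norm_velocity:
  assumes t: "t \<in> {0..T}"
  shows "L2_norm (velocity t) = sqrt ((2 * pi) ^ 3 * (LINT \<xi>|lborel. (norm (U t \<xi>))\<^sup>2))"
proof -
  have "continuous_on UNIV (\<lambda>\<eta>. (\<lambda>y. profile (fst y) (snd y)) (t, \<eta>))"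
    by (rule continuous_on_compose2[OF profile_cont]) (use t in \<open>auto intro!: continuous_intros\<close>)
  then have c: "(\<lambda>\<eta>. (norm (profile t \<eta>))\<^sup>2) \<in> borel_measurable borel"
    by (intro borel_measurable_continuous_onI continuous_intros) simp
  have "(LINT \<eta>|lborel. (\<Sum>j\<in>UNIV. (norm (vamp t j \<eta>))\<^sup>2)) = (LINT \<eta>|lborel. (norm (profile t \<eta>))\<^sup>2)"
    by (simp add: vamp_def norm_vec_def L2_set_def sum_nonneg)
  also have "\<dots> = (LINT \<xi>|lborel. (norm (profile t (wavevec t \<xi>)))\<^sup>2)"
    using integral_wavevec[OF c] by simp
  finally show ?thesis
    unfolding velocity_def L2_norm_field[OF amplitude_vamp[OF t] hermitian_vamp] by (simp add: profile_def)
qed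

text \<open>The frequencies of the packet have length at most 1, where the Sobolev weight is at most \<open>2\<^sup>k\<close>.\<close>

lemma sobolev_norm_velocity:
  assumes t: "t \<in> {0..T}"
  shows "sobolev_norm k (velocity t) \<le> sqrt (2 ^ k) * L2_norm (velocity t)"
proof -
  let ?w = "\<lambda>k j. LINT \<xi>|lborel. (1 + (norm \<xi>)\<^sup>2) ^ k * (norm (vamp t j \<xi>))\<^sup>2"
  have i: "integrable lborel (\<lambda>\<xi>. (1 + (norm \<xi>)\<^sup>2) ^ k * (norm (vamp t j \<xi>))\<^sup>2)" for k j
  proof -
    have "integrable lborel (\<lambda>\<xi>. norm (complex_of_real ((1 + (norm \<xi>)\<^sup>2) ^ k) * (vamp t j \<xi> * vamp t j \<xi>)))"
      by (intro integrable_norm amplitude_integrable amplitude_mult amplitude_vamp t continuous_intros amplitude_continuous)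
    then show ?thesis
      by (simp only: norm_mult norm_of_real abs_of_nonneg power2_eq_square zero_le_power add_nonneg_nonneg
        zero_le_one mult_nonneg_nonneg norm_ge_zero)
  qed
  have "?w k j \<le> 2 ^ k * ?w 0 j" for j
  proof -
    have "?w k j \<le> (LINT \<xi>|lborel. 2 ^ k * ((1 + (norm \<xi>)\<^sup>2) ^ 0 * (norm (vamp t j \<xi>))\<^sup>2))"
    proof (intro integral_mono i integrable_mult_right)
      fix \<xi> :: "real^3"
      show "(1 + (norm \<xi>)\<^sup>2) ^ k * (norm (vamp t j \<xi>))\<^sup>2 \<le> 2 ^ k * ((1 + (norm \<xi>)\<^sup>2) ^ 0 * (norm (vamp t j \<xi>))\<^sup>2)"
      proof (cases "vamp t j \<xi> = 0")
        case False
        then have "norm \<xi> \<le> 1" using vamp_support[OF t] by blast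
        then have "(norm \<xi>)\<^sup>2 \<le> 1" by (simp add: power_le_one)
        then have "(1 + (norm \<xi>)\<^sup>2) ^ k \<le> 2 ^ k" by (intro power_mono) (auto simp: add_nonneg_nonneg)
        then show ?thesis by (simp add: mult_right_mono)
      qed simp
    qed
    then show ?thesis by simp
  qed
  then have "(\<Sum>j\<in>UNIV. ?w k j) \<le> 2 ^ k * (\<Sum>j\<in>UNIV. ?w 0 j)"
    unfolding sum_distrib_left by (intro sum_mono)
  then have "(2 * pi) ^ 3 * (\<Sum>j\<in>UNIV. ?w k j) \<le> 2 ^ k * ((2 * pi) ^ 3 * (\<Sum>j\<in>UNIV. ?w 0 j))"
    unfolding mult.left_commute[of "2 ^ k"] by (intro mult_left_mono) auto
  then have "sqrt ((2 * pi) ^ 3 * (\<Sum>j\<in>UNIV. ?w k j)) \<le> sqrt (2 ^ k) * sqrt ((2 * pi) ^ 3 * (\<Sum>j\<in>UNIV. ?w 0 j))"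
    unfolding real_sqrt_mult[symmetric] by (rule real_sqrt_le_mono)
  moreover have "L2_norm (velocity t) = sqrt ((2 * pi) ^ 3 * (\<Sum>j\<in>UNIV. ?w 0 j))"
  proof -
    have "integrable lborel (\<lambda>\<xi>. (norm (vamp t j \<xi>))\<^sup>2)" for j using i[of 0 j] by simp
    then show ?thesis
      unfolding velocity_def L2_norm_field[OF amplitude_vamp[OF t] hermitian_vamp]
      by (subst Bochner_Integration.integral_sum) simp_all
  qed
  ultimately show ?thesis
    unfolding velocity_def sobolev_norm_field[OF amplitude_vamp[OF t] hermitian_vamp] by simp
qed

end

section \<open>Packets growing at the optimal rate\<close>

lemma mode_rate_add_scaleR:
  "mode_rate f \<nu> \<eta> (a *\<^sub>R v + b *\<^sub>R w) = a *\<^sub>R mode_rate f \<nu> \<eta> v + b *\<^sub>R mode_rate f \<nu> \<eta> w"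
proof -
  have "press f \<eta> (a *\<^sub>R v + b *\<^sub>R w) = a * press f \<eta> v + b * press f \<eta> w"
    by (simp add: press_def add_divide_distrib diff_divide_distrib algebra_simps)
  then show ?thesis by (simp add: vec_eq_iff forall_3 mode_rate_nth algebra_simps)
qed

text \<open>The pressure is odd in \<open>\<eta>\<close> and is multiplied by \<open>\<eta>\<close>. Therefore the reflected packet solves the same
mode equation.\<close>

lemma mode_rate_minus: "mode_rate f \<nu> (- \<eta>) v = mode_rate f \<nu> \<eta> v"
  by (simp add: mode_rate_def press_minus)

text \<open>\<open>Y\<close> is the common \<open>L\<^sup>2\<close> size of the weight, which lies slightly below the initial norm. The smaller
tolerance \<open>\<epsilon>'\<close> absorbs the error made in replacing \<open>Y\<close> by \<open>N 0\<close>, since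
\<open>(e - \<epsilon>) (1 + \<epsilon>') \<le> e - \<epsilon>'\<close> for \<open>e \<le> exp (\<Lambda> T)\<close>.\<close>

lemma L2_ratio_bounds:
  fixes N :: "real \<Rightarrow> real"
  assumes up: "\<And>t. t \<in> {0..T} \<Longrightarrow> N t \<le> (exp (\<Lambda> * t) + \<epsilon>') * Y"
    and low: "\<And>t. t \<in> {0..T} \<Longrightarrow> (exp (\<Lambda> * t) - \<epsilon>') * Y \<le> N t"
    and Y: "Y \<le> N 0" "0 \<le> Y" and N: "\<And>t. 0 \<le> N t" and T: "0 \<le> T" and \<Lambda>: "0 \<le> \<Lambda>"
    and \<epsilon>: "0 < \<epsilon>" "\<epsilon>' = \<epsilon> / (exp (\<Lambda> * T) + 1)" and t: "t \<in> {0..T}"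
  shows "(exp (\<Lambda> * t) - \<epsilon>) * N 0 \<le> N t" and "N t \<le> (exp (\<Lambda> * t) + \<epsilon>) * N 0"
proof -
  let ?e = "exp (\<Lambda> * t)" and ?E = "exp (\<Lambda> * T)"
  have E: "?E + 1 > 0" by (simp add: add_pos_pos)
  have e': "\<epsilon>' * ?E = \<epsilon> - \<epsilon>'" "\<epsilon>' > 0"
  proof -
    show "\<epsilon>' > 0" unfolding \<epsilon>(2) using \<epsilon>(1) E by (rule divide_pos_pos)
    have "\<epsilon>' * (?E + 1) = \<epsilon>" using E by (simp add: \<epsilon>(2))
    then show "\<epsilon>' * ?E = \<epsilon> - \<epsilon>'" by (simp add: algebra_simps)
  qed
  have eE: "?e \<le> ?E" using t \<Lambda> by (simp add: mult_left_mono)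
  have "\<epsilon>' * 1 \<le> \<epsilon>' * ?E" using e'(2) T \<Lambda> by (intro mult_left_mono) auto
  then have le: "\<epsilon>' \<le> \<epsilon>" using e' by linarith
  have "N t \<le> (?e + \<epsilon>') * Y" by (rule up[OF t])
  also have "\<dots> \<le> (?e + \<epsilon>) * N 0" using le Y \<epsilon> by (intro mult_mono) (auto simp: add_nonneg_nonneg)
  finally show "N t \<le> (?e + \<epsilon>) * N 0" .
  show "(?e - \<epsilon>) * N 0 \<le> N t"
  proof (cases "?e \<le> \<epsilon>")
    case True
    then have "(?e - \<epsilon>) * N 0 \<le> 0" using N[of 0] by (simp add: mult_nonpos_nonneg)
    then show ?thesis using N[of t] by linarith
  next
    case False
    have "N 0 \<le> (1 + \<epsilon>') * Y" using up[of 0] T by simp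
    then have "(?e - \<epsilon>) * N 0 \<le> (?e - \<epsilon>) * ((1 + \<epsilon>') * Y)" using False by (intro mult_left_mono) auto
    also have "\<dots> = ((?e - \<epsilon>) * (1 + \<epsilon>')) * Y" by simp
    also have "\<dots> \<le> (?e - \<epsilon>') * Y"
    proof (rule mult_right_mono[OF _ Y(2)])
      have "\<epsilon>' * ?e \<le> \<epsilon> - \<epsilon>'" using mult_left_mono[OF eE, of \<epsilon>'] e' by simp
      moreover have "0 \<le> \<epsilon> * \<epsilon>'" using \<epsilon>(1) e'(2) by simp
      ultimately show "(?e - \<epsilon>) * (1 + \<epsilon>') \<le> ?e - \<epsilon>'" by (simp add: algebra_simps)
    qed
    also have "\<dots> \<le> N t" by (rule low[OF t])
    finally show ?thesis .
  qed
qed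

lemma integral_square_pos:
  fixes X :: "'a::euclidean_space \<Rightarrow> real"
  assumes c: "continuous_on UNIV X" and i: "integrable lborel (\<lambda>\<xi>. (X \<xi>)\<^sup>2)" and z: "X z \<noteq> 0"
  shows "0 < (LINT \<xi>|lborel. (X \<xi>)\<^sup>2)"
proof -
  have "(LINT \<xi>|lborel. (X \<xi>)\<^sup>2) \<noteq> 0"
  proof
    assume "(LINT \<xi>|lborel. (X \<xi>)\<^sup>2) = 0"
    then have "AE \<xi> in lborel. \<xi> \<in> {\<xi>. X \<xi> = 0}"
      using integral_nonneg_eq_0_iff_AE[OF i] by simp
    then have "AE \<xi> in lebesgue. \<xi> \<in> {\<xi>. X \<xi> = 0}" by (rule AE_completion)
    moreover have "closed {\<xi>. X \<xi> = 0}"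
      using continuous_closed_preimage_constant[OF c closed_UNIV, of 0] by simp
    ultimately have "z \<in> {\<xi>. X \<xi> = 0}" using mem_closed_if_AE_lebesgue by blast
    with z show False by simp
  qed
  moreover have "0 \<le> (LINT \<xi>|lborel. (X \<xi>)\<^sup>2)" by (intro Bochner_Integration.integral_nonneg) simp
  ultimately show ?thesis by linarith
qed

text \<open>The packet consists of the growing modes weighted by the distance to the complement of the box, plus
its mirror image under \<open>\<xi> \<mapsto> - \<xi>\<close>. The two pieces have disjoint supports, because the box lies in the
half space \<open>\<xi>\<^sub>3 > 0\<close>; hence the pointwise bounds for one mode hold for the sum as well.\<close>

lemma growing_solution_exists:
  fixes f \<nu> T \<epsilon> \<Lambda> :: real
  assumes f: "0 < f" "f < 1" and \<nu>: "\<nu> > 0" and \<Lambda>: "\<Lambda> = sqrt (f * (1 - f))" and T: "T > 0" and \<epsilon>: "\<epsilon> > 0"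
  shows "\<exists>u q. linearized_solution f \<nu> T u q \<and> (\<exists>t\<in>{0..T}. \<exists>x. u t x \<noteq> 0) \<and>
      (\<forall>k. C_sobolev T k u) \<and> (\<forall>k. C_sobolev T k (\<lambda>t. gradient (q t))) \<and>
      (\<forall>t\<in>{0..T}. (exp (t * \<Lambda>) - \<epsilon>) * L2_norm (u 0) \<le> L2_norm (u t) \<and>
                  L2_norm (u t) \<le> (exp (t * \<Lambda>) + \<epsilon>) * L2_norm (u 0)) \<and>
      (\<forall>k. sobolev_norm k (u 0) \<le> sqrt (2 ^ k) * L2_norm (u 0))"
proof -
  have \<Lambda>0: "\<Lambda> \<ge> 0" using f by (simp add: \<Lambda>)
  define \<epsilon>' where "\<epsilon>' = \<epsilon> / (exp (\<Lambda> * T) + 1)"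
  have \<epsilon>': "\<epsilon>' > 0" using \<epsilon> by (simp add: \<epsilon>'_def add_pos_pos)
  from growing_mode_exists[OF f \<nu> T \<epsilon>', folded \<Lambda>]
  obtain lo hi V where lohi: "\<forall>j. lo $ j < hi $ j" "0 < lo $ 3"
    and small': "\<forall>t\<in>{0..T}. \<forall>\<xi>\<in>cbox lo hi. norm (wavevec t \<xi>) \<le> 1"
    and Vc: "continuous_on ({0..T} \<times> UNIV) (\<lambda>(t, \<xi>). V t \<xi>)"
    and V': "\<forall>t\<in>{0..T}. \<forall>\<xi>\<in>cbox lo hi.
       ((\<lambda>s. V s \<xi>) has_vector_derivative mode_rate f \<nu> (wavevec t \<xi>) (V t \<xi>)) (at t within {0..T}) \<and>
       wavevec t \<xi> \<bullet> V t \<xi> = 0 \<and>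
       exp (\<Lambda> * t) - \<epsilon>' \<le> norm (V t \<xi>) \<and> norm (V t \<xi>) \<le> exp (\<Lambda> * t) + \<epsilon>'"
    and V1': "\<forall>\<xi>\<in>cbox lo hi. 1 \<le> norm (V 0 \<xi>)"
    by (elim exE conjE) (rule that)
  note small = small'[rule_format] and V = V'[rule_format] and V1 = V1'[rule_format]
  define \<beta> where "\<beta> \<xi> = infdist \<xi> (- box lo hi)" for \<xi>
  have \<beta>0: "0 \<le> \<beta> \<xi>" for \<xi> by (simp add: \<beta>_def infdist_nonneg)
  have \<beta>b: "\<xi> \<in> cbox lo hi" if "\<beta> \<xi> \<noteq> 0" for \<xi>
  proof (rule ccontr)
    assume "\<xi> \<notin> cbox lo hi"
    then have "\<xi> \<in> - box lo hi" using box_subset_cbox by blast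
    with that show False by (simp add: \<beta>_def)
  qed
  have \<beta>m: "\<beta> (- \<xi>) = 0" if "\<beta> \<xi> \<noteq> 0" for \<xi>
  proof (rule ccontr)
    assume "\<beta> (- \<xi>) \<noteq> 0"
    from \<beta>b[OF this] \<beta>b[OF that] have "lo $ 3 \<le> - (\<xi> $ 3)" "lo $ 3 \<le> \<xi> $ 3"
      by (simp_all add: mem_box_cart)
    with lohi(2) show False by linarith
  qed
  have \<beta>c: "continuous_on S g \<Longrightarrow> continuous_on S (\<lambda>x. \<beta> (g x))" for S :: "'z::topological_space set" and g
    unfolding \<beta>_def by (rule continuous_on_infdist)
  define U where "U t \<xi> = \<beta> \<xi> *\<^sub>R V t \<xi> + \<beta> (- \<xi>) *\<^sub>R V t (- \<xi>)" for t \<xi>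
  have supp: "norm (wavevec s \<xi>) \<le> 1 \<and> lo $ 3 \<le> \<bar>\<xi> $ 3\<bar>" if s: "s \<in> {0..T}" and n: "\<beta> \<xi> \<noteq> 0 \<or> \<beta> (- \<xi>) \<noteq> 0" for s \<xi>
    using n
  proof
    assume "\<beta> \<xi> \<noteq> 0"
    from \<beta>b[OF this] show ?thesis using small[OF s, of \<xi>] by (simp add: mem_box_cart) (metis abs_ge_self order_trans)
  next
    assume "\<beta> (- \<xi>) \<noteq> 0"
    from \<beta>b[OF this] have "norm (wavevec s (- \<xi>)) \<le> 1" "lo $ 3 \<le> - (\<xi> $ 3)"
      using small[OF s, of "- \<xi>"] by (simp_all add: mem_box_cart)
    then show ?thesis using abs_ge_minus_self[of "\<xi> $ 3"] by simp
  qed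
  have part: "((\<lambda>s. \<beta> \<xi> *\<^sub>R V s \<xi>) has_vector_derivative \<beta> \<xi> *\<^sub>R mode_rate f \<nu> (wavevec t \<xi>) (V t \<xi>)) (at t within {0..T})"
    if t: "t \<in> {0..T}" for t \<xi>
  proof (cases "\<beta> \<xi> = 0")
    case False
    have "((\<lambda>s. V s \<xi>) has_vector_derivative mode_rate f \<nu> (wavevec t \<xi>) (V t \<xi>)) (at t within {0..T})"
      using V[OF t \<beta>b[OF False]] by blast
    then show ?thesis by (rule bounded_linear.has_vector_derivative[OF bounded_linear_scaleR_right])
  qed simp
  interpret wave_packet f \<nu> T "lo $ 3" U
  proof
    show "continuous_on ({0..T} \<times> UNIV) (\<lambda>(t, \<xi>). U t \<xi>)"
    proof -
      have a: "continuous_on ({0..T} \<times> UNIV) (\<lambda>y. V (fst y) (snd y))" using Vc by (simp add: split_beta)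
      have "continuous_on ({0..T} \<times> UNIV) (\<lambda>y. (\<lambda>y. V (fst y) (snd y)) (fst y, - snd y))"
        by (rule continuous_on_compose2[OF a]) (auto intro!: continuous_intros)
      then show ?thesis unfolding U_def split_beta using a by (intro continuous_intros \<beta>c) simp_all
    qed
    show "U t (- \<xi>) = U t \<xi>" for t \<xi> by (simp add: U_def add.commute)
    show "norm (wavevec s \<xi>) \<le> 1 \<and> lo $ 3 \<le> \<bar>\<xi> $ 3\<bar>" if "t \<in> {0..T}" "s \<in> {0..T}" "U t \<xi> \<noteq> 0" for t s \<xi>
      by (rule supp[OF that(2)]) (use that(3) in \<open>auto simp: U_def\<close>)
    show "((\<lambda>s. U s \<xi>) has_vector_derivative mode_rate f \<nu> (wavevec t \<xi>) (U t \<xi>)) (at t within {0..T})" if t: "t \<in> {0..T}" for t \<xi>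
      using has_vector_derivative_add[OF part[OF t, of \<xi>] part[OF t, of "- \<xi>"]]
      by (simp add: U_def mode_rate_add_scaleR mode_rate_minus)
    show "wavevec t \<xi> \<bullet> U t \<xi> = 0" if t: "t \<in> {0..T}" for t \<xi>
    proof -
      have *: "\<beta> \<xi> * (wavevec t \<xi> \<bullet> V t \<xi>) = 0" for \<xi>
        using V[OF t, of \<xi>] \<beta>b[of \<xi>] by (cases "\<beta> \<xi> = 0") auto
      show ?thesis using *[of \<xi>] *[of "- \<xi>"] by (auto simp: U_def inner_add_right)
    qed
  qed (use T lohi in auto)
  define X where "X \<xi> = \<beta> \<xi> + \<beta> (- \<xi>)" for \<xi>
  have X0: "0 \<le> X \<xi>" for \<xi> by (simp add: X_def \<beta>0)
  have Xc: "continuous_on UNIV X" unfolding X_def by (intro continuous_intros \<beta>c)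
  have bounds: "(exp (\<Lambda> * t) - \<epsilon>') * X \<xi> \<le> norm (U t \<xi>)" "norm (U t \<xi>) \<le> (exp (\<Lambda> * t) + \<epsilon>') * X \<xi>"
    "t = 0 \<Longrightarrow> X \<xi> \<le> norm (U t \<xi>)" if t: "t \<in> {0..T}" for t \<xi>
  proof -
    have one: "(exp (\<Lambda> * t) - \<epsilon>') * X \<xi> \<le> norm (U t \<xi>) \<and> norm (U t \<xi>) \<le> (exp (\<Lambda> * t) + \<epsilon>') * X \<xi> \<and> (t = 0 \<longrightarrow> X \<xi> \<le> norm (U t \<xi>))"
      if n: "\<beta> \<xi> \<noteq> 0" for \<xi>
    proof -
      have p: "norm (U t \<xi>) = norm (V t \<xi>) * \<beta> \<xi>" "X \<xi> = \<beta> \<xi>"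
        using \<beta>m[OF n] \<beta>0[of \<xi>] by (simp_all add: U_def X_def)
      show ?thesis
        unfolding p using V[OF t \<beta>b[OF n]] V1[OF \<beta>b[OF n]] \<beta>0[of \<xi>]
        by (auto intro: mult_right_mono simp: mult_le_cancel_right1)
    qed
    have even: "U t (- \<xi>) = U t \<xi>" "X (- \<xi>) = X \<xi>" by (simp_all add: U_def X_def add.commute)
    have "(exp (\<Lambda> * t) - \<epsilon>') * X \<xi> \<le> norm (U t \<xi>) \<and> norm (U t \<xi>) \<le> (exp (\<Lambda> * t) + \<epsilon>') * X \<xi> \<and> (t = 0 \<longrightarrow> X \<xi> \<le> norm (U t \<xi>))"
    proof (cases "\<beta> \<xi> = 0")
      case True
      show ?thesis
      proof (cases "\<beta> (- \<xi>) = 0")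
        case b: True
        have "U t \<xi> = 0" "X \<xi> = 0" using True b by (simp_all add: U_def X_def)
        then show ?thesis by simp
      next
        case False
        from one[OF this] show ?thesis unfolding even .
      qed
    qed (rule one)
    then show "(exp (\<Lambda> * t) - \<epsilon>') * X \<xi> \<le> norm (U t \<xi>)" "norm (U t \<xi>) \<le> (exp (\<Lambda> * t) + \<epsilon>') * X \<xi>"
      "t = 0 \<Longrightarrow> X \<xi> \<le> norm (U t \<xi>)" by blast+
  qed
  have XI: "integrable lborel (\<lambda>\<xi>. (X \<xi>)\<^sup>2)"
  proof -
    have "wavevec 0 \<xi> = \<xi>" for \<xi> by (simp add: vec_eq_iff forall_3)
    then have "norm \<xi> \<le> 1" if "X \<xi> \<noteq> 0" for \<xi> using supp[of 0 \<xi>] T that by (auto simp: X_def)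
    then have "\<forall>\<xi>. norm \<xi> > 1 \<longrightarrow> complex_of_real (X \<xi>) = 0" by force
    then have a: "amplitude (\<lambda>\<xi>. complex_of_real (X \<xi>))"
      unfolding amplitude_def using Xc by (auto intro!: continuous_intros)
    have "integrable lborel (\<lambda>\<xi>. norm (complex_of_real (X \<xi>) * complex_of_real (X \<xi>)))"
      by (intro integrable_norm amplitude_integrable amplitude_mult a amplitude_continuous)
    then show ?thesis by (simp add: norm_mult power2_eq_square X0 flip: of_real_mult)
  qed
  have Um: "(\<lambda>\<xi>. (norm (U t \<xi>))\<^sup>2) \<in> borel_measurable lborel" if "t \<in> {0..T}" for t
  proof -
    have "continuous_on UNIV (\<lambda>\<xi>. (\<lambda>(t, \<xi>). U t \<xi>) (t, \<xi>))"
      by (rule continuous_on_compose2[OF U_cont]) (use that in \<open>auto intro!: continuous_intros\<close>)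
    then show ?thesis by (simp, intro borel_measurable_continuous_onI continuous_intros)
  qed
  have UI: "integrable lborel (\<lambda>\<xi>. (norm (U t \<xi>))\<^sup>2)" if t: "t \<in> {0..T}" for t
  proof (rule Bochner_Integration.integrable_bound[OF _ Um[OF t]])
    show "integrable lborel (\<lambda>\<xi>. (exp (\<Lambda> * t) + \<epsilon>')\<^sup>2 * (X \<xi>)\<^sup>2)" using XI by simp
    show "AE \<xi> in lborel. norm ((norm (U t \<xi>))\<^sup>2) \<le> norm ((exp (\<Lambda> * t) + \<epsilon>')\<^sup>2 * (X \<xi>)\<^sup>2)"
      using bounds(2)[OF t] by (auto simp flip: power_mult_distrib intro!: AE_I2 power_mono)
  qed
  define I where "I = (LINT \<xi>|lborel. (X \<xi>)\<^sup>2)"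
  define Y where "Y = sqrt ((2 * pi) ^ 3 * I)"
  have mono: "a * Y \<le> L2_norm (velocity t)" if t: "t \<in> {0..T}" and a: "\<And>\<xi>. a * X \<xi> \<le> norm (U t \<xi>)" for a t
  proof (cases "0 \<le> a")
    case True
    have "a\<^sup>2 * I = (LINT \<xi>|lborel. a\<^sup>2 * (X \<xi>)\<^sup>2)" by (simp add: I_def)
    also have "\<dots> \<le> (LINT \<xi>|lborel. (norm (U t \<xi>))\<^sup>2)"
      by (intro integral_mono integrable_mult_right XI UI t)
         (use a True X0 in \<open>auto simp flip: power_mult_distrib intro!: power_mono\<close>)
    finally have "(2 * pi) ^ 3 * (a\<^sup>2 * I) \<le> (2 * pi) ^ 3 * (LINT \<xi>|lborel. (norm (U t \<xi>))\<^sup>2)"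
      by (intro mult_left_mono) auto
    then have "sqrt (a\<^sup>2 * ((2 * pi) ^ 3 * I)) \<le> L2_norm (velocity t)"
      unfolding L2_norm_velocity[OF t] by (intro real_sqrt_le_mono) (simp add: mult.left_commute)
    then show ?thesis using True by (simp add: Y_def real_sqrt_mult)
  next
    case False
    have "0 \<le> Y" "0 \<le> L2_norm (velocity t)"
      by (auto simp: Y_def I_def L2_norm_def intro!: mult_nonneg_nonneg Bochner_Integration.integral_nonneg)
    then show ?thesis using False mult_nonpos_nonneg[of a Y] by linarith
  qed
  have up: "L2_norm (velocity t) \<le> a * Y" if t: "t \<in> {0..T}" and a: "0 \<le> a" "\<And>\<xi>. norm (U t \<xi>) \<le> a * X \<xi>" for a t
  proof -
    have "(LINT \<xi>|lborel. (norm (U t \<xi>))\<^sup>2) \<le> (LINT \<xi>|lborel. a\<^sup>2 * (X \<xi>)\<^sup>2)"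
      by (intro integral_mono integrable_mult_right XI UI t)
         (use a in \<open>auto simp flip: power_mult_distrib intro!: power_mono\<close>)
    also have "\<dots> = a\<^sup>2 * I" by (simp add: I_def)
    finally have "(2 * pi) ^ 3 * (LINT \<xi>|lborel. (norm (U t \<xi>))\<^sup>2) \<le> (2 * pi) ^ 3 * (a\<^sup>2 * I)"
      by (intro mult_left_mono) auto
    then have "L2_norm (velocity t) \<le> sqrt (a\<^sup>2 * ((2 * pi) ^ 3 * I))"
      unfolding L2_norm_velocity[OF t] by (intro real_sqrt_le_mono) (simp add: mult.left_commute)
    then show ?thesis using a(1) by (simp add: Y_def real_sqrt_mult)
  qed
  have t0: "0 \<in> {0..T}" using T by simp
  have Y0: "Y \<le> L2_norm (velocity 0)" using mono[OF t0, of 1] bounds(3)[OF t0] by simp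
  have Ypos: "Y > 0"
  proof -
    let ?z = "(1/2) *\<^sub>R (lo + hi)"
    have "?z \<in> box lo hi" using lohi(1) by (auto simp: mem_box_cart)
    moreover have "lo \<in> - box lo hi" by (simp add: mem_box_cart)
    ultimately have "\<beta> ?z > 0"
      unfolding \<beta>_def by (intro infdist_pos_not_in_closed) (auto intro: closed_Compl open_box)
    then have "X ?z \<noteq> 0" using \<beta>0[of "- ?z"] by (simp add: X_def)
    from integral_square_pos[OF Xc XI this] show ?thesis by (simp add: Y_def I_def)
  qed
  have "\<exists>x. velocity 0 x \<noteq> 0"
  proof (rule ccontr)
    assume "\<nexists>x. velocity 0 x \<noteq> 0"
    then have "L2_norm (velocity 0) = 0" by (simp add: L2_norm_def)
    with Y0 Ypos show False by simp
  qed
  then have nonzero: "\<exists>t\<in>{0..T}. \<exists>x. velocity t x \<noteq> 0" using t0 by blast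
  have Nn: "0 \<le> L2_norm v" for v
    by (auto simp: L2_norm_def intro!: Bochner_Integration.integral_nonneg)
  have ratio: "\<forall>t\<in>{0..T}. (exp (t * \<Lambda>) - \<epsilon>) * L2_norm (velocity 0) \<le> L2_norm (velocity t) \<and>
      L2_norm (velocity t) \<le> (exp (t * \<Lambda>) + \<epsilon>) * L2_norm (velocity 0)"
  proof
    fix t assume t: "t \<in> {0..T}"
    note r = L2_ratio_bounds[of T "\<lambda>t. L2_norm (velocity t)" \<Lambda> \<epsilon>' Y \<epsilon> t, OF _ _ Y0 _ Nn _ \<Lambda>0 \<epsilon> \<epsilon>'_def t]
    have "L2_norm (velocity t) \<le> (exp (\<Lambda> * t) + \<epsilon>') * Y" if "t \<in> {0..T}" for t
      by (rule up[OF that]) (use \<epsilon>' bounds(2)[OF that] in \<open>auto simp: add_nonneg_nonneg\<close>)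
    moreover have "(exp (\<Lambda> * t) - \<epsilon>') * Y \<le> L2_norm (velocity t)" if "t \<in> {0..T}" for t
      by (rule mono[OF that]) (rule bounds(1)[OF that])
    ultimately show "(exp (t * \<Lambda>) - \<epsilon>) * L2_norm (velocity 0) \<le> L2_norm (velocity t) \<and>
      L2_norm (velocity t) \<le> (exp (t * \<Lambda>) + \<epsilon>) * L2_norm (velocity 0)"
      using r Ypos T by (simp add: mult.commute)
  qed
  show ?thesis
    by (intro exI[of _ velocity] exI[of _ pressure] conjI allI linearized_solution_wave_packet nonzero ratio
        C_sobolev_velocity C_sobolev_gradient_pressure sobolev_norm_velocity t0)
qed

theorem theorem1p2:
  fixes f \<nu> \<Lambda> :: real
  assumes "0 < f" and "f < 1" and "\<nu> > 0"
    and "\<Lambda> = sqrt (f * (1 - f))"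
  shows "\<exists>C :: nat \<Rightarrow> real. (\<forall>k\<ge>1. C k > 0) \<and>
    (\<forall>T>0. \<forall>\<epsilon>>0. \<exists>(u :: real \<Rightarrow> real^3 \<Rightarrow> real^3) (q :: real \<Rightarrow> real^3 \<Rightarrow> real).
      linearized_solution f \<nu> T u q \<and>
      (\<exists>t\<in>{0..T}. \<exists>x. u t x \<noteq> 0) \<and>
      (\<forall>k. C_sobolev T k u) \<and>
      (\<forall>k. C_sobolev T k (\<lambda>t. gradient (q t))) \<and>
      (\<forall>t\<in>{0..T}. (exp (t * \<Lambda>) - \<epsilon>) * L2_norm (u 0) \<le> L2_norm (u t) \<and>
                  L2_norm (u t) \<le> (exp (t * \<Lambda>) + \<epsilon>) * L2_norm (u 0)) \<and>
      (\<forall>k\<ge>1. sobolev_norm k (u 0) \<le> C k * L2_norm (u 0)))"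
proof (intro exI[of _ "\<lambda>k. sqrt (2 ^ k)"] conjI allI impI)
  fix T \<epsilon> :: real assume "0 < T" "0 < \<epsilon>"
  from growing_solution_exists[OF assms this]
  show "\<exists>(u :: real \<Rightarrow> real^3 \<Rightarrow> real^3) (q :: real \<Rightarrow> real^3 \<Rightarrow> real).
      linearized_solution f \<nu> T u q \<and>
      (\<exists>t\<in>{0..T}. \<exists>x. u t x \<noteq> 0) \<and>
      (\<forall>k. C_sobolev T k u) \<and>
      (\<forall>k. C_sobolev T k (\<lambda>t. gradient (q t))) \<and>
      (\<forall>t\<in>{0..T}. (exp (t * \<Lambda>) - \<epsilon>) * L2_norm (u 0) \<le> L2_norm (u t) \<and>
                  L2_norm (u t) \<le> (exp (t * \<Lambda>) + \<epsilon>) * L2_norm (u 0)) \<and>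
      (\<forall>k\<ge>1. sobolev_norm k (u 0) \<le> sqrt (2 ^ k) * L2_norm (u 0))"
    by blast
qed simp

end
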